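(* Let $X$ be a spectrally negative Lévy process with Laplace exponent $\psi$, right-inverse $\Phi$ of $\psi$, and scale functions $W^{(p)}$, and let $q>0$. For $\lambda>0$ define the probability measures $\mu_1^\lambda$ on $[0,\infty)$ and $\mu_2^\lambda$ on $\mathbb R$ by $$\mu_1^\lambda(\mathrm dy):=\frac{\Phi(q)}{\Phi(q+\lambda)}\Big(\delta_0(\mathrm dy)+1_{\{y>0\}}(\Phi(q+\lambda)-\Phi(q))e^{-\Phi(q)y}\,\mathrm dy\Big),$$ $$\mu_2^\lambda(\mathrm du):=\frac{(q+\lambda)\Phi(q)}{\Phi(q+\lambda)}\Big[g^{(q+\lambda)}(u)+(\Phi(q+\lambda)-\Phi(q))\int_0^\infty e^{-\Phi(q)y}g^{(q+\lambda)}(u-y)\,\mathrm dy\Big]\mathrm du,$$ where $g^{(p)}(u):=\dfrac{e^{-\Phi(p)u}}{\psi'(\Phi(p))}-W^{(p)}(-u)$, $u\in\mathbb R$. Let $\mu$ be the probability measure on $[0,\infty)$ determined by $$\int_{[0,\infty)}e^{-\theta y}\mu(\mathrm dy)=\frac{\Phi(q)}{\Phi(q)+\theta},\qquad\theta\ge0.$$ Then $\mu_1^\lambda$ and $\mu_2^\lambda$ both converge weakly to $\mu$ as $\lambda\to\infty$.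
   Context: A spectrally negative Lévy process is a real-valued Lévy process without positive jumps whose paths are not a.s. monotone. With $X(0)=0$, $\psi(\theta)=\log\mathbb E[e^{\theta X(1)}]$, $\theta\ge0$, and $\Phi(p):=\sup\{s\ge0:\psi(s)=p\}$, $p\ge0$. The $p$-scale function $W^{(p)}:\mathbb R\to[0,\infty)$ is zero on $(-\infty,0)$, and on $[0,\infty)$ is the continuous strictly increasing function with $\int_0^\infty e^{-\theta x}W^{(p)}(x)\,\mathrm dx=1/(\psi(\theta)-p)$ for $\theta>\Phi(p)$. $\delta_0$ is the Dirac measure at $0$. Measures on $[0,\infty)$ are regarded as measures on $\mathbb R$ when needed. The function $g^{(p)}$ is the density of the $p$-resolvent: $\mathbb E[\int_0^\infty e^{-ps}1_A(X(s))\,\mathrm ds]=\int_Ag^{(p)}(u)\,\mathrm du$ for Borel $A\subset\mathbb R$ and $p>0$. *)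

theory Defs
  imports "HOL-Probability.Probability"
begin

text \<open>The time set is \<open>[0, \<infinity>)\<close>: the values of \<open>X\<close> at negative times are irrelevant.\<close>

locale levy_process = prob_space M for M :: "'a measure" +
  fixes X :: "real \<Rightarrow> 'a \<Rightarrow> real"
  assumes X_measurable: "\<And>t. 0 \<le> t \<Longrightarrow> X t \<in> borel_measurable M"
    and X_zero: "AE \<omega> in M. X 0 \<omega> = 0"
    and indep_increments:
      "\<And>(n::nat) (t :: nat \<Rightarrow> real). 0 \<le> t 0 \<Longrightarrow> mono t \<Longrightarrow>
         indep_vars (\<lambda>_. borel) (\<lambda>i \<omega>. X (t (Suc i)) \<omega> - X (t i) \<omega>) {..<n}"
    and stationary_increments:
      "\<And>s t. 0 \<le> s \<Longrightarrow> s \<le> t \<Longrightarrow>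
         distr M borel (\<lambda>\<omega>. X t \<omega> - X s \<omega>) = distr M borel (X (t - s))"
    and cadlag:
      "AE \<omega> in M. (\<forall>t\<ge>0. continuous (at_right t) (\<lambda>s. X s \<omega>)) \<and>
                   (\<forall>t>0. \<exists>l. ((\<lambda>s. X s \<omega>) \<longlongrightarrow> l) (at_left t))"

locale spectrally_negative_levy_process = levy_process M X
  for M :: "'a measure" and X :: "real \<Rightarrow> 'a \<Rightarrow> real" +
  assumes no_positive_jumps:
      "AE \<omega> in M. \<forall>t>0. \<forall>l. ((\<lambda>s. X s \<omega>) \<longlongrightarrow> l) (at_left t) \<longrightarrow> X t \<omega> \<le> l"
    and not_monotone:
      "\<not> (AE \<omega> in M. mono_on {0..} (\<lambda>t. X t \<omega>) \<or> antimono_on {0..} (\<lambda>t. X t \<omega>))"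

definition laplace_exponent :: "'a measure \<Rightarrow> (real \<Rightarrow> 'a \<Rightarrow> real) \<Rightarrow> real \<Rightarrow> real" where
  "laplace_exponent M X \<theta> = ln (\<integral>\<omega>. exp (\<theta> * X 1 \<omega>) \<partial>M)"

definition right_inverse :: "(real \<Rightarrow> real) \<Rightarrow> real \<Rightarrow> real" where
  "right_inverse \<psi> p = Sup {s. 0 \<le> s \<and> \<psi> s = p}"

definition is_scale_function :: "(real \<Rightarrow> real) \<Rightarrow> real \<Rightarrow> (real \<Rightarrow> real) \<Rightarrow> bool" where
  "is_scale_function \<psi> p w \<longleftrightarrow>
     (\<forall>x<0. w x = 0) \<and> (\<forall>x\<ge>0. 0 \<le> w x) \<and>
     continuous_on {0..} w \<and> strict_mono_on {0..} w \<and>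
     (\<forall>\<theta> > right_inverse \<psi> p.
        set_integrable lborel {0..} (\<lambda>x. exp (- \<theta> * x) * w x) \<and>
        (LBINT x:{0..}. exp (- \<theta> * x) * w x) = 1 / (\<psi> \<theta> - p))"

definition resolvent_density ::
    "(real \<Rightarrow> real) \<Rightarrow> (real \<Rightarrow> real \<Rightarrow> real) \<Rightarrow> real \<Rightarrow> real \<Rightarrow> real" where
  "resolvent_density \<psi> W p u =
     exp (- right_inverse \<psi> p * u) / deriv \<psi> (right_inverse \<psi> p) - W p (- u)"

text \<open>Measures on \<open>[0, \<infinity>)\<close> are regarded as Borel measures on the real line.
  The parameter \<open>r\<close> is the \<open>\<lambda>\<close> of the measures. The coercion \<open>ennreal\<close> truncates
  negative values; the densities below are nonnegative for scale functions \<open>W\<close> (almost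
  everywhere), although no single term of \<open>mu2\<close> shows it.\<close>

definition mu1 :: "(real \<Rightarrow> real) \<Rightarrow> real \<Rightarrow> real \<Rightarrow> real measure" where
  "mu1 \<psi> q r =
     (let \<Phi> = right_inverse \<psi> in
      measure_of UNIV (sets borel) (\<lambda>A.
        ennreal (\<Phi> q / \<Phi> (q + r)) *
        (emeasure (return borel 0) A +
         (\<integral>\<^sup>+y \<in> A. indicator {0<..} y * ennreal ((\<Phi> (q + r) - \<Phi> q) * exp (- \<Phi> q * y)) \<partial>lborel))))"

definition mu2 :: "(real \<Rightarrow> real) \<Rightarrow> (real \<Rightarrow> real \<Rightarrow> real) \<Rightarrow> real \<Rightarrow> real \<Rightarrow> real measure" where
  "mu2 \<psi> W q r =
     (let \<Phi> = right_inverse \<psi>; g = resolvent_density \<psi> W (q + r) in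
      density lborel (\<lambda>u. ennreal (
        (q + r) * \<Phi> q / \<Phi> (q + r) *
        (g u + (\<Phi> (q + r) - \<Phi> q) * (LBINT y:{0..}. exp (- \<Phi> q * y) * g (u - y))))))"

definition limit_law :: "(real \<Rightarrow> real) \<Rightarrow> real \<Rightarrow> real measure \<Rightarrow> bool" where
  "limit_law \<psi> q \<mu> \<longleftrightarrow>
     real_distribution \<mu> \<and> (AE y in \<mu>. 0 \<le> y) \<and>
     (\<forall>\<theta>\<ge>0. (LINT y:{0..}|\<mu>. exp (- \<theta> * y)) = right_inverse \<psi> q / (right_inverse \<psi> q + \<theta>))"

text \<open>Weak convergence along an arbitrary filter, by bounded continuous test functions;
  \<open>weak_conv_m\<close> only covers sequences, where the two notions agree.\<close>

definition weak_conv_along :: "('i \<Rightarrow> real measure) \<Rightarrow> real measure \<Rightarrow> 'i filter \<Rightarrow> bool" where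
  "weak_conv_along N \<mu> F \<longleftrightarrow>
     (\<forall>f :: real \<Rightarrow> real. continuous_on UNIV f \<and> bounded (range f) \<longrightarrow>
        ((\<lambda>i. \<integral>x. f x \<partial>N i) \<longlongrightarrow> (\<integral>x. f x \<partial>\<mu>)) F)"

lemma weak_conv_along_sequentially_iff:
  assumes N: "\<And>n. real_distribution (N n)" and \<mu>: "real_distribution \<mu>"
  shows "weak_conv_along N \<mu> sequentially \<longleftrightarrow> weak_conv_m N \<mu>"
proof
  assume *: "weak_conv_along N \<mu> sequentially"
  show "weak_conv_m N \<mu>"
  proof (rule integral_cts_step_conv_imp_weak_conv[OF N \<mu>])
    fix x y :: real assume "x < y"
    then have c: "continuous_on UNIV (cts_step x y)"
      by (rule uniformly_continuous_imp_continuous[OF cts_step_uniformly_continuous])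
    have b: "bounded (range (cts_step x y))"
      using \<open>x < y\<close> by (intro boundedI[of _ 1]) (auto simp: cts_step_def divide_simps)
    show "(\<lambda>n. integral\<^sup>L (N n) (cts_step x y)) \<longlonglongrightarrow> integral\<^sup>L \<mu> (cts_step x y)"
      using * b c unfolding weak_conv_along_def by blast
  qed
next
  assume *: "weak_conv_m N \<mu>"
  show "weak_conv_along N \<mu> sequentially"
    unfolding weak_conv_along_def
  proof (intro allI impI)
    fix f :: "real \<Rightarrow> real" assume f: "continuous_on UNIV f \<and> bounded (range f)"
    then obtain B where "\<And>x. norm (f x) \<le> B"
      by (auto simp: bounded_iff)
    then show "(\<lambda>n. \<integral>x. f x \<partial>N n) \<longlonglongrightarrow> (\<integral>x. f x \<partial>\<mu>)"
      using f by (intro weak_conv_imp_integral_bdd_continuous_conv[OF N \<mu> *])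
        (auto simp: continuous_on_eq_continuous_at)
  qed
qed

end

theory Submission
  imports Defs "HOL-Complex_Analysis.Complex_Analysis" "HOL-Real_Asymp.Real_Asymp"
begin

text \<open>Let \<open>R\<^sub>p\<close> be the law of \<open>X\<close> at an independent exponential time of rate \<open>p\<close>. Its transform is
  \<open>E exp (\<theta> U) = p / (p - \<psi> \<theta>)\<close> for \<open>0 \<le> \<theta> < \<Phi> p\<close>, and \<open>mu2\<close> is the convolution of \<open>mu1\<close> with
  \<open>R\<^sub>p\<close> for \<open>p = q + r\<close>. As \<open>p \<rightarrow> \<infinity>\<close> the first two exponential moments of \<open>R\<^sub>p\<close> tend to \<open>1\<close>, so
  \<open>R\<^sub>p\<close> concentrates at \<open>0\<close>; and \<open>mu1\<close> is a mixture of \<open>\<delta>\<^sub>0\<close> and the exponential law of rate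
  \<open>\<Phi> q\<close>, with the weight of \<open>\<delta>\<^sub>0\<close> tending to \<open>0\<close>.

  The main point is that \<open>R\<^sub>p\<close> has the density \<open>p g\<^sup>(\<^sup>p\<^sup>)\<close>; in particular \<open>g\<^sup>(\<^sup>p\<^sup>) \<ge> 0\<close>. The transforms of
  \<open>R\<^sub>p / p\<close> (left of the line \<open>Re z = \<Phi> p\<close>) and of \<open>W\<^sup>(\<^sup>p\<^sup>)(-u) du\<close> (right of it) are, up to sign, the same
  meromorphic function \<open>1 / (p - \<psi> z)\<close>, whose continuation across the line is provided by \<open>R\<^sub>r\<close>
  with \<open>r > p\<close>; on the line its only pole is the simple one at \<open>\<Phi> p\<close>. Approaching the line from
  both sides, the sum of the two tilted measures has the same Fourier transform, on compacts and in
  the limit, as Lebesgue measure divided by \<open>\<psi>' (\<Phi> p)\<close>. The test functions \<open>(2 sin (b u) / u)\<^sup>2\<close>,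
  whose Fourier transforms have compact support, turn this into equality of measures.\<close>

section \<open>Measures and exponential transforms\<close>

text \<open>The two transforms have no common strip of convergence: one converges left of the line
  through \<open>\<Phi> p\<close>, the other right of it. Uniqueness of two-sided transforms
  therefore does not apply, and the summand \<open>exp (- \<Phi> p * u) / \<psi>' (\<Phi> p)\<close>
  of the density cannot be seen from either side, since its own transform converges nowhere. It
  reappears as the residue at \<open>\<Phi> p\<close>. Along the line only continuity of the regular
  part on compact sets is available, no decay, and the sum of the measures tilted to the line itself
  is infinite; hence kernels with compactly supported Fourier transform, squared to be integrable.
  \<open>\<psi>\<close> stays a function of a real argument throughout:
  \<open>1 / (r - \<psi>)\<close> is continued by the transform of \<open>R\<^sub>r\<close>, and
  \<open>1 / (p - \<psi>)\<close> is built from it. Until its density is found,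
  \<open>R\<^sub>p\<close> is an abstract measure, which is why sums of measures occur and not sums
  of densities. Finiteness of the exponential moments of \<open>X\<close> is extracted from the
  equation that defines scale functions.\<close>

definition add_measure :: "'a measure \<Rightarrow> 'a measure \<Rightarrow> 'a measure" where
  "add_measure N1 N2 = measure_of (space N1) (sets N1) (\<lambda>A. emeasure N1 A + emeasure N2 A)"

lemma space_add_measure [simp]: "space (add_measure N1 N2) = space N1"
  and sets_add_measure [measurable_cong, simp]: "sets (add_measure N1 N2) = sets N1"
  by (simp_all add: add_measure_def)

lemma emeasure_add_measure:
  assumes "sets N2 = sets N1" "A \<in> sets N1"
  shows "emeasure (add_measure N1 N2) A = emeasure N1 A + emeasure N2 A"
  unfolding add_measure_def
proof (rule emeasure_measure_of_sigma)
  show "sigma_algebra (space N1) (sets N1)" by (rule sets.sigma_algebra_axioms)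
  show "positive (sets N1) (\<lambda>A. emeasure N1 A + emeasure N2 A)"
    by (simp add: positive_def)
  show "countably_additive (sets N1) (\<lambda>A. emeasure N1 A + emeasure N2 A)"
    unfolding countably_additive_def
  proof (intro allI impI)
    fix A :: "nat \<Rightarrow> _"
    assume "range A \<subseteq> sets N1" "disjoint_family A"
    then have "(\<Sum>i. emeasure N1 (A i)) = emeasure N1 (\<Union> (range A))"
      "(\<Sum>i. emeasure N2 (A i)) = emeasure N2 (\<Union> (range A))"
      using assms(1) by (simp_all add: suminf_emeasure)
    then show "(\<Sum>i. emeasure N1 (A i) + emeasure N2 (A i)) =
        emeasure N1 (\<Union> (range A)) + emeasure N2 (\<Union> (range A))"
      by (subst suminf_add[symmetric]) auto
  qed
qed (rule assms)

text \<open>Induction over measurable functions. In the limit step suprema commute with the sum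
  because both sequences of integrals increase.\<close>

lemma nn_integral_add_measure:
  assumes sets: "sets N2 = sets N1" and "f \<in> borel_measurable N1"
  shows "(\<integral>\<^sup>+x. f x \<partial>add_measure N1 N2) = (\<integral>\<^sup>+x. f x \<partial>N1) + (\<integral>\<^sup>+x. f x \<partial>N2)"
  using assms(2)
proof (induction rule: borel_measurable_induct)
  case (cong f g)
  have "space N2 = space N1" using sets by (rule sets_eq_imp_space_eq)
  then have *: "(\<integral>\<^sup>+x. f x \<partial>add_measure N1 N2) = (\<integral>\<^sup>+x. g x \<partial>add_measure N1 N2)"
    "(\<integral>\<^sup>+x. f x \<partial>N1) = (\<integral>\<^sup>+x. g x \<partial>N1)" "(\<integral>\<^sup>+x. f x \<partial>N2) = (\<integral>\<^sup>+x. g x \<partial>N2)"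
    using cong(3) by (auto intro!: nn_integral_cong)
  show ?case unfolding * by (rule cong.IH)
next
  case (set A)
  then show ?case using sets by (simp add: emeasure_add_measure)
next
  case (mult u c)
  have "u \<in> borel_measurable N2" "u \<in> borel_measurable (add_measure N1 N2)"
    using mult by (simp_all add: measurable_cong_sets[OF sets refl] measurable_cong_sets[OF sets_add_measure refl])
  with mult show ?case by (simp add: nn_integral_cmult distrib_left)
next
  case (add u v)
  have "u \<in> borel_measurable N2" "u \<in> borel_measurable (add_measure N1 N2)"
     "v \<in> borel_measurable N2" "v \<in> borel_measurable (add_measure N1 N2)"
    using add by (simp_all add: measurable_cong_sets[OF sets refl] measurable_cong_sets[OF sets_add_measure refl])
  with add show ?case by (simp add: nn_integral_add add_ac)
next
  case (seq U)
  have m: "U i \<in> borel_measurable N2" "U i \<in> borel_measurable (add_measure N1 N2)" for i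
    using seq by (simp_all add: measurable_cong_sets[OF sets refl] measurable_cong_sets[OF sets_add_measure refl])
  have s: "incseq (\<lambda>i. \<integral>\<^sup>+x. U i x \<partial>N)" for N
    using seq(3) by (auto simp: incseq_def le_fun_def intro!: nn_integral_mono)
  have "(\<integral>\<^sup>+x. (SUP i. U i) x \<partial>N) = (SUP i. \<integral>\<^sup>+x. U i x \<partial>N)"
    if "\<And>i. U i \<in> borel_measurable N" for N
    using nn_integral_monotone_convergence_SUP[OF seq(3) that] by (simp add: SUP_apply image_image)
  note * = this[OF m(1)] this[OF m(2)] this[OF seq(1)]
  show ?case unfolding * seq.IH
    by (rule ennreal_SUP_add[OF s s])
qed

lemma integral_add_measure_real:
  fixes f :: "'a \<Rightarrow> real"
  assumes sets: "sets N2 = sets N1" and f: "integrable N1 f" "integrable N2 f"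
  shows "integrable (add_measure N1 N2) f"
    and "(\<integral>x. f x \<partial>add_measure N1 N2) = (\<integral>x. f x \<partial>N1) + (\<integral>x. f x \<partial>N2)"
proof -
  have m [measurable]: "f \<in> borel_measurable N1" "f \<in> borel_measurable N2"
    using f by auto
  have m2: "f \<in> borel_measurable (add_measure N1 N2)"
    using m by (simp cong: measurable_cong_sets)
  \<comment> \<open>The choices \<open>s = 1\<close> and \<open>s = -1\<close> give the positive and
    the negative part, as \<open>ennreal\<close> cuts off negative values.\<close>
  have *: "(\<integral>\<^sup>+x. ennreal (s * f x) \<partial>add_measure N1 N2) =
      (\<integral>\<^sup>+x. ennreal (s * f x) \<partial>N1) + (\<integral>\<^sup>+x. ennreal (s * f x) \<partial>N2)" for s :: real
    by (rule nn_integral_add_measure[OF sets]) measurable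
  have n: "(\<integral>\<^sup>+x. ennreal (norm (f x)) \<partial>add_measure N1 N2) < \<infinity>"
  proof -
    have "(\<integral>\<^sup>+x. ennreal (norm (f x)) \<partial>add_measure N1 N2) =
      (\<integral>\<^sup>+x. ennreal (norm (f x)) \<partial>N1) + (\<integral>\<^sup>+x. ennreal (norm (f x)) \<partial>N2)"
      by (rule nn_integral_add_measure[OF sets]) measurable
    then show ?thesis using f by (simp add: integrable_iff_bounded)
  qed
  show i: "integrable (add_measure N1 N2) f"
    using m2 n by (simp add: integrable_iff_bounded)
  have fin: "(\<integral>\<^sup>+x. ennreal (s * f x) \<partial>N) \<noteq> \<infinity>" if "integrable N f" for s N
  proof -
    have "integrable N (\<lambda>x. s * f x)" using that by simp
    then show ?thesis by (metis real_integrable_def infinity_ennreal_def)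
  qed
  show "(\<integral>x. f x \<partial>add_measure N1 N2) = (\<integral>x. f x \<partial>N1) + (\<integral>x. f x \<partial>N2)"
    unfolding real_lebesgue_integral_def[OF i] real_lebesgue_integral_def[OF f(1)]
      real_lebesgue_integral_def[OF f(2)]
    using *[of 1] *[of "-1"] fin[OF f(1), of 1] fin[OF f(1), of "-1"] fin[OF f(2), of 1] fin[OF f(2), of "-1"]
    by (simp add: enn2real_plus less_top)
qed

lemma integral_add_measure_complex:
  fixes f :: "'a \<Rightarrow> complex"
  assumes sets: "sets N2 = sets N1" and f: "integrable N1 f" "integrable N2 f"
  shows "integrable (add_measure N1 N2) f"
    and "(\<integral>x. f x \<partial>add_measure N1 N2) = (\<integral>x. f x \<partial>N1) + (\<integral>x. f x \<partial>N2)"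
proof -
  note R = integral_add_measure_real[OF sets integrable_Re[OF f(1)] integrable_Re[OF f(2)]]
  note I = integral_add_measure_real[OF sets integrable_Im[OF f(1)] integrable_Im[OF f(2)]]
  have "integrable (add_measure N1 N2) (\<lambda>x. complex_of_real (Re (f x)) + \<i> * complex_of_real (Im (f x)))"
    using R(1) I(1) by (intro Bochner_Integration.integrable_add integrable_mult_right integrable_of_real)
  then show i: "integrable (add_measure N1 N2) f"
    by (simp add: complex_eq[symmetric])
  show "(\<integral>x. f x \<partial>add_measure N1 N2) = (\<integral>x. f x \<partial>N1) + (\<integral>x. f x \<partial>N2)"
    using R(2) I(2) f i by (simp add: complex_eq_iff)
qed

lemma finite_measure_add_measure:
  assumes "sets N2 = sets N1" "finite_measure N1" "finite_measure N2"
  shows "finite_measure (add_measure N1 N2)"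
proof (rule finite_measureI)
  have "space N2 = space N1" using assms(1) by (rule sets_eq_imp_space_eq)
  then show "emeasure (add_measure N1 N2) (space (add_measure N1 N2)) \<noteq> \<infinity>"
    using assms finite_measure.emeasure_finite[of N1 "space N1"]
      finite_measure.emeasure_finite[of N2 "space N2"]
    by (simp add: emeasure_add_measure)
qed

section \<open>Analyticity of exponential transforms\<close>

lemma integrable_exp_complex:
  fixes z :: complex
  assumes [measurable_cong]: "sets N = sets borel" and "integrable N (\<lambda>u. exp (Re z * u))"
  shows "integrable N (\<lambda>u. exp (z * of_real u))"
  using assms(2) by (rule Bochner_Integration.integrable_bound) auto

text \<open>Differentiation under the integral produces factors \<open>u\<close> and
  \<open>u^2\<close>; they are absorbed at the cost of an arbitrarily small increase
  \<open>\<delta>\<close> of the exponent.\<close>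

lemma abs_le_exp_abs:
  fixes u \<delta> :: real
  assumes "0 < \<delta>"
  shows "\<bar>u\<bar> \<le> exp (\<delta> * \<bar>u\<bar>) / \<delta>" and "u\<^sup>2 \<le> 2 * exp (\<delta> * \<bar>u\<bar>) / \<delta>\<^sup>2"
proof -
  have "1 + \<delta> * \<bar>u\<bar> + (\<delta> * \<bar>u\<bar>)\<^sup>2 / 2 \<le> exp (\<delta> * \<bar>u\<bar>)"
    using assms by (intro exp_lower_Taylor_quadratic) auto
  moreover have "0 \<le> \<delta> * \<bar>u\<bar>" using assms by simp
  ultimately have "\<delta> * \<bar>u\<bar> \<le> exp (\<delta> * \<bar>u\<bar>)" "\<delta>\<^sup>2 * u\<^sup>2 \<le> 2 * exp (\<delta> * \<bar>u\<bar>)"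
    by (auto simp: power_mult_distrib intro: order_trans[rotated])
  then show "\<bar>u\<bar> \<le> exp (\<delta> * \<bar>u\<bar>) / \<delta>" and "u\<^sup>2 \<le> 2 * exp (\<delta> * \<bar>u\<bar>) / \<delta>\<^sup>2"
    using assms by (simp_all add: field_simps)
qed

lemma exp_abs_le_add:
  "exp (\<delta> * \<bar>u\<bar>) \<le> exp (\<delta> * u) + exp (- \<delta> * u)" for u \<delta> :: real
  by (cases "u \<ge> 0") (auto simp: abs_if)

text \<open>Differentiation under the integral with an explicit remainder: the error of the
  first-order Taylor polynomial of \<open>exp (h * u)\<close> is at most \<open>norm h ^ 2\<close>
  times an integrable function, so the difference quotient misses the derivative by
  \<open>O(norm h)\<close>.\<close>

lemma has_field_derivative_exp_transform:
  fixes N :: "real measure" and z :: complex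
  assumes sets [measurable_cong]: "sets N = sets borel"
    and int: "\<And>\<theta>. \<alpha> < \<theta> \<Longrightarrow> \<theta> < \<beta> \<Longrightarrow> integrable N (\<lambda>u. exp (\<theta> * u))"
    and z: "\<alpha> < Re z" "Re z < \<beta>"
  shows "integrable N (\<lambda>u. of_real u * exp (z * of_real u))"
    and "((\<lambda>z. \<integral>u. exp (z * of_real u) \<partial>N) has_field_derivative
          (\<integral>u. of_real u * exp (z * of_real u) \<partial>N)) (at z)"
proof -
  \<comment> \<open>One \<open>\<delta>\<close> pays for the perturbation \<open>h\<close>, a second
    one for the factor \<open>u^2\<close>; with a third of the distance to the edges,
    \<open>Re z\<close> shifted by \<open>2 * \<delta>\<close> stays inside the strip.\<close>
  define \<delta> where "\<delta> = min (\<beta> - Re z) (Re z - \<alpha>) / 3"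
  have \<delta>: "0 < \<delta>" "\<alpha> < Re z - 2 * \<delta>" "Re z + 2 * \<delta> < \<beta>"
    using z unfolding \<delta>_def by (auto simp: min_def field_simps)
  define G where "G u = exp ((Re z + 2 * \<delta>) * u) + exp ((Re z - 2 * \<delta>) * u)" for u
  have intG: "integrable N G"
    unfolding G_def using \<delta> by (intro Bochner_Integration.integrable_add int) auto
  have G: "exp (Re z * u) * exp (2 * \<delta> * \<bar>u\<bar>) \<le> G u" for u
  proof -
    have "exp (Re z * u) * exp (2 * \<delta> * \<bar>u\<bar>) \<le> exp (Re z * u) * (exp (2 * \<delta> * u) + exp (- (2 * \<delta>) * u))"
      using exp_abs_le_add[of "2 * \<delta>" u] by simp
    also have "\<dots> = G u" by (simp add: G_def algebra_simps flip: exp_add)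
    finally show ?thesis .
  qed
  have G1: "exp (Re z * u) * exp (\<delta> * \<bar>u\<bar>) \<le> G u" for u
  proof -
    have "exp (Re z * u) * exp (\<delta> * \<bar>u\<bar>) \<le> exp (Re z * u) * exp (2 * \<delta> * \<bar>u\<bar>)"
      using \<delta>(1) by (simp add: mult_right_mono)
    then show ?thesis using G[of u] by linarith
  qed
  show i1: "integrable N (\<lambda>u. of_real u * exp (z * of_real u))"
  proof (rule Bochner_Integration.integrable_bound)
    show "integrable N (\<lambda>u. G u / \<delta>)" using intG by simp
    show "AE u in N. norm (of_real u * exp (z * of_real u)) \<le> norm (G u / \<delta>)"
    proof (rule AE_I2)
      fix u
      have "norm (of_real u * exp (z * of_real u)) = \<bar>u\<bar> * exp (Re z * u)"
        by (simp add: norm_mult)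
      also have "\<dots> \<le> exp (\<delta> * \<bar>u\<bar>) / \<delta> * exp (Re z * u)"
        using abs_le_exp_abs(1)[OF \<delta>(1), of u] by (intro mult_right_mono) auto
      also have "\<dots> \<le> G u / \<delta>" using G1[of u] \<delta>(1) by (simp add: field_simps)
      also have "\<dots> \<le> norm (G u / \<delta>)" by (metis abs_ge_self real_norm_def)
      finally show "norm (of_real u * exp (z * of_real u)) \<le> norm (G u / \<delta>)" .
    qed
  qed auto
  let ?f = "\<lambda>z. \<integral>u. exp (z * of_real u) \<partial>N"
  let ?D = "\<integral>u. of_real u * exp (z * of_real u) \<partial>N"
  have i: "integrable N (\<lambda>u. exp (w * of_real u))" if "\<alpha> < Re w" "Re w < \<beta>" for w :: complex
    using that by (intro integrable_exp_complex sets int)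
  have bound: "norm ((?f (z + h) - ?f z) / h - ?D) \<le> norm h * (2 / \<delta>\<^sup>2 * (\<integral>u. G u \<partial>N))"
    if h: "h \<noteq> 0" "norm h < \<delta>" for h
  proof -
    have zh: "\<alpha> < Re (z + h)" "Re (z + h) < \<beta>"
      using abs_Re_le_cmod[of h] h \<delta> by auto
    have "?f (z + h) - ?f z - h * ?D =
        (\<integral>u. exp ((z + h) * of_real u) - exp (z * of_real u) - h * (of_real u * exp (z * of_real u)) \<partial>N)"
      using i[OF zh] i[OF z] i1 by simp
    also have "norm \<dots> \<le> (\<integral>u. (norm h)\<^sup>2 * (2 / \<delta>\<^sup>2 * G u) \<partial>N)"
    proof (rule order_trans[OF integral_norm_bound integral_mono])
      show "integrable N (\<lambda>u. norm (exp ((z + h) * of_real u) - exp (z * of_real u) - h * (of_real u * exp (z * of_real u))))"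
        by (intro integrable_norm Bochner_Integration.integrable_diff integrable_mult_right i[OF zh] i[OF z] i1)
      show "integrable N (\<lambda>u. (norm h)\<^sup>2 * (2 / \<delta>\<^sup>2 * G u))" using intG by simp
      fix u
      have "norm (exp (h * of_real u) - (\<Sum>k\<le>1. (h * of_real u) ^ k / fact k)) \<le>
          exp \<bar>Re (h * of_real u)\<bar> * norm (h * of_real u) ^ Suc 1 / fact 1"
        by (rule Taylor_exp)
      then have t: "norm (exp (h * of_real u) - 1 - h * of_real u) \<le>
          exp \<bar>Re h * u\<bar> * (norm h * \<bar>u\<bar>)\<^sup>2"
        by (simp add: norm_mult power2_eq_square algebra_simps)
      have "\<bar>Re h * u\<bar> \<le> \<delta> * \<bar>u\<bar>"
        using abs_Re_le_cmod[of h] h by (simp add: abs_mult mult_right_mono)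
      then have "exp \<bar>Re h * u\<bar> * (norm h * \<bar>u\<bar>)\<^sup>2 \<le> exp (\<delta> * \<bar>u\<bar>) * ((norm h)\<^sup>2 * (2 * exp (\<delta> * \<bar>u\<bar>) / \<delta>\<^sup>2))"
        using mult_left_mono[OF abs_le_exp_abs(2)[OF \<delta>(1), of u], of "(norm h)\<^sup>2"]
        by (intro mult_mono) (auto simp: power_mult_distrib)
      also have "\<dots> = (norm h)\<^sup>2 * (2 / \<delta>\<^sup>2 * exp (2 * \<delta> * \<bar>u\<bar>))"
        by (simp add: algebra_simps flip: exp_add)
      finally have t2: "norm (exp (h * of_real u) - 1 - h * of_real u) \<le> \<dots>" using t by linarith
      have "exp ((z + h) * of_real u) - exp (z * of_real u) - h * (of_real u * exp (z * of_real u)) =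
          exp (z * of_real u) * (exp (h * of_real u) - 1 - h * of_real u)"
        by (simp add: algebra_simps exp_add)
      also have "norm \<dots> = exp (Re z * u) * norm (exp (h * of_real u) - 1 - h * of_real u)"
        by (simp add: norm_mult)
      also have "\<dots> \<le> exp (Re z * u) * ((norm h)\<^sup>2 * (2 / \<delta>\<^sup>2 * exp (2 * \<delta> * \<bar>u\<bar>)))"
        using t2 by (intro mult_left_mono) auto
      also have "\<dots> = (norm h)\<^sup>2 * (2 / \<delta>\<^sup>2 * (exp (Re z * u) * exp (2 * \<delta> * \<bar>u\<bar>)))" by simp
      also have "\<dots> \<le> (norm h)\<^sup>2 * (2 / \<delta>\<^sup>2 * G u)"
        using G[of u] by (intro mult_left_mono) auto
      finally show "norm (exp ((z + h) * of_real u) - exp (z * of_real u) - h * (of_real u * exp (z * of_real u)))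
          \<le> (norm h)\<^sup>2 * (2 / \<delta>\<^sup>2 * G u)" .
    qed
    also have "\<dots> = norm h * (norm h * (2 / \<delta>\<^sup>2 * (\<integral>u. G u \<partial>N)))"
      by (simp add: power2_eq_square)
    finally have "norm (?f (z + h) - ?f z - h * ?D) \<le> norm h * (norm h * (2 / \<delta>\<^sup>2 * (\<integral>u. G u \<partial>N)))" .
    moreover have "(?f (z + h) - ?f z) / h - ?D = (?f (z + h) - ?f z - h * ?D) / h"
      using h by (simp add: field_simps)
    ultimately show ?thesis using h by (simp add: norm_divide divide_le_eq mult.commute)
  qed
  have "((\<lambda>h. (?f (z + h) - ?f z) / h - ?D) \<longlongrightarrow> 0) (at 0)"
  proof (rule Lim_null_comparison)
    show "eventually (\<lambda>h. norm ((?f (z + h) - ?f z) / h - ?D) \<le> norm h * (2 / \<delta>\<^sup>2 * (\<integral>u. G u \<partial>N))) (at 0)"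
      unfolding eventually_at using \<delta>(1) bound by (intro exI[of _ \<delta>]) auto
    show "((\<lambda>h. norm h * (2 / \<delta>\<^sup>2 * (\<integral>u. G u \<partial>N))) \<longlongrightarrow> 0) (at (0::complex))"
      by (intro tendsto_mult_left_zero tendsto_norm_zero tendsto_ident_at)
  qed
  then show "(?f has_field_derivative ?D) (at z)"
    unfolding DERIV_def by (simp add: LIM_zero_iff)
qed

lemma holomorphic_on_exp_transform:
  fixes N :: "real measure"
  assumes "sets N = sets borel"
    and "\<And>\<theta>. \<alpha> < \<theta> \<Longrightarrow> \<theta> < \<beta> \<Longrightarrow> integrable N (\<lambda>u. exp (\<theta> * u))"
  shows "(\<lambda>z. \<integral>u. exp (z * of_real u) \<partial>N) holomorphic_on {z. \<alpha> < Re z \<and> Re z < \<beta>}"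
proof (rule holomorphic_onI)
  fix z assume "z \<in> {z. \<alpha> < Re z \<and> Re z < \<beta>}"
  then show "(\<lambda>z. \<integral>u. exp (z * of_real u) \<partial>N) field_differentiable at z within {z. \<alpha> < Re z \<and> Re z < \<beta>}"
    using has_field_derivative_exp_transform(2)[OF assms, where z=z]
    by (auto simp: field_differentiable_def intro: has_field_derivative_at_within)
qed

lemma exp_transform_of_real:
  "(\<integral>u. exp (complex_of_real \<theta> * of_real u) \<partial>N) = of_real (\<integral>u. exp (\<theta> * u) \<partial>N)"
proof -
  have "(\<lambda>u. exp (complex_of_real \<theta> * of_real u)) = (\<lambda>u. complex_of_real (exp (\<theta> * u)))"
    by (simp add: exp_of_real[symmetric])
  then show ?thesis by simp
qed

lemma open_vertical_strip: "open {z. \<alpha> < Re z \<and> Re z < \<beta>}"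
  by (intro open_Collect_conj open_Collect_less continuous_intros)

lemma convex_vertical_strip: "convex {z. \<alpha> < Re z \<and> Re z < \<beta>}"
proof -
  have "{z. \<alpha> < Re z \<and> Re z < \<beta>} = {z. Re z > \<alpha>} \<inter> {z. Re z < \<beta>}" by auto
  then show ?thesis by (simp add: convex_Int convex_halfspace_Re_gt convex_halfspace_Re_lt)
qed

text \<open>Identity theorem: a real segment accumulates inside the strip. The complex transform
  identities below are obtained in this way from their real versions.\<close>

lemma holomorphic_vertical_strip_eqI:
  fixes f g :: "complex \<Rightarrow> complex"
  assumes "f holomorphic_on {z. \<alpha> < Re z \<and> Re z < \<beta>}" "g holomorphic_on {z. \<alpha> < Re z \<and> Re z < \<beta>}"
    and eq: "\<And>\<theta>::real. \<alpha> < \<theta> \<Longrightarrow> \<theta> < \<beta> \<Longrightarrow> f (of_real \<theta>) = g (of_real \<theta>)"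
    and z: "\<alpha> < Re z" "Re z < \<beta>"
  shows "f z = g z"
proof -
  let ?S = "{z. \<alpha> < Re z \<and> Re z < \<beta>}"
  have ab: "\<alpha> < \<beta>" using z by linarith
  have "(\<lambda>z. f z - g z) z = 0"
  proof (rule analytic_continuation[where f = "\<lambda>z. f z - g z"])
    show "(\<lambda>z. f z - g z) holomorphic_on ?S" using assms by (intro holomorphic_intros)
    show "open ?S" by (rule open_vertical_strip)
    show "connected ?S" by (rule convex_connected[OF convex_vertical_strip])
    show "of_real ` {\<alpha><..<\<beta>} \<subseteq> ?S" by auto
    have "(\<alpha> + \<beta>) / 2 \<in> {\<alpha><..<\<beta>}" using ab by auto
    then have "(\<alpha> + \<beta>) / 2 islimpt {\<alpha><..<\<beta>}"
      by (metis open_greaterThanLessThan islimpt_def interior_limit_point interior_open)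
    then obtain x where x: "\<And>n::nat. x n \<in> {\<alpha><..<\<beta>} - {(\<alpha> + \<beta>) / 2}" "x \<longlonglongrightarrow> (\<alpha> + \<beta>) / 2"
      unfolding islimpt_sequential by auto
    show "complex_of_real ((\<alpha> + \<beta>) / 2) islimpt of_real ` {\<alpha><..<\<beta>}"
      unfolding islimpt_sequential
    proof (intro exI[of _ "\<lambda>n. complex_of_real (x n)"] conjI allI)
      show "complex_of_real (x n) \<in> complex_of_real ` {\<alpha><..<\<beta>} - {complex_of_real ((\<alpha> + \<beta>) / 2)}" for n
        using x(1)[of n] by (metis DiffD1 DiffD2 DiffI imageI insertE insertI1 of_real_eq_iff singletonD)
      show "(\<lambda>n. complex_of_real (x n)) \<longlonglongrightarrow> complex_of_real ((\<alpha> + \<beta>) / 2)"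
        using x(2) by (rule tendsto_of_real)
    qed
    show "complex_of_real ((\<alpha> + \<beta>) / 2) \<in> ?S" using ab by (simp add: field_simps)
  qed (use eq z in auto)
  then show ?thesis by simp
qed

section \<open>Uniqueness of measures from their transforms\<close>

lemma integrable_exp_neg:
  assumes "real_distribution N" "AE y in N. 0 \<le> y" "\<theta> \<le> 0"
  shows "integrable N (\<lambda>u. exp (\<theta> * u))"
proof -
  interpret real_distribution N by fact
  show ?thesis
  proof (rule integrable_const_bound[where B = 1])
    show "AE y in N. norm (exp (\<theta> * y)) \<le> 1"
      using assms(2)
    proof eventually_elim
      case (elim y)
      then have "\<theta> * y \<le> 0" using assms(3) by (simp add: mult_nonpos_nonneg)
      then show ?case by simp
    qed
  qed simp
qed

text \<open>For a law on the half-line the imaginary axis bounds a half plane of analyticity. The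
  characteristic function is the limit from inside, through \<open>Re z = - 1 / (n + 1)\<close>,
  with majorant \<open>1\<close> because \<open>u \<ge> 0\<close> almost surely.\<close>

lemma char_eq_lim_exp_transform:
  assumes "real_distribution N" "AE y in N. 0 \<le> y"
  shows "(\<lambda>n. \<integral>u. exp (Complex (- 1 / real (Suc n)) t * of_real u) \<partial>N) \<longlonglongrightarrow> char N t"
proof -
  interpret real_distribution N by fact
  show ?thesis
    unfolding char_def
  proof (rule integral_dominated_convergence[where w = "\<lambda>_. 1"])
    show "AE u in N. (\<lambda>n. exp (Complex (- 1 / real (Suc n)) t * of_real u)) \<longlonglongrightarrow> iexp (t * u)"
    proof (rule AE_I2)
      fix u
      have "(\<lambda>n. exp (of_real (- 1 / real (Suc n)) * of_real u + iexp_arg))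
         \<longlonglongrightarrow> exp (of_real 0 * of_real u + iexp_arg)" for iexp_arg :: complex
        using LIMSEQ_inverse_real_of_nat[THEN tendsto_minus]
        by (intro tendsto_intros) (simp_all add: inverse_eq_divide)
      from this[of "\<i> * of_real (t * u)"]
      show "(\<lambda>n. exp (Complex (- 1 / real (Suc n)) t * of_real u)) \<longlonglongrightarrow> iexp (t * u)"
        by (simp add: Complex_eq algebra_simps)
    qed
    show "AE u in N. norm (exp (Complex (- 1 / real (Suc n)) t * of_real u)) \<le> 1" for n
      using assms(2) by eventually_elim (auto simp: divide_simps)
  qed auto
qed

text \<open>Analytic continuation carries the equality from the negative real axis into a strip, and
  the boundary limit carries it on to characteristic functions. The left edge \<open>-2\<close> only
  has to lie below \<open>-1\<close>, the leftmost of the values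
  \<open>- 1 / (n + 1)\<close>.\<close>

lemma laplace_transform_uniqueness:
  assumes N1: "real_distribution N1" "AE y in N1. 0 \<le> y"
    and N2: "real_distribution N2" "AE y in N2. 0 \<le> y"
    and eq: "\<And>\<theta>. 0 < \<theta> \<Longrightarrow> (\<integral>y. exp (- \<theta> * y) \<partial>N1) = (\<integral>y. exp (- \<theta> * y) \<partial>N2)"
  shows "N1 = N2"
proof (rule Levy_uniqueness[OF N1(1) N2(1)])
  have sets: "sets N1 = sets borel" "sets N2 = sets borel"
    using N1 N2 by (simp_all add: real_distribution.events_eq_borel)
  have "(\<integral>u. exp (Complex (- 1 / real (Suc n)) t * of_real u) \<partial>N1) =
      (\<integral>u. exp (Complex (- 1 / real (Suc n)) t * of_real u) \<partial>N2)" for n t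
  proof (rule holomorphic_vertical_strip_eqI
      [of "\<lambda>z. \<integral>u. exp (z * of_real u) \<partial>N1" "-2" 0 "\<lambda>z. \<integral>u. exp (z * of_real u) \<partial>N2"])
    show "(\<lambda>z. \<integral>u. exp (z * of_real u) \<partial>N1) holomorphic_on {z. - 2 < Re z \<and> Re z < 0}"
      by (intro holomorphic_on_exp_transform sets integrable_exp_neg[OF N1]) auto
    show "(\<lambda>z. \<integral>u. exp (z * of_real u) \<partial>N2) holomorphic_on {z. - 2 < Re z \<and> Re z < 0}"
      by (intro holomorphic_on_exp_transform sets integrable_exp_neg[OF N2]) auto
    show "(\<integral>u. exp (complex_of_real \<theta> * of_real u) \<partial>N1) = (\<integral>u. exp (complex_of_real \<theta> * of_real u) \<partial>N2)"
      if "\<theta> < 0" for \<theta>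
      using eq[of "- \<theta>"] that by (simp add: exp_transform_of_real)
  qed (auto simp: divide_simps)
  then have "(\<lambda>n. \<integral>u. exp (Complex (- 1 / real (Suc n)) t * of_real u) \<partial>N1) \<longlonglongrightarrow> char N2 t" for t
    using char_eq_lim_exp_transform[OF N2] by presburger
  then show "char N1 = char N2"
    using char_eq_lim_exp_transform[OF N1] LIMSEQ_unique by blast
qed

text \<open>Frequency \<open>0\<close> shows that both total masses agree; after normalisation,
  uniqueness for probability laws applies. Mass zero cannot be normalised and is treated
  apart.\<close>

lemma finite_measure_char_uniqueness:
  fixes N1 N2 :: "real measure"
  assumes f: "finite_measure N1" "finite_measure N2"
    and s: "sets N1 = sets borel" "sets N2 = sets borel"
    and eq: "\<And>t. (\<integral>u. iexp (t * u) \<partial>N1) = (\<integral>u. iexp (t * u) \<partial>N2)"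
  shows "N1 = N2"
proof -
  interpret A: finite_measure N1 by fact
  interpret B: finite_measure N2 by fact
  have sp: "space N1 = UNIV" "space N2 = UNIV"
    using s[THEN sets_eq_imp_space_eq] by auto
  have m: "measure N1 UNIV = measure N2 UNIV"
    using eq[of 0] by (simp add: sp)
  show ?thesis
  proof (cases "measure N1 UNIV = 0")
    case True
    then have z: "emeasure N1 UNIV = 0" "emeasure N2 UNIV = 0"
      using m by (simp_all add: A.emeasure_eq_measure B.emeasure_eq_measure)
    show ?thesis
    proof (rule measure_eqI)
      fix X assume "X \<in> sets N1"
      have "emeasure N1 X \<le> emeasure N1 UNIV" "emeasure N2 X \<le> emeasure N2 UNIV"
        by (rule emeasure_mono; simp add: s)+
      then show "emeasure N1 X = emeasure N2 X" using z by simp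
    qed (simp add: s)
  next
    case False
    define c where "c = measure N1 UNIV"
    have c: "c > 0" using False unfolding c_def by (simp add: zero_less_measure_iff)
    define P where "P N = density N (\<lambda>_. ennreal (1 / c))" for N :: "real measure"
    have rd: "real_distribution (P N)" if N: "finite_measure N" "sets N = sets borel" "measure N UNIV = c" for N
    proof -
      interpret finite_measure N by fact
      have spN: "space N = UNIV" using sets_eq_imp_space_eq[OF N(2)] by simp
      show ?thesis
        unfolding P_def
      proof (rule real_distribution.intro)
        show "prob_space (density N (\<lambda>_. ennreal (1 / c)))"
          using c N(3) by (intro prob_spaceI)
            (simp add: emeasure_density spN N(2) emeasure_eq_measure nn_integral_const flip: ennreal_mult)
        show "real_distribution_axioms (density N (\<lambda>_. ennreal (1 / c)))"
          by unfold_locales (simp add: N(2))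
      qed
    qed
    have ch: "char (P N) t = (\<integral>u. iexp (t * u) \<partial>N) / c" if "sets N = sets borel" for N t
      unfolding char_def P_def
      by (subst integral_density)
        (use c in \<open>auto simp: scaleR_conv_of_real that cong: measurable_cong_sets\<close>)
    have "char (P N1) = char (P N2)"
      by (rule ext) (simp only: ch s eq)
    then have "P N1 = P N2"
      using m by (intro Levy_uniqueness rd f s) (auto simp: c_def)
    show ?thesis
    proof (rule measure_eqI)
      fix X assume "X \<in> sets N1"
      then have X: "X \<in> sets N1" "X \<in> sets N2" by (simp_all add: s)
      have "emeasure (P N) X = ennreal (1 / c) * emeasure N X" if "X \<in> sets N" for N
        using that by (simp add: P_def emeasure_density nn_integral_cmult_indicator)
      then have "ennreal (1 / c) * emeasure N1 X = ennreal (1 / c) * emeasure N2 X"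
        using \<open>P N1 = P N2\<close> X by metis
      then show "emeasure N1 X = emeasure N2 X"
        using c by (simp add: ennreal_mult_cancel_left)
    qed (simp add: s)
  qed
qed

section \<open>Kernels with compactly supported Fourier transform\<close>

definition fejer :: "real \<Rightarrow> real \<Rightarrow> real" where
  "fejer b u = (LBINT s:{-b..b}. cos (s * u))"

lemma fejer_measurable [measurable]: "fejer b \<in> borel_measurable borel"
  unfolding fejer_def[abs_def] set_lebesgue_integral_def by measurable

text \<open>Being defined as the Fourier transform of the indicator of \<open>{-b..b}\<close>, the
  kernel is ready for Fubini and needs no convention at \<open>0\<close>. The closed form shows
  decay of order \<open>1 / u\<close> only; its square, a multiple of a Fejer kernel, is
  integrable.\<close>

lemma fejer_eq:
  assumes "0 < b"
  shows "u \<noteq> 0 \<Longrightarrow> fejer b u = 2 * sin (b * u) / u" and "fejer b 0 = 2 * b"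
proof -
  show "fejer b 0 = 2 * b" using assms by (simp add: fejer_def set_lebesgue_integral_def)
  assume u: "u \<noteq> 0"
  have "(LBINT s=-b..b. cos (s * u)) = sin (b * u) / u - sin (- b * u) / u"
  proof (rule interval_integral_FTC_finite)
    show "continuous_on {min (- b)  b..max (- b) b} (\<lambda>s. cos (s * u))"
      by (intro continuous_intros)
    show "((\<lambda>s. sin (s * u) / u) has_vector_derivative cos (x * u)) (at x within {min (- b) b..max (- b) b})" for x
      unfolding has_real_derivative_iff_has_vector_derivative[symmetric]
      using u by (auto intro!: derivative_eq_intros)
  qed
  then show "fejer b u = 2 * sin (b * u) / u"
    using assms by (simp add: fejer_def interval_integral_Icc)
qed

lemma abs_fejer_le:
  assumes "0 < b"
  shows "\<bar>fejer b u\<bar> \<le> 2 * b" and "u \<noteq> 0 \<Longrightarrow> \<bar>fejer b u\<bar> \<le> 2 / \<bar>u\<bar>"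
proof -
  show "\<bar>fejer b u\<bar> \<le> 2 * b"
  proof (cases "u = 0")
    case False
    have "\<bar>sin (b * u)\<bar> \<le> \<bar>b * u\<bar>" by (rule abs_sin_x_le_abs_x)
    then show ?thesis using False assms by (simp add: fejer_eq abs_mult divide_simps)
  qed (use assms in \<open>simp add: fejer_eq\<close>)
  show "\<bar>fejer b u\<bar> \<le> 2 / \<bar>u\<bar>" if "u \<noteq> 0"
    using that assms by (simp add: fejer_eq abs_mult divide_simps)
qed

lemma fejer_neq_0:
  assumes "0 < b" "\<bar>b * u\<bar> < pi"
  shows "fejer b u \<noteq> 0"
proof (cases "u = 0")
  case False
  have "sin (b * u) \<noteq> 0"
  proof
    assume "sin (b * u) = 0"
    then have "b * u = 0" using assms(2) sin_eq_0_pi[of "b * u"] by auto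
    then show False using False assms by simp
  qed
  then show ?thesis using False assms by (simp add: fejer_eq)
qed (use assms in \<open>simp add: fejer_eq\<close>)

lemma integrable_fejer_square:
  assumes "0 < b"
  shows "integrable lborel (\<lambda>u. (fejer b u)\<^sup>2)"
proof -
  \<comment> \<open>The constant is the sum of the bounds \<open>(2 * b)^2\<close> for
    \<open>(fejer b u)^2\<close> and \<open>2^2\<close> for
    \<open>(fejer b u * u)^2\<close>.\<close>
  have *: "integrable lborel (\<lambda>u. (4 * b\<^sup>2 + 4) * inverse (1 + u\<^sup>2))"
    using integrable_inverse_1_plus_square by (simp add: set_integrable_def)
  show ?thesis
  proof (rule Bochner_Integration.integrable_bound[OF *])
    show "AE u in lborel. norm ((fejer b u)\<^sup>2) \<le> norm ((4 * b\<^sup>2 + 4) * inverse (1 + u\<^sup>2))"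
    proof (rule AE_I2)
      fix u
      have "\<bar>fejer b u\<bar> \<le> \<bar>2 * b\<bar>"
        using abs_fejer_le(1)[OF assms, of u] assms by simp
      moreover have "\<bar>fejer b u * u\<bar> \<le> \<bar>2\<bar>"
        using abs_fejer_le(2)[OF assms, of u] by (cases "u = 0") (auto simp: abs_mult field_simps)
      ultimately have "(fejer b u)\<^sup>2 \<le> (2 * b)\<^sup>2" "(fejer b u * u)\<^sup>2 \<le> 2\<^sup>2"
        by (simp_all only: abs_le_square_iff)
      then have "(fejer b u)\<^sup>2 * (1 + u\<^sup>2) \<le> 4 * b\<^sup>2 + 4"
        by (simp add: algebra_simps power_mult_distrib)
      moreover have "0 < 1 + u\<^sup>2" by (simp add: add_pos_nonneg)
      ultimately have "(fejer b u)\<^sup>2 \<le> (4 * b\<^sup>2 + 4) * inverse (1 + u\<^sup>2)"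
        by (simp add: field_simps)
      then show "norm ((fejer b u)\<^sup>2) \<le> norm ((4 * b\<^sup>2 + 4) * inverse (1 + u\<^sup>2))"
        by (metis abs_ge_self abs_of_nonneg order_trans real_norm_def zero_le_power2)
    qed
  qed measurable
qed

text \<open>Fubini: pairing with the kernel sees only the frequencies in \<open>{-b..b}\<close>. The
  factor \<open>f\<close> is kept general so that the kernel can be applied a second time.\<close>

lemma integral_fejer:
  fixes f :: "real \<Rightarrow> complex"
  assumes "0 < b" and N: "finite_measure N" "sets N = sets borel"
    and f: "f \<in> borel_measurable borel" "\<And>u. norm (f u) \<le> B"
  shows "(\<integral>u. of_real (fejer b u) * f u \<partial>N) = (LBINT s:{-b..b}. \<integral>u. iexp (s * u) * f u \<partial>N)"
    and "integrable lborel (\<lambda>s. indicator {-b..b} s *\<^sub>R (\<integral>u. iexp (s * u) * f u \<partial>N))"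
proof -
  interpret finite_measure N by fact
  note [measurable] = f(1)
  note [measurable_cong] = N(2)
  interpret pair_sigma_finite N lborel
    by (rule pair_sigma_finite.intro) (auto intro: sigma_finite_measure sigma_finite_lborel)
  interpret Q: pair_sigma_finite lborel N
    by (rule pair_sigma_finite.intro) (auto intro: sigma_finite_measure sigma_finite_lborel)
  let ?g = "\<lambda>u s. indicator {-b..b} s *\<^sub>R (iexp (s * u) * f u)"
  have i: "integrable (N \<Otimes>\<^sub>M lborel) (case_prod ?g)"
  proof (rule Fubini_integrable)
    show "case_prod ?g \<in> borel_measurable (N \<Otimes>\<^sub>M lborel)" by measurable
    have b: "norm (?g u s) = indicator {-b..b} s * norm (f u)" for u s
      by (simp add: norm_mult indicator_def)
    show "integrable N (\<lambda>u. \<integral>s. norm (case_prod ?g (u, s)) \<partial>lborel)"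
      unfolding prod.case b using assms
      by (simp, intro integrable_mult_right integrable_mult_left integrable_const_bound[where B = B]) auto
    show "AE u in N. integrable lborel (\<lambda>s. case_prod ?g (u, s))"
    proof (rule AE_I2)
      fix u
      have "integrable lborel (\<lambda>s. indicator {-b..b} s *\<^sub>R (iexp (s * u) * f u))"
        by (intro borel_integrable_compact continuous_intros) auto
      then show "integrable lborel (\<lambda>s. case_prod ?g (u, s))" by simp
    qed
  qed
  have e: "(LBINT s:{-b..b}. iexp (s * u)) = of_real (fejer b u)" for u
  proof -
    have si: "set_integrable lborel {-b..b} (\<lambda>s. iexp (s * u))"
      unfolding set_integrable_def by (rule borel_integrable_compact) (auto intro!: continuous_intros)
    \<comment> \<open>The sine is odd, so the complex exponential integrates to the real
      kernel.\<close>
    have "(LBINT s=-b..b. sin (s * u)) = 0"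
      using interval_integral_reflect[of "-b" b "\<lambda>s. sin (s * u)"]
      by (simp add: interval_lebesgue_integral_uminus)
    then have s0: "(LBINT s:{-b..b}. sin (s * u)) = 0"
      using assms by (simp add: interval_integral_Icc)
    show ?thesis
    proof (rule complex_eqI)
      show "Re (LBINT s:{-b..b}. iexp (s * u)) = Re (of_real (fejer b u))"
        using si unfolding set_lebesgue_integral_def set_integrable_def fejer_def
        by (subst integral_Re[symmetric]) (auto simp: Re_exp)
      show "Im (LBINT s:{-b..b}. iexp (s * u)) = Im (of_real (fejer b u))"
        using si s0 unfolding set_lebesgue_integral_def set_integrable_def
        by (subst integral_Im[symmetric]) (auto simp: Im_exp)
    qed
  qed
  have "(\<integral>u. of_real (fejer b u) * f u \<partial>N) = (\<integral>u. \<integral>s. ?g u s \<partial>lborel \<partial>N)"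
  proof (rule Bochner_Integration.integral_cong)
    fix u
    have "(\<integral>s. ?g u s \<partial>lborel) = (\<integral>s. (indicator {-b..b} s *\<^sub>R iexp (s * u)) * f u \<partial>lborel)"
      by simp
    also have "\<dots> = (LBINT s:{-b..b}. iexp (s * u)) * f u"
      unfolding set_lebesgue_integral_def by (rule integral_mult_left_zero)
    finally show "of_real (fejer b u) * f u = (\<integral>s. ?g u s \<partial>lborel)" by (simp only: e)
  qed simp
  also have "\<dots> = (\<integral>s. \<integral>u. ?g u s \<partial>N \<partial>lborel)"
    using Fubini_integral[OF i] by simp
  also have "\<dots> = (LBINT s:{-b..b}. \<integral>u. iexp (s * u) * f u \<partial>N)"
    unfolding set_lebesgue_integral_def by simp
  finally show "(\<integral>u. of_real (fejer b u) * f u \<partial>N) = \<dots>" .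
  have "integrable lborel (\<lambda>s. \<integral>u. ?g u s \<partial>N)"
    using Q.integrable_fst'[OF integrable_product_swap[OF i]] by simp
  then show "integrable lborel (\<lambda>s. indicator {-b..b} s *\<^sub>R (\<integral>u. iexp (s * u) * f u \<partial>N))" by simp
qed

text \<open>Closeness of Fourier transforms on the window passes to the kernel integrals; the loss
  \<open>2 * b\<close> is the length of the window.\<close>

lemma norm_integral_fejer_diff_le:
  fixes f :: "real \<Rightarrow> complex"
  assumes b: "0 < b" and N: "finite_measure N" "sets N = sets borel"
    and N': "finite_measure N'" "sets N' = sets borel"
    and f: "f \<in> borel_measurable borel" "\<And>u. norm (f u) \<le> B"
    and le: "\<And>s. \<bar>s\<bar> \<le> b \<Longrightarrow> norm ((\<integral>u. iexp (s * u) * f u \<partial>N) - (\<integral>u. iexp (s * u) * f u \<partial>N')) \<le> \<delta>"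
  shows "norm ((\<integral>u. of_real (fejer b u) * f u \<partial>N) - (\<integral>u. of_real (fejer b u) * f u \<partial>N')) \<le> 2 * b * \<delta>"
proof -
  note * = integral_fejer[OF b N f] integral_fejer[OF b N' f]
  have "(\<integral>u. of_real (fejer b u) * f u \<partial>N) - (\<integral>u. of_real (fejer b u) * f u \<partial>N') =
     (\<integral>s. indicator {-b..b} s *\<^sub>R ((\<integral>u. iexp (s * u) * f u \<partial>N) - (\<integral>u. iexp (s * u) * f u \<partial>N')) \<partial>lborel)"
    unfolding *(1,3) set_lebesgue_integral_def using *(2,4) by (simp add: scaleR_diff_right)
  also have "norm \<dots> \<le> (\<integral>s. indicator {-b..b} s * \<delta> \<partial>lborel)"
  proof (rule order_trans[OF integral_norm_bound integral_mono])
    show "integrable lborel (\<lambda>s. norm (indicator {-b..b} s *\<^sub>R ((\<integral>u. iexp (s * u) * f u \<partial>N) - (\<integral>u. iexp (s * u) * f u \<partial>N'))))"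
      using *(2,4) by (intro integrable_norm) (simp add: scaleR_diff_right)
    show "norm (indicator {-b..b} s *\<^sub>R ((\<integral>u. iexp (s * u) * f u \<partial>N) - (\<integral>u. iexp (s * u) * f u \<partial>N'))) \<le> indicator {-b..b} s * \<delta>" for s
      using le[of s] by (auto simp: indicator_def)
  qed (use b in auto)
  finally show ?thesis using b by simp
qed

text \<open>The two kernel factors are peeled off one at a time. Each shifts the frequency
  \<open>a\<close> by at most \<open>b\<close>, whence the window
  \<open>\<bar>a\<bar> + 2 * b\<close>, and each costs a factor \<open>2 * b\<close>.\<close>

lemma norm_integral_fejer_square_diff_le:
  assumes b: "0 < b" and N: "finite_measure N" "sets N = sets borel"
    and N': "finite_measure N'" "sets N' = sets borel"
    and le: "\<And>\<eta>. \<bar>\<eta>\<bar> \<le> \<bar>a\<bar> + 2 * b \<Longrightarrow> norm ((\<integral>u. iexp (\<eta> * u) \<partial>N) - (\<integral>u. iexp (\<eta> * u) \<partial>N')) \<le> \<delta>"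
  shows "norm ((\<integral>u. of_real ((fejer b u)\<^sup>2) * iexp (a * u) \<partial>N) - (\<integral>u. of_real ((fejer b u)\<^sup>2) * iexp (a * u) \<partial>N'))
      \<le> 2 * b * (2 * b * \<delta>)"
proof -
  have "norm ((\<integral>u. of_real (fejer b u) * (of_real (fejer b u) * iexp (a * u)) \<partial>N) -
      (\<integral>u. of_real (fejer b u) * (of_real (fejer b u) * iexp (a * u)) \<partial>N')) \<le> 2 * b * (2 * b * \<delta>)"
  proof (rule norm_integral_fejer_diff_le[OF b N N'])
    show "norm (of_real (fejer b u) * iexp (a * u)) \<le> 2 * b" for u
      using abs_fejer_le(1)[OF b, of u] by (simp add: norm_mult)
    fix s :: real assume s: "\<bar>s\<bar> \<le> b"
    have "norm ((\<integral>u. of_real (fejer b u) * iexp ((s + a) * u) \<partial>N) -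
        (\<integral>u. of_real (fejer b u) * iexp ((s + a) * u) \<partial>N')) \<le> 2 * b * \<delta>"
    proof (rule norm_integral_fejer_diff_le[OF b N N', where B = 1])
      fix s' :: real assume s': "\<bar>s'\<bar> \<le> b"
      have "\<bar>s' + (s + a)\<bar> \<le> \<bar>a\<bar> + 2 * b" using s s' by linarith
      from le[OF this]
      show "norm ((\<integral>u. iexp (s' * u) * iexp ((s + a) * u) \<partial>N) -
         (\<integral>u. iexp (s' * u) * iexp ((s + a) * u) \<partial>N')) \<le> \<delta>"
        by (simp add: algebra_simps flip: exp_add)
    qed auto
    moreover have *: "iexp (s * u) * (of_real (fejer b u) * iexp (a * u)) = of_real (fejer b u) * iexp ((s + a) * u)" for u
      by (simp add: algebra_simps exp_add)
    ultimately show "norm ((\<integral>u. iexp (s * u) * (of_real (fejer b u) * iexp (a * u)) \<partial>N) -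
       (\<integral>u. iexp (s * u) * (of_real (fejer b u) * iexp (a * u)) \<partial>N')) \<le> 2 * b * \<delta>"
      by (simp only: *)
  qed measurable
  then show ?thesis by (simp add: power2_eq_square mult.assoc)
qed

section \<open>The resolvent density\<close>

text \<open>For a real exponent \<open>\<theta> < 0\<close> this is the normalisation of the
  exponential density of rate \<open>- \<theta>\<close>; complex exponents follow by analytic
  continuation.\<close>

lemma lborel_halfline_exp_transform:
  assumes "Re z < 0"
  shows "integrable lborel (\<lambda>u. indicator {0..} u *\<^sub>R exp (z * of_real u))"
    and "(\<integral>u. indicator {0..} u *\<^sub>R exp (z * of_real u) \<partial>lborel) = - 1 / z"
proof -
  define N where "N = density lborel (\<lambda>u::real. ennreal (indicator {0..} u))"
  have s: "sets N = sets borel" by (simp add: N_def)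
  have i: "integrable N (\<lambda>u. exp (\<theta> * u))" and v: "(\<integral>u. exp (\<theta> * u) \<partial>N) = - 1 / \<theta>"
    if "\<theta> < 0" for \<theta>
  proof -
    interpret prob_space "density lborel (\<lambda>x. ennreal (exponential_density (- \<theta>) x))"
      using that by (intro prob_space_exponential_density) simp
    have e: "(\<lambda>x. exponential_density (- \<theta>) x) = (\<lambda>x. - \<theta> * (indicator {0..} x * exp (\<theta> * x)))"
      by (auto simp: exponential_density_def fun_eq_iff indicator_def)
    have nn: "exponential_density (- \<theta>) x \<ge> 0" for x
      using that by (simp add: exponential_density_nonneg)
    have "(\<integral>\<^sup>+x. ennreal (exponential_density (- \<theta>) x) \<partial>lborel) = ennreal 1"
      using emeasure_space_1 by (simp add: emeasure_density)
    then have "has_bochner_integral lborel (\<lambda>x. exponential_density (- \<theta>) x) 1"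
      using nn by (intro has_bochner_integral_nn_integral) auto
    then have h: "has_bochner_integral lborel (\<lambda>x. (- 1 / \<theta>) * (- \<theta> * (indicator {0..} x * exp (\<theta> * x)))) (- 1 / \<theta>)"
      unfolding e using has_bochner_integral_mult_right[of "- 1 / \<theta>"] by fastforce
    then have h: "has_bochner_integral lborel (\<lambda>x. indicator {0..} x * exp (\<theta> * x)) (- 1 / \<theta>)"
      using that by (simp add: field_simps)
    then show "integrable N (\<lambda>u. exp (\<theta> * u))" "(\<integral>u. exp (\<theta> * u) \<partial>N) = - 1 / \<theta>"
      unfolding N_def by (simp_all add: has_bochner_integral_iff integrable_density integral_density)
  qed
  have "integrable N (\<lambda>u. exp (z * of_real u))"
    using assms by (intro integrable_exp_complex s i) auto
  then show "integrable lborel (\<lambda>u. indicator {0..} u *\<^sub>R exp (z * of_real u))"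
    unfolding N_def by (subst (asm) integrable_density) auto
  have "(\<integral>u. exp (z * of_real u) \<partial>N) = - 1 / z"
  proof (rule holomorphic_vertical_strip_eqI
      [of "\<lambda>z. \<integral>u. exp (z * of_real u) \<partial>N" "Re z - 1" 0 "\<lambda>z. - 1 / z"])
    show "(\<lambda>z. \<integral>u. exp (z * of_real u) \<partial>N) holomorphic_on {w. Re z - 1 < Re w \<and> Re w < 0}"
      by (intro holomorphic_on_exp_transform s i)
    show "(\<lambda>z. - 1 / z) holomorphic_on {w. Re z - 1 < Re w \<and> Re w < 0}"
      by (intro holomorphic_intros) auto
    show "(\<integral>u. exp (complex_of_real \<theta> * of_real u) \<partial>N) = - 1 / complex_of_real \<theta>" if "\<theta> < 0" for \<theta>
      using v[OF that] by (simp add: exp_transform_of_real)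
  qed (use assms in auto)
  then show "(\<integral>u. indicator {0..} u *\<^sub>R exp (z * of_real u) \<partial>lborel) = - 1 / z"
    unfolding N_def by (subst (asm) integral_density) auto
qed

text \<open>The two fractions come from the two half-lines. Later they match the pole terms of the
  transforms at distance \<open>\<epsilon>\<close> to the right and to the left of the critical
  line.\<close>

lemma lborel_two_sided_exp_transform:
  assumes "0 < \<epsilon>"
  shows "integrable lborel (\<lambda>u. exp (- \<epsilon> * \<bar>u\<bar>))"
    and "(\<integral>u. exp (- \<epsilon> * \<bar>u\<bar>) *\<^sub>R iexp (\<eta> * u) \<partial>lborel) =
      1 / (of_real \<epsilon> - \<i> * of_real \<eta>) + 1 / (of_real \<epsilon> + \<i> * of_real \<eta>)"
proof -
  define f where "f z u = indicator {0..} u *\<^sub>R exp (z * complex_of_real u)" for z u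
  note f = lborel_halfline_exp_transform[folded f_def]
  have r: "integrable lborel (\<lambda>u. f z (- u))" "(\<integral>u. f z (- u) \<partial>lborel) = - 1 / z" if "Re z < 0" for z
    using f[OF that] lborel_integrable_real_affine[of "f z" "-1" 0]
      lborel_integral_real_affine[of "-1" "f z" 0] by auto
  define g where "g \<eta> u = f (- of_real \<epsilon> + \<i> * of_real \<eta>) u + f (- of_real \<epsilon> - \<i> * of_real \<eta>) (- u)" for \<eta> u
  have g: "has_bochner_integral lborel (g \<eta>)
      (1 / (of_real \<epsilon> - \<i> * of_real \<eta>) + 1 / (of_real \<epsilon> + \<i> * of_real \<eta>))" for \<eta>
  proof -
    have "has_bochner_integral lborel (g \<eta>)
      (- 1 / (- of_real \<epsilon> + \<i> * of_real \<eta>) + - 1 / (- of_real \<epsilon> - \<i> * of_real \<eta>))"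
      unfolding g_def using f[of "- of_real \<epsilon> + \<i> * of_real \<eta>"] r[of "- of_real \<epsilon> - \<i> * of_real \<eta>"] assms
      by (intro has_bochner_integral_add) (auto simp: has_bochner_integral_iff)
    moreover have "- 1 / (- of_real \<epsilon> + \<i> * of_real \<eta>) = 1 / (of_real \<epsilon> - \<i> * of_real \<eta>)"
      using minus_divide_divide[of 1 "of_real \<epsilon> - \<i> * of_real \<eta>"] by simp
    moreover have "- 1 / (- of_real \<epsilon> - \<i> * of_real \<eta>) = 1 / (of_real \<epsilon> + \<i> * of_real \<eta>)"
      using minus_divide_divide[of 1 "of_real \<epsilon> + \<i> * of_real \<eta>"] by simp
    ultimately show ?thesis by (simp only:)
  qed
  \<comment> \<open>Both half-lines contain \<open>0\<close>, where \<open>g\<close> counts twice;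
    hence an identity almost everywhere only.\<close>
  have e: "AE u in lborel. g \<eta> u = exp (- \<epsilon> * \<bar>u\<bar>) *\<^sub>R iexp (\<eta> * u)" for \<eta>
    using AE_lborel_singleton[of 0]
  proof eventually_elim
    case (elim u)
    then show ?case
      by (cases "u > 0") (auto simp: g_def f_def scaleR_conv_of_real exp_of_real[symmetric] algebra_simps simp flip: exp_add)
  qed
  have h: "has_bochner_integral lborel (\<lambda>u. exp (- \<epsilon> * \<bar>u\<bar>) *\<^sub>R iexp (\<eta> * u))
      (1 / (of_real \<epsilon> - \<i> * of_real \<eta>) + 1 / (of_real \<epsilon> + \<i> * of_real \<eta>))" for \<eta>
    using g[of \<eta>] has_bochner_integralI_AE[OF _ _ e] by force
  then show "(\<integral>u. exp (- \<epsilon> * \<bar>u\<bar>) *\<^sub>R iexp (\<eta> * u) \<partial>lborel) =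
      1 / (of_real \<epsilon> - \<i> * of_real \<eta>) + 1 / (of_real \<epsilon> + \<i> * of_real \<eta>)"
    by (simp add: has_bochner_integral_iff)
  have "integrable lborel (\<lambda>u. Re (exp (- \<epsilon> * \<bar>u\<bar>) *\<^sub>R iexp (0 * u)))"
    using h[of 0] by (intro integrable_Re) (simp add: has_bochner_integral_iff)
  then show "integrable lborel (\<lambda>u. exp (- \<epsilon> * \<bar>u\<bar>))" by simp
qed

text \<open>Equality case of the triangle inequality: the real part of the difference is the
  integral of \<open>exp (\<theta> * u) * (1 - cos (\<eta> * u)) \<ge> 0\<close>, so this function
  vanishes almost everywhere.\<close>

lemma exp_transform_periodic_imp:
  fixes N :: "real measure" and \<theta> \<eta> :: real
  assumes N: "sets N = sets borel" and i: "integrable N (\<lambda>u. exp (\<theta> * u))"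
    and eq: "(\<integral>u. exp (Complex \<theta> \<eta> * of_real u) \<partial>N) = (\<integral>u. exp (of_real \<theta> * of_real u) \<partial>N)"
  shows "AE u in N. cos (\<eta> * u) = 1"
proof -
  note [measurable_cong] = N
  have ic: "integrable N (\<lambda>u. exp (\<theta> * u) * cos (\<eta> * u))"
    by (rule Bochner_Integration.integrable_bound[OF i]) (auto simp: abs_mult)
  have "(\<integral>u. exp (\<theta> * u) * cos (\<eta> * u) \<partial>N) = (\<integral>u. Re (exp (Complex \<theta> \<eta> * of_real u)) \<partial>N)"
    by (simp add: Re_exp)
  also have "\<dots> = Re (\<integral>u. exp (Complex \<theta> \<eta> * of_real u) \<partial>N)"
    using i by (intro integral_Re integrable_exp_complex N) auto
  also have "\<dots> = (\<integral>u. exp (\<theta> * u) \<partial>N)"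
    unfolding eq exp_transform_of_real by simp
  finally have "(\<integral>u. exp (\<theta> * u) * (1 - cos (\<eta> * u)) \<partial>N) = 0"
    using i ic by (simp add: algebra_simps)
  moreover have "integrable N (\<lambda>u. exp (\<theta> * u) * (1 - cos (\<eta> * u)))"
    using i ic by (simp add: algebra_simps)
  ultimately have "AE u in N. exp (\<theta> * u) * (1 - cos (\<eta> * u)) = 0"
    by (subst (asm) integral_nonneg_eq_0_iff_AE) auto
  then show ?thesis by eventually_elim simp
qed

text \<open>The analytic core, with no process in it. \<open>R\<close> and \<open>R'\<close> stand
  for the laws at exponential times of rates \<open>p\<close> and \<open>r\<close>, the numbers
  \<open>\<Phi>\<close> and \<open>\<Phi>'\<close> for the right inverse at \<open>p\<close> and at
  \<open>r\<close>, and \<open>w\<close> for the scale function at \<open>p\<close>. The transform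
  of \<open>R'\<close> converges beyond \<open>\<Phi>\<close> and so covers both sides of the
  critical line.\<close>

locale resolvent_transform =
  R: real_distribution R + R': real_distribution R'
  for R R' :: "real measure" +
  fixes \<psi> w :: "real \<Rightarrow> real" and p r \<Phi> \<Phi>' :: real
  assumes p: "0 < p" "p < r" and \<Phi>: "0 < \<Phi>" "\<Phi> < \<Phi>'"
    and R_transform: "\<And>\<theta>. 0 \<le> \<theta> \<Longrightarrow> \<theta> < \<Phi> \<Longrightarrow>
      has_bochner_integral R (\<lambda>u. exp (\<theta> * u)) (p / (p - \<psi> \<theta>))"
    and R'_transform: "\<And>\<theta>. 0 \<le> \<theta> \<Longrightarrow> \<theta> < \<Phi>' \<Longrightarrow>
      has_bochner_integral R' (\<lambda>u. exp (\<theta> * u)) (r / (r - \<psi> \<theta>))"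
    and w_transform: "\<And>\<theta>. \<Phi> < \<theta> \<Longrightarrow>
      has_bochner_integral lborel (\<lambda>u. exp (\<theta> * u) * w (- u)) (1 / (\<psi> \<theta> - p))"
    and w_measurable [measurable]: "w \<in> borel_measurable borel"
    and w_neg: "\<And>x. x < 0 \<Longrightarrow> w x = 0" and w_nonneg: "\<And>x. 0 \<le> w x" and w_pos: "\<And>x. 0 < x \<Longrightarrow> 0 < w x"
    and \<psi>_eq: "\<psi> \<Phi> = p"
    and \<psi>_less: "\<And>\<theta>. 0 \<le> \<theta> \<Longrightarrow> \<theta> < \<Phi> \<Longrightarrow> \<psi> \<theta> < p"
    and \<psi>_greater: "\<And>\<theta>. \<Phi> < \<theta> \<Longrightarrow> \<theta> < \<Phi>' \<Longrightarrow> p < \<psi> \<theta> \<and> \<psi> \<theta> < r"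
begin

definition Wm :: "real measure" where "Wm = density lborel (\<lambda>u. ennreal (w (- u)))"
definition "A z = (\<integral>u. exp (z * of_real u) \<partial>R') / of_real r" for z :: complex
definition "B z = (\<integral>u. exp (z * of_real u) \<partial>R) / of_real p" for z :: complex
definition "V z = (\<integral>u. exp (z * of_real u) \<partial>Wm)" for z :: complex
text \<open>On the real axis \<open>A\<close> is \<open>1 / (r - \<psi>)\<close> and
  \<open>Q\<close> is \<open>(p - \<psi>) / (r - \<psi>)\<close>, so \<open>A / Q\<close> continues
  \<open>1 / (p - \<psi>)\<close>. Expressed through \<open>A\<close>, the function \<open>Q\<close>
  is holomorphic across the line.\<close>

definition "Q z = 1 - of_real (r - p) * A z" for z :: complex

lemma sets_Wm [measurable_cong]: "sets Wm = sets borel"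
  by (simp add: Wm_def)

lemma R_integrable: "0 < \<theta> \<Longrightarrow> \<theta> < \<Phi> \<Longrightarrow> integrable R (\<lambda>u. exp (\<theta> * u))"
  using R_transform by (simp add: has_bochner_integral_iff)

lemma R'_integrable: "0 < \<theta> \<Longrightarrow> \<theta> < \<Phi>' \<Longrightarrow> integrable R' (\<lambda>u. exp (\<theta> * u))"
  using R'_transform by (simp add: has_bochner_integral_iff)

lemma Wm_integral:
  assumes "\<Phi> < \<theta>"
  shows "integrable Wm (\<lambda>u. exp (\<theta> * u))" "(\<integral>u. exp (\<theta> * u) \<partial>Wm) = 1 / (\<psi> \<theta> - p)"
  using w_transform[OF assms] w_nonneg unfolding Wm_def
  by (simp_all add: has_bochner_integral_iff integrable_density integral_density mult.commute)

lemma \<psi>_less': "0 \<le> \<theta> \<Longrightarrow> \<theta> < \<Phi>' \<Longrightarrow> \<psi> \<theta> < r"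
  using \<psi>_less[of \<theta>] \<psi>_greater[of \<theta>] \<psi>_eq p by (cases \<theta> \<Phi> rule: linorder_cases) auto

lemma A_holomorphic: "A holomorphic_on {z. 0 < Re z \<and> Re z < \<Phi>'}"
  unfolding A_def using p by (intro holomorphic_intros holomorphic_on_exp_transform R'.events_eq_borel R'_integrable) auto

lemma B_holomorphic: "B holomorphic_on {z. 0 < Re z \<and> Re z < \<Phi>}"
  unfolding B_def using p by (intro holomorphic_intros holomorphic_on_exp_transform R.events_eq_borel R_integrable) auto

lemma V_holomorphic: "V holomorphic_on {z. \<Phi> < Re z \<and> Re z < \<Phi>'}"
  unfolding V_def by (intro holomorphic_on_exp_transform sets_Wm Wm_integral)

lemma Q_holomorphic: "Q holomorphic_on {z. 0 < Re z \<and> Re z < \<Phi>'}"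
  unfolding Q_def by (intro holomorphic_intros A_holomorphic)

lemma A_of_real: "0 < \<theta> \<Longrightarrow> \<theta> < \<Phi>' \<Longrightarrow> A (of_real \<theta>) = of_real (1 / (r - \<psi> \<theta>))"
  using R'_transform[of \<theta>] p unfolding A_def exp_transform_of_real by (simp add: has_bochner_integral_iff)

lemma B_of_real: "0 < \<theta> \<Longrightarrow> \<theta> < \<Phi> \<Longrightarrow> B (of_real \<theta>) = of_real (1 / (p - \<psi> \<theta>))"
  using R_transform[of \<theta>] p unfolding B_def exp_transform_of_real by (simp add: has_bochner_integral_iff)

lemma V_of_real: "\<Phi> < \<theta> \<Longrightarrow> V (of_real \<theta>) = of_real (1 / (\<psi> \<theta> - p))"
  unfolding V_def exp_transform_of_real by (simp add: Wm_integral)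

lemma Q_of_real:
  assumes "0 < \<theta>" "\<theta> < \<Phi>'"
  shows "Q (of_real \<theta>) = of_real ((p - \<psi> \<theta>) / (r - \<psi> \<theta>))"
proof -
  have "(p - \<psi> \<theta>) / (r - \<psi> \<theta>) = 1 - (r - p) * (1 / (r - \<psi> \<theta>))"
    using \<psi>_less'[of \<theta>] assms by (simp add: field_simps)
  then show ?thesis by (simp add: Q_def A_of_real[OF assms])
qed

text \<open>Kept in product form: zeros of \<open>Q\<close> are excluded only afterwards, with the
  help of this identity.\<close>

lemma BQ_eq_A:
  assumes "0 < Re z" "Re z < \<Phi>"
  shows "B z * Q z = A z"
proof (rule holomorphic_vertical_strip_eqI[where f = "\<lambda>z. B z * Q z" and g = A, OF _ _ _ assms])
  show "(\<lambda>z. B z * Q z) holomorphic_on {z. 0 < Re z \<and> Re z < \<Phi>}"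
    using \<Phi> by (intro holomorphic_intros B_holomorphic holomorphic_on_subset[OF Q_holomorphic]) auto
  show "A holomorphic_on {z. 0 < Re z \<and> Re z < \<Phi>}"
    using \<Phi> by (intro holomorphic_on_subset[OF A_holomorphic]) auto
  show "B (of_real \<theta>) * Q (of_real \<theta>) = A (of_real \<theta>)" if "0 < \<theta>" "\<theta> < \<Phi>" for \<theta>
    using that \<psi>_less[of \<theta>] \<Phi> p
    by (simp add: A_of_real B_of_real Q_of_real flip: of_real_mult)
qed

lemma VQ_eq_A:
  assumes "\<Phi> < Re z" "Re z < \<Phi>'"
  shows "V z * Q z = - A z"
proof (rule holomorphic_vertical_strip_eqI[where f = "\<lambda>z. V z * Q z" and g = "\<lambda>z. - A z", OF _ _ _ assms])
  show "(\<lambda>z. V z * Q z) holomorphic_on {z. \<Phi> < Re z \<and> Re z < \<Phi>'}"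
    using \<Phi> by (intro holomorphic_intros V_holomorphic holomorphic_on_subset[OF Q_holomorphic]) auto
  show "(\<lambda>z. - A z) holomorphic_on {z. \<Phi> < Re z \<and> Re z < \<Phi>'}"
    using \<Phi> by (intro holomorphic_intros holomorphic_on_subset[OF A_holomorphic]) auto
  show "V (of_real \<theta>) * Q (of_real \<theta>) = - A (of_real \<theta>)" if "\<Phi> < \<theta>" "\<theta> < \<Phi>'" for \<theta>
  proof -
    have "1 / a * (- a / b) = - (1 / b)" if "a \<noteq> 0" for a b :: real
      using that by simp
    from this[of "\<psi> \<theta> - p" "r - \<psi> \<theta>"]
    have "1 / (\<psi> \<theta> - p) * ((p - \<psi> \<theta>) / (r - \<psi> \<theta>)) = - (1 / (r - \<psi> \<theta>))"
      using \<psi>_greater[of \<theta>] that by simp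
    then have "complex_of_real (1 / (\<psi> \<theta> - p)) * of_real ((p - \<psi> \<theta>) / (r - \<psi> \<theta>)) = - of_real (1 / (r - \<psi> \<theta>))"
      by (simp only: flip: of_real_mult of_real_minus)
    then show ?thesis using that \<Phi> by (simp only: A_of_real V_of_real Q_of_real)
  qed
qed

text \<open>A zero of \<open>Q\<close> off the real axis would force \<open>R'\<close> to live on a lattice; then \<open>A\<close>, hence
  also \<open>V\<close>, would be periodic, and \<open>w\<close> would vanish off a lattice.\<close>

lemma Q_neq_0:
  assumes z: "0 < Re z" "Re z < \<Phi>'" "z \<noteq> of_real \<Phi>"
  shows "Q z \<noteq> 0"
proof
  assume Q0: "Q z = 0"
  consider "Re z < \<Phi>" | "\<Phi> < Re z" | "Re z = \<Phi>" by linarith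
  then show False
  proof cases
    case 1
    \<comment> \<open>By its definition \<open>Q z\<close> would be \<open>1\<close> if
      \<open>A z = 0\<close>.\<close>
    then have "A z = 0" using BQ_eq_A[of z] z Q0 by simp
    then show False using Q0 by (simp add: Q_def)
  next
    case 2
    then have "A z = 0" using VQ_eq_A[of z] z Q0 by simp
    then show False using Q0 by (simp add: Q_def)
  next
    case 3
    define \<eta> where "\<eta> = Im z"
    have zeq: "z = Complex \<Phi> \<eta>" using 3 by (simp add: \<eta>_def complex_eq_iff)
    have \<eta>: "\<eta> \<noteq> 0" using z 3 by (auto simp: \<eta>_def complex_eq_iff)
    have "Q (of_real \<Phi>) = 0" using Q_of_real[of \<Phi>] \<Phi> \<psi>_eq by simp
    then have "complex_of_real (r - p) * A z = of_real (r - p) * A (of_real \<Phi>)"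
      using Q0 by (simp add: Q_def del: of_real_diff)
    moreover have "complex_of_real (r - p) \<noteq> 0" using p by (simp del: of_real_diff)
    ultimately have "A z = A (of_real \<Phi>)" by (metis mult_left_cancel)
    then have "(\<integral>u. exp (Complex \<Phi> \<eta> * of_real u) \<partial>R') = (\<integral>u. exp (of_real \<Phi> * of_real u) \<partial>R')"
      using p unfolding A_def zeq by simp
    then have "AE u in R'. cos (\<eta> * u) = 1"
      using \<Phi> by (intro exp_transform_periodic_imp R'.events_eq_borel R'_integrable) auto
    then have lat: "AE u in R'. exp (\<i> * of_real (\<eta> * u)) = 1"
    proof eventually_elim
      case (elim u)
      then have "sin (\<eta> * u) = 0" using sin_cos_squared_add[of "\<eta> * u"] by simp
      then show ?case using elim by (simp only: cis_conv_exp[symmetric] complex_eq_iff cis.simps) simp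
    qed
    have per: "A (Complex \<theta> \<eta>) = A (of_real \<theta>)" for \<theta>
    proof -
      have "(\<integral>u. exp (Complex \<theta> \<eta> * of_real u) \<partial>R') = (\<integral>u. exp (of_real \<theta> * of_real u) \<partial>R')"
      proof (rule integral_cong_AE)
        show "AE u in R'. exp (Complex \<theta> \<eta> * of_real u) = exp (of_real \<theta> * of_real u)"
          using lat
        proof eventually_elim
          case (elim u)
          have "exp (Complex \<theta> \<eta> * of_real u) = exp (of_real \<theta> * of_real u) * exp (\<i> * of_real (\<eta> * u))"
            by (simp add: Complex_eq algebra_simps flip: exp_add)
          then show ?case by (simp only: elim mult_1_right)
        qed
      qed auto
      then show ?thesis by (simp add: A_def)
    qed
    \<comment> \<open>A point right of the line but inside the strip, where \<open>V\<close>
      inherits from \<open>A\<close> the equality of the values at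
      \<open>Complex \<theta> \<eta>\<close> and at \<open>\<theta>\<close>.\<close>
    define \<theta> where "\<theta> = (\<Phi> + \<Phi>') / 2"
    have \<theta>: "\<Phi> < \<theta>" "\<theta> < \<Phi>'" using \<Phi> by (auto simp: \<theta>_def)
    have Qp: "Q (Complex \<theta> \<eta>) = Q (of_real \<theta>)" by (simp add: Q_def per)
    have Qn: "Q (of_real \<theta>) \<noteq> 0"
      using Q_of_real[of \<theta>] \<psi>_greater[OF \<theta>] \<theta> \<Phi> by simp
    have "V (Complex \<theta> \<eta>) * Q (of_real \<theta>) = V (of_real \<theta>) * Q (of_real \<theta>)"
      using VQ_eq_A[of "Complex \<theta> \<eta>"] VQ_eq_A[of "of_real \<theta>"] \<theta> by (simp add: per Qp)
    then have "V (Complex \<theta> \<eta>) = V (of_real \<theta>)" using Qn by simp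
    then have "AE u in Wm. cos (\<eta> * u) = 1"
      unfolding V_def using \<theta> by (intro exp_transform_periodic_imp sets_Wm Wm_integral) auto
    then have ae: "AE u in lborel. 0 < w (- u) \<longrightarrow> cos (\<eta> * u) = 1"
      unfolding Wm_def by (subst (asm) AE_density) auto
    \<comment> \<open>On this interval \<open>w (- u) > 0\<close>, while \<open>\<eta> * u\<close>
      is nonzero and lies between \<open>- pi\<close> and \<open>pi\<close>, so its cosine is not
      \<open>1\<close>; the interval would have to be a null set.\<close>
    have "AE u in lborel. u \<notin> {- pi / \<bar>\<eta>\<bar> <..< 0}"
      using ae
    proof eventually_elim
      case (elim u)
      show ?case
      proof
        assume u: "u \<in> {- pi / \<bar>\<eta>\<bar> <..< 0}"
        then have c: "cos (\<eta> * u) = 1" using elim w_pos[of "- u"] by simp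
        have "\<bar>\<eta> * u\<bar> < pi" using u \<eta> by (simp add: abs_mult field_simps)
        moreover have "sin (\<eta> * u) = 0" using c sin_cos_squared_add[of "\<eta> * u"] by simp
        ultimately have "\<eta> * u = 0" using sin_eq_0_pi[of "\<eta> * u"] by auto
        then show False using u \<eta> by simp
      qed
    qed
    then have "emeasure lborel {- pi / \<bar>\<eta>\<bar> <..< 0} = 0"
      by (subst (asm) AE_iff_measurable[where N = "{- pi / \<bar>\<eta>\<bar> <..< 0}"]) auto
    moreover have "emeasure lborel {- pi / \<bar>\<eta>\<bar> <..< 0} = ennreal (pi / \<bar>\<eta>\<bar>)"
      using \<eta> by (subst emeasure_lborel_Ioo) (auto simp: divide_simps)
    ultimately show False using \<eta> by simp
  qed
qed

section \<open>The simple pole at \<open>\<Phi>\<close>\<close>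

definition "slope = (\<integral>u. u * exp (\<Phi> * u) \<partial>R') / r"

text \<open>The number \<open>1 / \<psi>' \<Phi>\<close>: differentiating
  \<open>A = 1 / (r - \<psi>)\<close> at \<open>\<Phi>\<close>, where \<open>\<psi>\<close> equals
  \<open>p\<close>, gives \<open>slope = \<psi>' \<Phi> / (r - p)^2\<close>. In this form it makes
  sense before \<open>\<psi>\<close> is known to be differentiable.\<close>

definition "c = 1 / (slope * (r - p)\<^sup>2)"

lemma A_deriv: "(A has_field_derivative of_real slope) (at (of_real \<Phi>))"
proof -
  have "((\<lambda>z::complex. \<integral>u. exp (z * of_real u) \<partial>R') has_field_derivative
      (\<integral>u. of_real u * exp (of_real \<Phi> * of_real u) \<partial>R')) (at (of_real \<Phi>))"
    using \<Phi> by (intro has_field_derivative_exp_transform(2)[where \<alpha> = 0 and \<beta> = \<Phi>'] R'.events_eq_borel R'_integrable) auto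
  moreover have "(\<lambda>u. of_real u * exp (of_real \<Phi> * of_real u)) = (\<lambda>u. complex_of_real (u * exp (\<Phi> * u)))"
    by (simp add: exp_of_real[symmetric])
  ultimately have "((\<lambda>z::complex. \<integral>u. exp (z * of_real u) \<partial>R') has_field_derivative
      of_real (\<integral>u. u * exp (\<Phi> * u) \<partial>R')) (at (of_real \<Phi>))"
    by (simp only: integral_complex_of_real)
  from DERIV_cdivide[OF this, of "of_real r"] show ?thesis
    unfolding A_def slope_def by simp
qed

lemma integrable_slope: "integrable R' (\<lambda>u. u * exp (\<Phi> * u))"
proof -
  have "integrable R' (\<lambda>u. complex_of_real u * exp (of_real \<Phi> * of_real u))"
    using \<Phi> by (intro has_field_derivative_exp_transform(1)[where \<alpha> = 0 and \<beta> = \<Phi>'] R'.events_eq_borel R'_integrable) auto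
  moreover have "(\<lambda>u. of_real u * exp (of_real \<Phi> * of_real u)) = (\<lambda>u. complex_of_real (u * exp (\<Phi> * u)))"
    by (simp add: exp_of_real[symmetric])
  ultimately have "integrable R' (\<lambda>u. Re (complex_of_real (u * exp (\<Phi> * u))))"
    by (intro integrable_Re) simp
  then show ?thesis by simp
qed

text \<open>This makes the pole simple and \<open>c\<close> positive. Integrating
  \<open>(1 - x) * exp x \<le> 1\<close> at \<open>x = \<Phi> * u\<close> compares
  \<open>slope\<close> with the moment \<open>r / (r - p)\<close>, which exceeds
  \<open>1\<close>.\<close>

lemma slope_pos: "0 < slope"
proof -
  have i: "has_bochner_integral R' (\<lambda>u. exp (\<Phi> * u)) (r / (r - p))"
    using R'_transform[of \<Phi>] \<Phi> \<psi>_eq by simp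
  have "(\<integral>u. exp (\<Phi> * u) - \<Phi> * (u * exp (\<Phi> * u)) \<partial>R') \<le> (\<integral>u. 1 \<partial>R')"
  proof (rule integral_mono)
    show "integrable R' (\<lambda>u. exp (\<Phi> * u) - \<Phi> * (u * exp (\<Phi> * u)))"
      using i integrable_slope by (simp add: has_bochner_integral_iff)
    fix u
    have "(1 + (- \<Phi> * u)) * exp (\<Phi> * u) \<le> exp (- \<Phi> * u) * exp (\<Phi> * u)"
      by (intro mult_right_mono exp_ge_add_one_self) simp
    then show "exp (\<Phi> * u) - \<Phi> * (u * exp (\<Phi> * u)) \<le> 1"
      by (simp add: algebra_simps flip: exp_add)
  qed simp
  then have "r / (r - p) - \<Phi> * (r * slope) \<le> 1"
    using i integrable_slope p R'.prob_space by (simp add: has_bochner_integral_iff slope_def)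
  moreover have "1 < r / (r - p)" using p by simp
  ultimately have "0 < \<Phi> * (r * slope)" by linarith
  then show ?thesis using \<Phi> p by (simp add: zero_less_mult_iff)
qed

lemma c_pos: "0 < c"
  using slope_pos p by (simp add: c_def)

text \<open>\<open>\<psi>\<close> is recovered from the analytic function \<open>A\<close> as
  \<open>r - 1 / A\<close>. This supplies the differentiability behind \<open>deriv \<psi>\<close>
  in the resolvent density.\<close>

lemma \<psi>_deriv: "(\<psi> has_real_derivative slope * (r - p)\<^sup>2) (at \<Phi>)"
proof -
  have "((\<lambda>x. A (of_real x)) has_vector_derivative of_real slope) (at \<Phi>)"
    by (rule has_vector_derivative_real_field[OF A_deriv])
  then have "((\<lambda>x. Re (A (of_real x))) has_vector_derivative Re (of_real slope)) (at \<Phi>)"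
    by (rule bounded_linear.has_vector_derivative[OF bounded_linear_Re])
  then have d: "((\<lambda>x. Re (A (of_real x))) has_real_derivative slope) (at \<Phi>)"
    by (simp add: has_real_derivative_iff_has_vector_derivative)
  have A\<Phi>: "Re (A (of_real \<Phi>)) = 1 / (r - p)" using A_of_real[of \<Phi>] \<Phi> \<psi>_eq by simp
  have d1: "((\<lambda>x. r - 1 / Re (A (of_real x))) has_real_derivative slope * (r - p)\<^sup>2) (at \<Phi>)"
    by (rule DERIV_cong[OF DERIV_diff[OF DERIV_const DERIV_divide[OF DERIV_const d]]])
      (use A\<Phi> p in \<open>auto simp: power2_eq_square\<close>)
  show ?thesis
  proof (rule has_field_derivative_transform_within_open[OF d1, of "{0<..<\<Phi>'}"])
    show "r - 1 / Re (A (of_real x)) = \<psi> x" if "x \<in> {0<..<\<Phi>'}" for x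
      using that A_of_real[of x] \<psi>_less'[of x] by simp
  qed (use \<Phi> in auto)
qed

text \<open>The factor \<open>z - \<Phi>\<close> removes the pole of \<open>A / Q\<close>. The value
  of \<open>E\<close> at \<open>\<Phi>\<close> is the limit there, so \<open>- c\<close> is the
  residue, and the difference quotient \<open>H\<close> of \<open>E\<close> is the regular part of
  \<open>A / Q\<close>.\<close>

definition "E z = (if z = of_real \<Phi> then - of_real c else (z - of_real \<Phi>) * A z / Q z)" for z :: complex
definition "H z = (if z = of_real \<Phi> then deriv E (of_real \<Phi>) else (E z - E (of_real \<Phi>)) / (z - of_real \<Phi>))" for z :: complex

lemma E_holomorphic: "E holomorphic_on {z. 0 < Re z \<and> Re z < \<Phi>'}"
proof (rule no_isolated_singularity'[where K = "{of_real \<Phi>}"])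
  let ?S = "{z. 0 < Re z \<and> Re z < \<Phi>'}"
  show "open ?S" by (rule open_vertical_strip)
  have "(\<lambda>z. (z - of_real \<Phi>) * A z / Q z) holomorphic_on (?S - {of_real \<Phi>})"
    using Q_neq_0
    by (intro holomorphic_intros holomorphic_on_subset[OF A_holomorphic] holomorphic_on_subset[OF Q_holomorphic]) auto
  then show "E holomorphic_on (?S - {of_real \<Phi>})"
    by (rule holomorphic_transform) (auto simp: E_def)
  show "(E \<longlongrightarrow> E z) (at z within ?S)" if "z \<in> {of_real \<Phi>}" for z
  proof -
    have z: "z = of_real \<Phi>" using that by simp
    have Q0: "Q (of_real \<Phi>) = 0" using Q_of_real[of \<Phi>] \<Phi> \<psi>_eq by simp
    have "(Q has_field_derivative - (of_real (r - p) * of_real slope)) (at (of_real \<Phi>))"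
      unfolding Q_def[abs_def] by (auto intro!: derivative_eq_intros A_deriv)
    then have q: "((\<lambda>y. Q y / (y - of_real \<Phi>)) \<longlongrightarrow> - (of_real (r - p) * of_real slope)) (at (of_real \<Phi>))"
      by (simp add: has_field_derivative_iff Q0)
    have a: "(A \<longlongrightarrow> A (of_real \<Phi>)) (at (of_real \<Phi>))"
      using DERIV_isCont[OF A_deriv] by (simp add: isCont_def)
    have "((\<lambda>y. A y / (Q y / (y - of_real \<Phi>))) \<longlongrightarrow> A (of_real \<Phi>) / - (of_real (r - p) * of_real slope)) (at (of_real \<Phi>))"
      using p slope_pos by (intro tendsto_divide a q) auto
    \<comment> \<open>At \<open>\<Phi>\<close> the value of \<open>A\<close> is
      \<open>1 / (r - p)\<close> and the derivative of \<open>Q\<close> is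
      \<open>- (r - p) * slope\<close>, whence the square in \<open>c\<close>.\<close>
    moreover have "A (of_real \<Phi>) / - (of_real (r - p) * of_real slope) = E (of_real \<Phi>)"
      using A_of_real[of \<Phi>] \<Phi> \<psi>_eq p slope_pos by (simp add: E_def c_def power2_eq_square)
    moreover have "eventually (\<lambda>y. A y / (Q y / (y - of_real \<Phi>)) = E y) (at (of_real \<Phi>))"
      unfolding eventually_at_filter by (rule always_eventually) (auto simp: E_def)
    ultimately have "(E \<longlongrightarrow> E (of_real \<Phi>)) (at (of_real \<Phi>))"
      using tendsto_cong by fastforce
    then show ?thesis unfolding z by (rule tendsto_within_subset) auto
  qed
qed auto

lemma H_holomorphic: "H holomorphic_on {z. 0 < Re z \<and> Re z < \<Phi>'}"
  unfolding H_def by (rule pole_lemma_open[OF E_holomorphic open_vertical_strip])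

lemma A_div_Q:
  assumes "z \<noteq> of_real \<Phi>"
  shows "A z / Q z = H z - of_real c / (z - of_real \<Phi>)"
proof -
  have d: "z - of_real \<Phi> \<noteq> 0" using assms by simp
  have "H z = (E z + of_real c) / (z - of_real \<Phi>)"
    using assms by (simp add: H_def E_def[of "of_real \<Phi>"])
  also have "\<dots> = E z / (z - of_real \<Phi>) + of_real c / (z - of_real \<Phi>)"
    by (rule add_divide_distrib)
  also have "E z = (z - of_real \<Phi>) * (A z / Q z)" using assms by (simp add: E_def)
  also have "\<dots> / (z - of_real \<Phi>) = A z / Q z" using d by simp
  finally show ?thesis by simp
qed

lemma B_eq:
  assumes "0 < Re z" "Re z < \<Phi>"
  shows "B z = H z - of_real c / (z - of_real \<Phi>)"
proof -
  have "z \<noteq> of_real \<Phi>" using assms by auto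
  moreover from this have "Q z \<noteq> 0" using assms \<Phi> by (intro Q_neq_0) auto
  then have "B z = A z / Q z" using BQ_eq_A[OF assms] by (simp add: eq_divide_eq)
  ultimately show ?thesis by (simp add: A_div_Q)
qed

lemma V_eq:
  assumes "\<Phi> < Re z" "Re z < \<Phi>'"
  shows "V z = of_real c / (z - of_real \<Phi>) - H z"
proof -
  have "z \<noteq> of_real \<Phi>" using assms by auto
  moreover from this have "Q z \<noteq> 0" using assms \<Phi> by (intro Q_neq_0) auto
  then have "V z = - (A z / Q z)" using VQ_eq_A[OF assms] by (metis minus_divide_left nonzero_eq_divide_eq)
  ultimately show ?thesis by (simp add: A_div_Q)
qed

end

section \<open>Approaching the line from both sides\<close>

lemma finite_measure_density_ennreal:
  assumes "integrable N f" "\<And>x. 0 \<le> f x"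
  shows "finite_measure (density N (\<lambda>x. ennreal (f x)))"
proof (rule finite_measureI)
  have "(\<integral>\<^sup>+x. ennreal (f x) \<partial>N) < \<infinity>"
    using assms by (simp add: integrable_iff_bounded)
  then show "emeasure (density N (\<lambda>x. ennreal (f x))) (space (density N (\<lambda>x. ennreal (f x)))) \<noteq> \<infinity>"
    using assms(1) by (simp add: emeasure_density cong: nn_integral_cong)
qed

lemma integrable_scaleR_bounded:
  fixes f :: "real \<Rightarrow> complex" and g :: "real \<Rightarrow> real"
  assumes "integrable N g" "f \<in> borel_measurable N" "\<And>u. norm (f u) \<le> Bd"
  shows "integrable N (\<lambda>u. g u *\<^sub>R f u)"
proof (rule Bochner_Integration.integrable_bound)
  show "integrable N (\<lambda>u. Bd * \<bar>g u\<bar>)" using assms(1) by simp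
  show "AE u in N. norm (g u *\<^sub>R f u) \<le> norm (Bd * \<bar>g u\<bar>)"
  proof (rule AE_I2)
    fix u
    have "0 \<le> Bd" using assms(3)[of u] norm_ge_zero order_trans by blast
    then show "norm (g u *\<^sub>R f u) \<le> norm (Bd * \<bar>g u\<bar>)"
      using mult_left_mono[OF assms(3)[of u], of "\<bar>g u\<bar>"] by (simp add: abs_mult mult.commute)
  qed
qed (use assms in measurable)

text \<open>Provides integrability on the line itself, where no integrable majorant is known in
  advance.\<close>

lemma integrable_Fatou:
  fixes f :: "'b \<Rightarrow> real"
  assumes g: "\<And>n. integrable N (g n)" "\<And>n x. 0 \<le> g n x" "\<And>n. (\<integral>x. g n x \<partial>N) \<le> C"
    and lim: "\<And>x. (\<lambda>n. g n x) \<longlonglongrightarrow> f x"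
  shows "integrable N f"
proof -
  have fm [measurable]: "f \<in> borel_measurable N"
    using g(1) lim by (intro borel_measurable_LIMSEQ_real[of N g f]) auto
  have f0: "0 \<le> f x" for x using lim[of x] g(2) by (intro LIMSEQ_le_const[OF lim]) auto
  have "(\<integral>\<^sup>+x. ennreal (f x) \<partial>N) = (\<integral>\<^sup>+x. liminf (\<lambda>n. ennreal (g n x)) \<partial>N)"
  proof (rule nn_integral_cong)
    fix x
    have "(\<lambda>n. ennreal (g n x)) \<longlonglongrightarrow> ennreal (f x)" using lim by (rule tendsto_ennrealI)
    then show "ennreal (f x) = liminf (\<lambda>n. ennreal (g n x))"
      using lim_imp_Liminf[OF sequentially_bot] by metis
  qed
  also have "\<dots> \<le> liminf (\<lambda>n. \<integral>\<^sup>+x. ennreal (g n x) \<partial>N)"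
    using g(1) by (intro nn_integral_liminf) auto
  also have "\<dots> = liminf (\<lambda>n. ennreal (\<integral>x. g n x \<partial>N))"
    using g(1,2) by (simp add: nn_integral_eq_integral)
  also have "\<dots> \<le> liminf (\<lambda>n. ennreal C)"
    using g(3) by (intro Liminf_mono always_eventually allI ennreal_leI) auto
  also have "\<dots> < \<infinity>" by (simp add: Liminf_const)
  finally have "(\<integral>\<^sup>+x. ennreal (f x) \<partial>N) < \<infinity>" .
  then show ?thesis using f0 by (simp add: integrable_iff_bounded)
qed

context resolvent_transform
begin

text \<open>\<open>R\<close> is tilted to abscissa \<open>\<Phi> - \<epsilon>\<close> and
  \<open>w (- u)\<close> to \<open>\<Phi> + \<epsilon>\<close>, each inside its own half plane of
  convergence, which keeps the sum finite. The measure expected in the limit, \<open>c\<close> times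
  Lebesgue measure, is damped symmetrically to match.\<close>

definition "tilted \<epsilon> = add_measure (density R (\<lambda>u. ennreal (exp ((\<Phi> - \<epsilon>) * u) / p)))
   (density lborel (\<lambda>u. ennreal (exp ((\<Phi> + \<epsilon>) * u) * w (- u))))"

definition "tilted_limit \<epsilon> = density lborel (\<lambda>u. ennreal (c * exp (- \<epsilon> * \<bar>u\<bar>)))"

lemma sets_tilted: "sets (tilted \<epsilon>) = sets borel" "sets (tilted_limit \<epsilon>) = sets borel"
  by (simp_all add: tilted_def tilted_limit_def)

lemma tilted_integrable:
  assumes "0 < \<epsilon>" "\<epsilon> < \<Phi>"
  shows "integrable R (\<lambda>u. exp ((\<Phi> - \<epsilon>) * u) / p)"
    and "integrable lborel (\<lambda>u. exp ((\<Phi> + \<epsilon>) * u) * w (- u))"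
    and "integrable lborel (\<lambda>u. c * exp (- \<epsilon> * \<bar>u\<bar>))"
  using R_integrable[of "\<Phi> - \<epsilon>"] w_transform[of "\<Phi> + \<epsilon>"] lborel_two_sided_exp_transform(1)[OF assms(1)] assms
  by (simp_all add: has_bochner_integral_iff)

lemma finite_tilted:
  assumes "0 < \<epsilon>" "\<epsilon> < \<Phi>"
  shows "finite_measure (tilted \<epsilon>)" "finite_measure (tilted_limit \<epsilon>)"
  unfolding tilted_def tilted_limit_def
  by (intro finite_measure_add_measure finite_measure_density_ennreal tilted_integrable assms;
      use p w_nonneg c_pos in simp)+

lemma tilted_integral:
  fixes f :: "real \<Rightarrow> complex"
  assumes \<epsilon>: "0 < \<epsilon>" "\<epsilon> < \<Phi>" and f: "f \<in> borel_measurable borel" "\<And>u. norm (f u) \<le> Bd"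
  shows "integrable R (\<lambda>u. (exp ((\<Phi> - \<epsilon>) * u) / p) *\<^sub>R f u)"
    and "integrable lborel (\<lambda>u. (exp ((\<Phi> + \<epsilon>) * u) * w (- u)) *\<^sub>R f u)"
    and "(\<integral>u. f u \<partial>tilted \<epsilon>) = (\<integral>u. (exp ((\<Phi> - \<epsilon>) * u) / p) *\<^sub>R f u \<partial>R)
        + (\<integral>u. (exp ((\<Phi> + \<epsilon>) * u) * w (- u)) *\<^sub>R f u \<partial>lborel)"
    and "(\<integral>u. f u \<partial>tilted_limit \<epsilon>) = (\<integral>u. (c * exp (- \<epsilon> * \<bar>u\<bar>)) *\<^sub>R f u \<partial>lborel)"
proof -
  have [measurable]: "f \<in> borel_measurable borel" by fact
  show i: "integrable R (\<lambda>u. (exp ((\<Phi> - \<epsilon>) * u) / p) *\<^sub>R f u)"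
    "integrable lborel (\<lambda>u. (exp ((\<Phi> + \<epsilon>) * u) * w (- u)) *\<^sub>R f u)"
    by (rule integrable_scaleR_bounded[OF tilted_integrable(1)[OF \<epsilon>] _ f(2)], measurable)
      (rule integrable_scaleR_bounded[OF tilted_integrable(2)[OF \<epsilon>] _ f(2)], measurable)
  show "(\<integral>u. f u \<partial>tilted \<epsilon>) = (\<integral>u. (exp ((\<Phi> - \<epsilon>) * u) / p) *\<^sub>R f u \<partial>R)
        + (\<integral>u. (exp ((\<Phi> + \<epsilon>) * u) * w (- u)) *\<^sub>R f u \<partial>lborel)"
    unfolding tilted_def using i p w_nonneg
    by (subst integral_add_measure_complex) (auto simp: integrable_density integral_density)
  show "(\<integral>u. f u \<partial>tilted_limit \<epsilon>) = (\<integral>u. (c * exp (- \<epsilon> * \<bar>u\<bar>)) *\<^sub>R f u \<partial>lborel)"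
    unfolding tilted_limit_def using c_pos by (subst integral_density) auto
qed

text \<open>The pole terms \<open>c / (\<epsilon> - i * \<eta>)\<close> from the left and
  \<open>c / (\<epsilon> + i * \<eta>)\<close> from the right add up to the transform of
  \<open>c * exp (- \<epsilon> * \<bar>u\<bar>)\<close>. They cancel exactly, and only values of the
  regular part remain.\<close>

lemma tilted_char:
  assumes \<epsilon>: "0 < \<epsilon>" "\<epsilon> < \<Phi>" "\<epsilon> < \<Phi>' - \<Phi>"
  shows "(\<integral>u. iexp (\<eta> * u) \<partial>tilted \<epsilon>) - (\<integral>u. iexp (\<eta> * u) \<partial>tilted_limit \<epsilon>) =
     H (Complex (\<Phi> - \<epsilon>) \<eta>) - H (Complex (\<Phi> + \<epsilon>) \<eta>)"
proof -
  have e: "exp (x * u) *\<^sub>R iexp (\<eta> * u) = exp (Complex x \<eta> * of_real u)" for x u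
    by (simp add: scaleR_conv_of_real Complex_eq algebra_simps exp_add flip: exp_of_real)
  have "(\<integral>u. (exp ((\<Phi> - \<epsilon>) * u) / p) *\<^sub>R iexp (\<eta> * u) \<partial>R) = (\<integral>u. exp (Complex (\<Phi> - \<epsilon>) \<eta> * of_real u) / of_real p \<partial>R)"
    by (rule Bochner_Integration.integral_cong) (simp_all only: e[symmetric], simp add: scaleR_conv_of_real)
  then have 1: "(\<integral>u. (exp ((\<Phi> - \<epsilon>) * u) / p) *\<^sub>R iexp (\<eta> * u) \<partial>R) = B (Complex (\<Phi> - \<epsilon>) \<eta>)"
    by (simp add: B_def)
  have "(\<integral>u. (exp ((\<Phi> + \<epsilon>) * u) * w (- u)) *\<^sub>R iexp (\<eta> * u) \<partial>lborel) =
      (\<integral>u. w (- u) *\<^sub>R exp (Complex (\<Phi> + \<epsilon>) \<eta> * of_real u) \<partial>lborel)"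
    by (rule Bochner_Integration.integral_cong) (simp_all only: e[symmetric], simp add: scaleR_conv_of_real)
  then have 2: "(\<integral>u. (exp ((\<Phi> + \<epsilon>) * u) * w (- u)) *\<^sub>R iexp (\<eta> * u) \<partial>lborel) = V (Complex (\<Phi> + \<epsilon>) \<eta>)"
    unfolding V_def Wm_def using w_nonneg by (subst integral_density) auto
  have "(\<integral>u. (c * exp (- \<epsilon> * \<bar>u\<bar>)) *\<^sub>R iexp (\<eta> * u) \<partial>lborel) = (\<integral>u. c *\<^sub>R (exp (- \<epsilon> * \<bar>u\<bar>) *\<^sub>R iexp (\<eta> * u)) \<partial>lborel)"
    by simp
  also have "\<dots> = c *\<^sub>R (1 / (of_real \<epsilon> - \<i> * of_real \<eta>) + 1 / (of_real \<epsilon> + \<i> * of_real \<eta>))"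
    unfolding integral_scaleR_right lborel_two_sided_exp_transform(2)[OF \<epsilon>(1)] ..
  finally have 3: "(\<integral>u. (c * exp (- \<epsilon> * \<bar>u\<bar>)) *\<^sub>R iexp (\<eta> * u) \<partial>lborel) =
     of_real c / (of_real \<epsilon> - \<i> * of_real \<eta>) + of_real c / (of_real \<epsilon> + \<i> * of_real \<eta>)"
    by (simp add: scaleR_conv_of_real distrib_left)
  have z: "Complex (\<Phi> - \<epsilon>) \<eta> - of_real \<Phi> = - (of_real \<epsilon> - \<i> * of_real \<eta>)"
    "Complex (\<Phi> + \<epsilon>) \<eta> - of_real \<Phi> = of_real \<epsilon> + \<i> * of_real \<eta>"
    by (simp_all add: Complex_eq)
  have "B (Complex (\<Phi> - \<epsilon>) \<eta>) = H (Complex (\<Phi> - \<epsilon>) \<eta>) + of_real c / (of_real \<epsilon> - \<i> * of_real \<eta>)"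
  proof -
    have "0 < Re (Complex (\<Phi> - \<epsilon>) \<eta>)" "Re (Complex (\<Phi> - \<epsilon>) \<eta>) < \<Phi>" using \<epsilon> by auto
    from B_eq[OF this] show ?thesis by (simp only: z divide_minus_right diff_minus_eq_add)
  qed
  moreover have "V (Complex (\<Phi> + \<epsilon>) \<eta>) = of_real c / (of_real \<epsilon> + \<i> * of_real \<eta>) - H (Complex (\<Phi> + \<epsilon>) \<eta>)"
    using V_eq[of "Complex (\<Phi> + \<epsilon>) \<eta>"] \<epsilon> unfolding z by simp
  moreover have "(\<integral>u. iexp (\<eta> * u) \<partial>tilted \<epsilon>) - (\<integral>u. iexp (\<eta> * u) \<partial>tilted_limit \<epsilon>) =
      (\<integral>u. (exp ((\<Phi> - \<epsilon>) * u) / p) *\<^sub>R iexp (\<eta> * u) \<partial>R)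
        + (\<integral>u. (exp ((\<Phi> + \<epsilon>) * u) * w (- u)) *\<^sub>R iexp (\<eta> * u) \<partial>lborel)
        - (\<integral>u. (c * exp (- \<epsilon> * \<bar>u\<bar>)) *\<^sub>R iexp (\<eta> * u) \<partial>lborel)"
    using tilted_integral(3,4)[OF \<epsilon>(1,2), of "\<lambda>u. iexp (\<eta> * u)" 1] by simp
  ultimately show ?thesis unfolding 1 2 3 by simp
qed

text \<open>Uniform continuity of \<open>H\<close> on a compact rectangle across the line. The
  restriction to frequencies up to \<open>L\<close> is harmless against kernels with compactly
  supported Fourier transform.\<close>

lemma H_uniform:
  assumes "0 < \<delta>"
  obtains \<epsilon>1 where "0 < \<epsilon>1" "\<And>\<epsilon> \<eta>. 0 < \<epsilon> \<Longrightarrow> \<epsilon> < \<epsilon>1 \<Longrightarrow> \<bar>\<eta>\<bar> \<le> L \<Longrightarrow>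
      norm (H (Complex (\<Phi> - \<epsilon>) \<eta>) - H (Complex (\<Phi> + \<epsilon>) \<eta>)) \<le> \<delta>"
proof -
  define e where "e = min \<Phi> (\<Phi>' - \<Phi>) / 2"
  have e: "0 < e" "e < \<Phi>" "\<Phi> + e < \<Phi>'" using \<Phi> by (auto simp: e_def min_def field_simps)
  let ?K = "cbox (Complex (\<Phi> - e) (- L)) (Complex (\<Phi> + e) L)"
  have "continuous_on ?K H"
    using e by (intro continuous_on_subset[OF holomorphic_on_imp_continuous_on[OF H_holomorphic]])
      (auto simp: in_cbox_complex_iff)
  then have "uniformly_continuous_on ?K H"
    by (intro compact_uniformly_continuous compact_cbox)
  then obtain d where d: "d > 0" "\<And>x y. x \<in> ?K \<Longrightarrow> y \<in> ?K \<Longrightarrow> dist y x < d \<Longrightarrow> dist (H y) (H x) < \<delta>"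
    unfolding uniformly_continuous_on_def using assms by meson
  show ?thesis
  proof
    \<comment> \<open>The two points are \<open>2 * \<epsilon>\<close> apart, hence
      \<open>d / 2\<close>.\<close>
    show "0 < min e (d / 2)" using e d by simp
    fix \<epsilon> \<eta> assume \<epsilon>: "0 < \<epsilon>" "\<epsilon> < min e (d / 2)" "\<bar>\<eta>\<bar> \<le> L"
    have "dist (Complex (\<Phi> - \<epsilon>) \<eta>) (Complex (\<Phi> + \<epsilon>) \<eta>) < d"
      using \<epsilon> by (simp add: dist_norm cmod_def real_sqrt_mult)
    then have "dist (H (Complex (\<Phi> - \<epsilon>) \<eta>)) (H (Complex (\<Phi> + \<epsilon>) \<eta>)) < \<delta>"
      using \<epsilon> e by (intro d) (auto simp: in_cbox_complex_iff)
    then show "norm (H (Complex (\<Phi> - \<epsilon>) \<eta>) - H (Complex (\<Phi> + \<epsilon>) \<eta>)) \<le> \<delta>"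
      by (simp add: dist_norm)
  qed
qed

text \<open>A sequence, as dominated convergence requires. The factor \<open>1 / 2\<close> keeps
  \<open>\<Phi> - eps n\<close> and \<open>\<Phi> + eps n\<close> strictly inside the strip even for
  \<open>n = 0\<close>.\<close>

definition "eps n = min \<Phi> (\<Phi>' - \<Phi>) / 2 * inverse (real (Suc n))"

lemma eps: "0 < eps n" "eps n < \<Phi>" "eps n < \<Phi>' - \<Phi>" "eps n \<le> eps 0" "eps \<longlonglongrightarrow> 0"
proof -
  have m: "0 < min \<Phi> (\<Phi>' - \<Phi>)" using \<Phi> by simp
  then show "0 < eps n" by (simp add: eps_def)
  have "inverse (real (Suc n)) \<le> 1" by (simp add: field_simps)
  then show 1: "eps n \<le> eps 0" using m unfolding eps_def
    by (intro mult_left_mono) auto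
  moreover have "eps 0 = min \<Phi> (\<Phi>' - \<Phi>) / 2" by (simp add: eps_def)
  moreover have "x < y" if "x \<le> x'" "x' = y / 2" "0 < y" for x x' y :: real
    using that by linarith
  ultimately have "eps n < min \<Phi> (\<Phi>' - \<Phi>)" using m by blast
  then show "eps n < \<Phi>" "eps n < \<Phi>' - \<Phi>" by simp_all
  show "eps \<longlonglongrightarrow> 0"
    unfolding eps_def[abs_def] by (intro tendsto_mult_right_zero LIMSEQ_inverse_real_of_nat)
qed

lemma tilted_fejer_diff:
  assumes b: "0 < b"
  shows "(\<lambda>n. (\<integral>u. of_real ((fejer b u)\<^sup>2) * iexp (a * u) \<partial>tilted (eps n)) -
     (\<integral>u. of_real ((fejer b u)\<^sup>2) * iexp (a * u) \<partial>tilted_limit (eps n))) \<longlonglongrightarrow> 0"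
proof (rule tendstoI)
  fix e :: real assume e: "0 < e"
  \<comment> \<open>With this choice \<open>2 * b * (2 * b * \<delta>)\<close> equals
    \<open>e / 2\<close>.\<close>
  define \<delta> where "\<delta> = e / (8 * b\<^sup>2)"
  have \<delta>: "0 < \<delta>" "2 * b * (2 * b * \<delta>) < e" using e b by (auto simp: \<delta>_def power2_eq_square)
  obtain \<epsilon>1 where \<epsilon>1: "0 < \<epsilon>1" "\<And>\<epsilon> \<eta>. 0 < \<epsilon> \<Longrightarrow> \<epsilon> < \<epsilon>1 \<Longrightarrow> \<bar>\<eta>\<bar> \<le> \<bar>a\<bar> + 2 * b \<Longrightarrow>
      norm (H (Complex (\<Phi> - \<epsilon>) \<eta>) - H (Complex (\<Phi> + \<epsilon>) \<eta>)) \<le> \<delta>"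
    using H_uniform[OF \<delta>(1)] by metis
  have "eventually (\<lambda>n. eps n < \<epsilon>1) sequentially"
    using eps(5) \<epsilon>1(1) by (rule order_tendstoD)
  then show "eventually (\<lambda>n. dist ((\<integral>u. of_real ((fejer b u)\<^sup>2) * iexp (a * u) \<partial>tilted (eps n)) -
     (\<integral>u. of_real ((fejer b u)\<^sup>2) * iexp (a * u) \<partial>tilted_limit (eps n))) 0 < e) sequentially"
  proof eventually_elim
    case (elim n)
    have "norm ((\<integral>u. of_real ((fejer b u)\<^sup>2) * iexp (a * u) \<partial>tilted (eps n)) -
     (\<integral>u. of_real ((fejer b u)\<^sup>2) * iexp (a * u) \<partial>tilted_limit (eps n))) \<le> 2 * b * (2 * b * \<delta>)"
    proof (rule norm_integral_fejer_square_diff_le[OF b finite_tilted(1) sets_tilted(1) finite_tilted(2) sets_tilted(2)])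
      show "norm ((\<integral>u. iexp (\<eta> * u) \<partial>tilted (eps n)) - (\<integral>u. iexp (\<eta> * u) \<partial>tilted_limit (eps n))) \<le> \<delta>"
        if "\<bar>\<eta>\<bar> \<le> \<bar>a\<bar> + 2 * b" for \<eta>
        unfolding tilted_char[OF eps(1-3)] by (rule \<epsilon>1(2)[OF eps(1) elim that])
    qed (rule eps)+
    then show ?case using \<delta>(2) by simp
  qed
qed

lemma tilted_limit_fejer:
  assumes b: "0 < b"
  shows "(\<lambda>n. \<integral>u. of_real ((fejer b u)\<^sup>2) * iexp (a * u) \<partial>tilted_limit (eps n)) \<longlonglongrightarrow>
    (\<integral>u. (c * (fejer b u)\<^sup>2) *\<^sub>R iexp (a * u) \<partial>lborel)"
proof -
  have bd: "norm (of_real ((fejer b u)\<^sup>2) * iexp (a * u)) \<le> (2 * b)\<^sup>2" for u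
    using power_mono[OF abs_fejer_le(1)[OF b, of u], of 2] by (simp add: norm_mult norm_power)
  have "(\<integral>u. of_real ((fejer b u)\<^sup>2) * iexp (a * u) \<partial>tilted_limit (eps n)) =
      (\<integral>u. (c * exp (- eps n * \<bar>u\<bar>)) *\<^sub>R (of_real ((fejer b u)\<^sup>2) * iexp (a * u)) \<partial>lborel)" for n
    by (rule tilted_integral(4)[OF eps(1,2) _ bd]) measurable
  moreover have "(\<lambda>n. \<integral>u. (c * exp (- eps n * \<bar>u\<bar>)) *\<^sub>R (of_real ((fejer b u)\<^sup>2) * iexp (a * u)) \<partial>lborel) \<longlonglongrightarrow>
    (\<integral>u. (c * (fejer b u)\<^sup>2) *\<^sub>R iexp (a * u) \<partial>lborel)"
  proof (rule integral_dominated_convergence[where w = "\<lambda>u. c * (fejer b u)\<^sup>2"])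
    show "integrable lborel (\<lambda>u. c * (fejer b u)\<^sup>2)"
      using integrable_fejer_square[OF b] by simp
    show "AE u in lborel. (\<lambda>n. (c * exp (- eps n * \<bar>u\<bar>)) *\<^sub>R (of_real ((fejer b u)\<^sup>2) * iexp (a * u))) \<longlonglongrightarrow>
        (c * (fejer b u)\<^sup>2) *\<^sub>R iexp (a * u)"
    proof (rule AE_I2)
      fix u
      have "(\<lambda>n. (c * exp (- eps n * \<bar>u\<bar>)) *\<^sub>R (of_real ((fejer b u)\<^sup>2) * iexp (a * u))) \<longlonglongrightarrow>
         (c * exp (- 0 * \<bar>u\<bar>)) *\<^sub>R (of_real ((fejer b u)\<^sup>2) * iexp (a * u))"
        by (intro tendsto_intros eps)
      then show "(\<lambda>n. (c * exp (- eps n * \<bar>u\<bar>)) *\<^sub>R (of_real ((fejer b u)\<^sup>2) * iexp (a * u))) \<longlonglongrightarrow>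
        (c * (fejer b u)\<^sup>2) *\<^sub>R iexp (a * u)"
        by (simp add: scaleR_conv_of_real mult.assoc)
    qed
    show "AE u in lborel. norm ((c * exp (- eps n * \<bar>u\<bar>)) *\<^sub>R (of_real ((fejer b u)\<^sup>2) * iexp (a * u))) \<le> c * (fejer b u)\<^sup>2" for n
    proof (rule AE_I2)
      fix u
      have "exp (- eps n * \<bar>u\<bar>) \<le> 1" using eps(1)[of n] by simp
      then have "c * exp (- eps n * \<bar>u\<bar>) * (fejer b u)\<^sup>2 \<le> c * 1 * (fejer b u)\<^sup>2"
        using c_pos by (intro mult_right_mono mult_left_mono) auto
      then show "norm ((c * exp (- eps n * \<bar>u\<bar>)) *\<^sub>R (of_real ((fejer b u)\<^sup>2) * iexp (a * u))) \<le> c * (fejer b u)\<^sup>2"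
        using c_pos by (simp add: norm_mult norm_power)
    qed
  qed measurable
  ultimately show ?thesis by simp
qed

lemma tilted_fejer:
  assumes b: "0 < b"
  shows "(\<lambda>n. \<integral>u. of_real ((fejer b u)\<^sup>2) * iexp (a * u) \<partial>tilted (eps n)) \<longlonglongrightarrow>
    (\<integral>u. (c * (fejer b u)\<^sup>2) *\<^sub>R iexp (a * u) \<partial>lborel)"
  using tendsto_add[OF tilted_fejer_diff[OF b, of a] tilted_limit_fejer[OF b, of a]] by simp

text \<open>The kernel integrals converge and are therefore bounded in \<open>n\<close>. Both
  summands being nonnegative, each is bounded separately, and Fatou's lemma gives integrability at
  \<open>\<epsilon> = 0\<close>.\<close>

lemma tilted_zero_integrable:
  assumes b: "0 < b"
  shows "integrable R (\<lambda>u. exp (\<Phi> * u) / p * (fejer b u)\<^sup>2)"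
    and "integrable lborel (\<lambda>u. exp (\<Phi> * u) * w (- u) * (fejer b u)\<^sup>2)"
proof -
  let ?g1 = "\<lambda>n u. exp ((\<Phi> - eps n) * u) / p * (fejer b u)\<^sup>2"
  let ?g2 = "\<lambda>n u. exp ((\<Phi> + eps n) * u) * w (- u) * (fejer b u)\<^sup>2"
  have bd: "norm (complex_of_real ((fejer b u)\<^sup>2)) \<le> (2 * b)\<^sup>2" for u
    using power_mono[OF abs_fejer_le(1)[OF b, of u], of 2] by (simp add: norm_power)
  have i: "integrable R (?g1 n)" "integrable lborel (?g2 n)"
    and eq: "(\<integral>u. of_real ((fejer b u)\<^sup>2) \<partial>tilted (eps n)) =
      complex_of_real ((\<integral>u. ?g1 n u \<partial>R) + (\<integral>u. ?g2 n u \<partial>lborel))" for n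
  proof -
    have m: "(\<lambda>u. complex_of_real ((fejer b u)\<^sup>2)) \<in> borel_measurable borel" by measurable
    note t = tilted_integral(1-3)[OF eps(1,2)[of n] m bd]
    have s: "x *\<^sub>R complex_of_real y = complex_of_real (x * y)" for x y
      by (simp add: scaleR_conv_of_real)
    note t = t[unfolded s]
    show "integrable R (?g1 n)" "integrable lborel (?g2 n)"
      using integrable_Re[OF t(1)] integrable_Re[OF t(2)] by (simp_all only: Re_complex_of_real)
    show "(\<integral>u. of_real ((fejer b u)\<^sup>2) \<partial>tilted (eps n)) =
      complex_of_real ((\<integral>u. ?g1 n u \<partial>R) + (\<integral>u. ?g2 n u \<partial>lborel))"
      unfolding t(3) by (simp only: integral_complex_of_real of_real_add)
  qed
  have "Bseq (\<lambda>n. \<integral>u. complex_of_real ((fejer b u)\<^sup>2) \<partial>tilted (eps n))"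
    using tilted_fejer[OF b, of 0] by (intro convergent_imp_Bseq convergentI) simp
  then obtain C where "\<And>n. norm (\<integral>u. complex_of_real ((fejer b u)\<^sup>2) \<partial>tilted (eps n)) \<le> C"
    by (auto simp: Bseq_def)
  then have C: "norm (complex_of_real ((\<integral>u. ?g1 n u \<partial>R) + (\<integral>u. ?g2 n u \<partial>lborel))) \<le> C" for n
    unfolding eq[symmetric] .
  have nn: "0 \<le> ?g1 n u" "0 \<le> ?g2 n u" for n u using p w_nonneg by auto
  have le: "(\<integral>u. ?g1 n u \<partial>R) \<le> C" "(\<integral>u. ?g2 n u \<partial>lborel) \<le> C" for n
  proof -
    have abs_add: "x \<le> C \<and> y \<le> C" if "0 \<le> x" "0 \<le> y" "\<bar>x + y\<bar> \<le> C" for x y :: real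
      using that by linarith
    have "0 \<le> (\<integral>u. ?g1 n u \<partial>R)" "0 \<le> (\<integral>u. ?g2 n u \<partial>lborel)"
      by (rule Bochner_Integration.integral_nonneg, rule nn)+
    from abs_add[OF this C[of n, unfolded norm_of_real]]
    show "(\<integral>u. ?g1 n u \<partial>R) \<le> C" "(\<integral>u. ?g2 n u \<partial>lborel) \<le> C" by blast+
  qed
  show "integrable R (\<lambda>u. exp (\<Phi> * u) / p * (fejer b u)\<^sup>2)"
  proof (rule integrable_Fatou[OF i(1) nn(1) le(1)])
    fix u
    have "(\<lambda>n. ?g1 n u) \<longlonglongrightarrow> exp ((\<Phi> - 0) * u) / p * (fejer b u)\<^sup>2"
      using p by (intro tendsto_intros eps) auto
    then show "(\<lambda>n. ?g1 n u) \<longlonglongrightarrow> exp (\<Phi> * u) / p * (fejer b u)\<^sup>2" by simp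
  qed
  show "integrable lborel (\<lambda>u. exp (\<Phi> * u) * w (- u) * (fejer b u)\<^sup>2)"
  proof (rule integrable_Fatou[OF i(2) nn(2) le(2)])
    fix u
    have "(\<lambda>n. ?g2 n u) \<longlonglongrightarrow> exp ((\<Phi> + 0) * u) * w (- u) * (fejer b u)\<^sup>2"
      by (intro tendsto_intros eps)
    then show "(\<lambda>n. ?g2 n u) \<longlonglongrightarrow> exp (\<Phi> * u) * w (- u) * (fejer b u)\<^sup>2" by simp
  qed
qed

lemma fejer_transform_eq:
  assumes b: "0 < b"
  shows "(\<integral>u. (exp (\<Phi> * u) / p * (fejer b u)\<^sup>2) *\<^sub>R iexp (a * u) \<partial>R) +
     (\<integral>u. (exp (\<Phi> * u) * w (- u) * (fejer b u)\<^sup>2) *\<^sub>R iexp (a * u) \<partial>lborel) =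
     (\<integral>u. (c * (fejer b u)\<^sup>2) *\<^sub>R iexp (a * u) \<partial>lborel)"
proof -
  let ?f = "\<lambda>u. complex_of_real ((fejer b u)\<^sup>2) * iexp (a * u)"
  have bd: "norm (?f u) \<le> (2 * b)\<^sup>2" for u
    using power_mono[OF abs_fejer_le(1)[OF b, of u], of 2] by (simp add: norm_mult norm_power)
  have m: "?f \<in> borel_measurable borel" by measurable
  note t = tilted_integral(1-3)[OF eps(1,2) m bd]
  have s: "x *\<^sub>R ?f u = (x * (fejer b u)\<^sup>2) *\<^sub>R iexp (a * u)" for x u
    by (simp add: scaleR_conv_of_real)
  note t = t[unfolded s]
  have 1: "(\<lambda>n. \<integral>u. (exp ((\<Phi> - eps n) * u) / p * (fejer b u)\<^sup>2) *\<^sub>R iexp (a * u) \<partial>R) \<longlonglongrightarrow>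
      (\<integral>u. (exp (\<Phi> * u) / p * (fejer b u)\<^sup>2) *\<^sub>R iexp (a * u) \<partial>R)"
  proof (rule integral_dominated_convergence
      [where w = "\<lambda>u. exp (\<Phi> * u) / p * (fejer b u)\<^sup>2 + exp ((\<Phi> - eps 0) * u) / p * (fejer b u)\<^sup>2"])
    have "integrable R (\<lambda>u. norm ((exp ((\<Phi> - eps 0) * u) / p * (fejer b u)\<^sup>2) *\<^sub>R iexp (a * u)))"
      by (rule integrable_norm[OF t(1)])
    then have "integrable R (\<lambda>u. exp ((\<Phi> - eps 0) * u) / p * (fejer b u)\<^sup>2)"
      using p by (simp add: norm_mult)
    then show "integrable R (\<lambda>u. exp (\<Phi> * u) / p * (fejer b u)\<^sup>2 + exp ((\<Phi> - eps 0) * u) / p * (fejer b u)\<^sup>2)"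
      using tilted_zero_integrable(1)[OF b] by (rule Bochner_Integration.integrable_add[rotated])
    show "AE u in R. (\<lambda>n. (exp ((\<Phi> - eps n) * u) / p * (fejer b u)\<^sup>2) *\<^sub>R iexp (a * u)) \<longlonglongrightarrow>
        (exp (\<Phi> * u) / p * (fejer b u)\<^sup>2) *\<^sub>R iexp (a * u)"
    proof (rule AE_I2)
      fix u
      have "(\<lambda>n. (exp ((\<Phi> - eps n) * u) / p * (fejer b u)\<^sup>2) *\<^sub>R iexp (a * u)) \<longlonglongrightarrow>
        (exp ((\<Phi> - 0) * u) / p * (fejer b u)\<^sup>2) *\<^sub>R iexp (a * u)"
        using p by (intro tendsto_intros eps) auto
      then show "(\<lambda>n. (exp ((\<Phi> - eps n) * u) / p * (fejer b u)\<^sup>2) *\<^sub>R iexp (a * u)) \<longlonglongrightarrow>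
        (exp (\<Phi> * u) / p * (fejer b u)\<^sup>2) *\<^sub>R iexp (a * u)" by simp
    qed
    show "AE u in R. norm ((exp ((\<Phi> - eps n) * u) / p * (fejer b u)\<^sup>2) *\<^sub>R iexp (a * u))
        \<le> exp (\<Phi> * u) / p * (fejer b u)\<^sup>2 + exp ((\<Phi> - eps 0) * u) / p * (fejer b u)\<^sup>2" for n
    proof (rule AE_I2)
      fix u
      \<comment> \<open>For \<open>u \<ge> 0\<close> the exponential stays below its limit
        \<open>exp (\<Phi> * u)\<close>; for \<open>u < 0\<close> it is largest at
        \<open>n = 0\<close>. The majorant adds the two cases.\<close>
      have "exp ((\<Phi> - eps n) * u) \<le> exp (\<Phi> * u) + exp ((\<Phi> - eps 0) * u)"
      proof (cases "0 \<le> u")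
        case True
        then have "exp ((\<Phi> - eps n) * u) \<le> exp (\<Phi> * u)"
          using eps(1)[of n] by (simp add: mult_right_mono)
        then show ?thesis by (simp add: add_increasing2)
      next
        case False
        then have "exp ((\<Phi> - eps n) * u) \<le> exp ((\<Phi> - eps 0) * u)"
          using eps(4)[of n] by (simp add: mult_right_mono_neg)
        then show ?thesis by (simp add: add_increasing)
      qed
      then have "exp ((\<Phi> - eps n) * u) * ((fejer b u)\<^sup>2 / p) \<le> (exp (\<Phi> * u) + exp ((\<Phi> - eps 0) * u)) * ((fejer b u)\<^sup>2 / p)"
        using p by (intro mult_right_mono) auto
      then show "norm ((exp ((\<Phi> - eps n) * u) / p * (fejer b u)\<^sup>2) *\<^sub>R iexp (a * u))
        \<le> exp (\<Phi> * u) / p * (fejer b u)\<^sup>2 + exp ((\<Phi> - eps 0) * u) / p * (fejer b u)\<^sup>2"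
        using p by (simp add: norm_mult distrib_right add_divide_distrib)
    qed
  qed measurable
  have 2: "(\<lambda>n. \<integral>u. (exp ((\<Phi> + eps n) * u) * w (- u) * (fejer b u)\<^sup>2) *\<^sub>R iexp (a * u) \<partial>lborel) \<longlonglongrightarrow>
      (\<integral>u. (exp (\<Phi> * u) * w (- u) * (fejer b u)\<^sup>2) *\<^sub>R iexp (a * u) \<partial>lborel)"
  proof (rule integral_dominated_convergence[where w = "\<lambda>u. exp (\<Phi> * u) * w (- u) * (fejer b u)\<^sup>2"])
    show "integrable lborel (\<lambda>u. exp (\<Phi> * u) * w (- u) * (fejer b u)\<^sup>2)"
      by (rule tilted_zero_integrable(2)[OF b])
    show "AE u in lborel. (\<lambda>n. (exp ((\<Phi> + eps n) * u) * w (- u) * (fejer b u)\<^sup>2) *\<^sub>R iexp (a * u)) \<longlonglongrightarrow>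
        (exp (\<Phi> * u) * w (- u) * (fejer b u)\<^sup>2) *\<^sub>R iexp (a * u)"
    proof (rule AE_I2)
      fix u
      have "(\<lambda>n. (exp ((\<Phi> + eps n) * u) * w (- u) * (fejer b u)\<^sup>2) *\<^sub>R iexp (a * u)) \<longlonglongrightarrow>
        (exp ((\<Phi> + 0) * u) * w (- u) * (fejer b u)\<^sup>2) *\<^sub>R iexp (a * u)"
        by (intro tendsto_intros eps)
      then show "(\<lambda>n. (exp ((\<Phi> + eps n) * u) * w (- u) * (fejer b u)\<^sup>2) *\<^sub>R iexp (a * u)) \<longlonglongrightarrow>
        (exp (\<Phi> * u) * w (- u) * (fejer b u)\<^sup>2) *\<^sub>R iexp (a * u)" by simp
    qed
    show "AE u in lborel. norm ((exp ((\<Phi> + eps n) * u) * w (- u) * (fejer b u)\<^sup>2) *\<^sub>R iexp (a * u))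
        \<le> exp (\<Phi> * u) * w (- u) * (fejer b u)\<^sup>2" for n
    proof (rule AE_I2)
      fix u
      \<comment> \<open>Only \<open>u \<le> 0\<close> matters, as \<open>w (- u)\<close> vanishes
        for \<open>u > 0\<close>; there the larger exponent gives the smaller exponential.\<close>
      have "exp ((\<Phi> + eps n) * u) * w (- u) \<le> exp (\<Phi> * u) * w (- u)"
      proof (cases "0 < u")
        case True
        then show ?thesis using w_neg[of "- u"] by simp
      next
        case False
        then have "(\<Phi> + eps n) * u \<le> \<Phi> * u"
          using eps(1)[of n] by (intro mult_right_mono_neg) auto
        then show ?thesis using w_nonneg by (intro mult_right_mono) auto
      qed
      then have "exp ((\<Phi> + eps n) * u) * w (- u) * (fejer b u)\<^sup>2 \<le> exp (\<Phi> * u) * w (- u) * (fejer b u)\<^sup>2"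
        by (rule mult_right_mono) simp
      then show "norm ((exp ((\<Phi> + eps n) * u) * w (- u) * (fejer b u)\<^sup>2) *\<^sub>R iexp (a * u))
        \<le> exp (\<Phi> * u) * w (- u) * (fejer b u)\<^sup>2"
        using w_nonneg[of "- u"] by (simp add: norm_mult abs_mult)
    qed
  qed measurable
  show ?thesis
    using LIMSEQ_unique[OF tendsto_add[OF 1 2] tilted_fejer[OF b, of a, unfolded t(3)]] .
qed

section \<open>From transforms to the density of \<open>R\<close>\<close>

lemma fejer_measure_eq:
  assumes b: "0 < b"
  shows "add_measure (density R (\<lambda>u. ennreal (exp (\<Phi> * u) / p * (fejer b u)\<^sup>2)))
      (density lborel (\<lambda>u. ennreal (exp (\<Phi> * u) * w (- u) * (fejer b u)\<^sup>2))) =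
    density lborel (\<lambda>u. ennreal (c * (fejer b u)\<^sup>2))" (is "add_measure ?N1 ?N2 = ?N")
proof (rule finite_measure_char_uniqueness)
  have nn: "0 \<le> exp (\<Phi> * u) / p * (fejer b u)\<^sup>2" "0 \<le> exp (\<Phi> * u) * w (- u) * (fejer b u)\<^sup>2"
    "0 \<le> c * (fejer b u)\<^sup>2" for u
    using p w_nonneg c_pos by auto
  note i = tilted_zero_integrable[OF b]
  have i3: "integrable lborel (\<lambda>u. c * (fejer b u)\<^sup>2)"
    using integrable_fejer_square[OF b] by simp
  show "finite_measure (add_measure ?N1 ?N2)"
    by (intro finite_measure_add_measure finite_measure_density_ennreal i nn) simp
  show "finite_measure ?N" by (intro finite_measure_density_ennreal i3 nn)
  show "sets (add_measure ?N1 ?N2) = sets borel" "sets ?N = sets borel" by simp_all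
  fix t :: real
  have bd: "norm (iexp (t * u)) \<le> 1" for u by simp
  have si: "integrable R (\<lambda>u. (exp (\<Phi> * u) / p * (fejer b u)\<^sup>2) *\<^sub>R iexp (t * u))"
    "integrable lborel (\<lambda>u. (exp (\<Phi> * u) * w (- u) * (fejer b u)\<^sup>2) *\<^sub>R iexp (t * u))"
    by (rule integrable_scaleR_bounded[OF i(1) _ bd], measurable)
      (rule integrable_scaleR_bounded[OF i(2) _ bd], measurable)
  have "(\<integral>u. iexp (t * u) \<partial>add_measure ?N1 ?N2) = (\<integral>u. iexp (t * u) \<partial>?N1) + (\<integral>u. iexp (t * u) \<partial>?N2)"
    using si nn by (intro integral_add_measure_complex) (auto simp: integrable_density)
  also have "(\<integral>u. iexp (t * u) \<partial>?N1) = (\<integral>u. (exp (\<Phi> * u) / p * (fejer b u)\<^sup>2) *\<^sub>R iexp (t * u) \<partial>R)"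
    using nn(1) by (intro integral_density AE_I2) measurable
  also have "(\<integral>u. iexp (t * u) \<partial>?N2) = (\<integral>u. (exp (\<Phi> * u) * w (- u) * (fejer b u)\<^sup>2) *\<^sub>R iexp (t * u) \<partial>lborel)"
    using nn(2) by (intro integral_density AE_I2) measurable
  also note fejer_transform_eq[OF b, of t]
  also have "(\<integral>u. (c * (fejer b u)\<^sup>2) *\<^sub>R iexp (t * u) \<partial>lborel) = (\<integral>u. iexp (t * u) \<partial>?N)"
    using nn(3) by (intro integral_density[symmetric] AE_I2) measurable
  finally show "(\<integral>u. iexp (t * u) \<partial>add_measure ?N1 ?N2) = (\<integral>u. iexp (t * u) \<partial>?N)" .
qed

text \<open>The kernel with \<open>b = 1 / (n + 1)\<close> has no zero for
  \<open>\<bar>u\<bar> < n + 1\<close>, so kernel and tilt can be divided out on a bounded set. The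
  identity is stated as a sum because \<open>c * exp (- \<Phi> * u) - w (- u)\<close> is not yet
  known to be nonnegative.\<close>

lemma emeasure_R_bounded:
  assumes X [measurable]: "X \<in> sets borel" and sub: "X \<subseteq> {- real (Suc n) <..< real (Suc n)}"
  shows "emeasure R X + (\<integral>\<^sup>+u\<in>X. ennreal (p * w (- u)) \<partial>lborel) =
    (\<integral>\<^sup>+u\<in>X. ennreal (p * (c * exp (- \<Phi> * u))) \<partial>lborel)"
proof -
  define b where "b = 1 / real (Suc n)"
  have b: "0 < b" by (simp add: b_def)
  have k: "0 < (fejer b u)\<^sup>2" if "u \<in> X" for u
  proof -
    have "\<bar>u\<bar> < real (Suc n)" using subsetD[OF sub that] by (simp add: abs_less_iff)
    then have "\<bar>b * u\<bar> < 1" by (simp add: b_def abs_mult field_simps)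
    then have "\<bar>b * u\<bar> < pi" using pi_gt3 by linarith
    then show ?thesis using fejer_neq_0[OF b] by simp
  qed
  \<comment> \<open>\<open>\<phi>\<close> inverts both the kernel and the tilt, which turns the
    first tilted measure back into \<open>R\<close> on \<open>X\<close>.\<close>
  define \<phi> where "\<phi> u = indicator X u * ennreal (p * exp (- \<Phi> * u) / (fejer b u)\<^sup>2)" for u
  have [measurable]: "\<phi> \<in> borel_measurable borel" unfolding \<phi>_def by measurable
  have e: "exp (\<Phi> * u) * exp (- \<Phi> * u) = 1" for u by (simp flip: exp_add)
  have *: "ennreal (y * (fejer b u)\<^sup>2) * \<phi> u = ennreal (y * p * exp (- \<Phi> * u)) * indicator X u" if "0 \<le> y" for y u
  proof (cases "u \<in> X")
    case True
    have "y * (fejer b u)\<^sup>2 * (p * exp (- \<Phi> * u) / (fejer b u)\<^sup>2) = y * p * exp (- \<Phi> * u)"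
      using k[OF True] by simp
    then show ?thesis using True that p by (simp add: \<phi>_def del: times_divide_eq_right flip: ennreal_mult)
  qed (simp add: \<phi>_def)
  have "(\<integral>\<^sup>+u. \<phi> u \<partial>density R (\<lambda>u. ennreal (exp (\<Phi> * u) / p * (fejer b u)\<^sup>2))) +
     (\<integral>\<^sup>+u. \<phi> u \<partial>density lborel (\<lambda>u. ennreal (exp (\<Phi> * u) * w (- u) * (fejer b u)\<^sup>2))) =
     (\<integral>\<^sup>+u. \<phi> u \<partial>density lborel (\<lambda>u. ennreal (c * (fejer b u)\<^sup>2)))"
    unfolding fejer_measure_eq[OF b, symmetric] by (rule nn_integral_add_measure[symmetric]) simp_all
  moreover have "(\<integral>\<^sup>+u. \<phi> u \<partial>density R (\<lambda>u. ennreal (exp (\<Phi> * u) / p * (fejer b u)\<^sup>2))) = emeasure R X"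
  proof -
    have "(\<integral>\<^sup>+u. \<phi> u \<partial>density R (\<lambda>u. ennreal (exp (\<Phi> * u) / p * (fejer b u)\<^sup>2))) =
        (\<integral>\<^sup>+u. ennreal (exp (\<Phi> * u) / p * (fejer b u)\<^sup>2) * \<phi> u \<partial>R)"
      by (rule nn_integral_density) measurable
    also have "\<dots> = (\<integral>\<^sup>+u. indicator X u \<partial>R)"
    proof (rule nn_integral_cong)
      fix u
      have "exp (\<Phi> * u) / p * p * exp (- \<Phi> * u) = 1" using e[of u] p by simp
      then show "ennreal (exp (\<Phi> * u) / p * (fejer b u)\<^sup>2) * \<phi> u = indicator X u"
        using *[of "exp (\<Phi> * u) / p" u] p by simp
    qed
    finally show ?thesis by simp
  qed
  moreover have "(\<integral>\<^sup>+u. \<phi> u \<partial>density lborel (\<lambda>u. ennreal (exp (\<Phi> * u) * w (- u) * (fejer b u)\<^sup>2))) =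
      (\<integral>\<^sup>+u\<in>X. ennreal (p * w (- u)) \<partial>lborel)"
  proof -
    have "(\<integral>\<^sup>+u. \<phi> u \<partial>density lborel (\<lambda>u. ennreal (exp (\<Phi> * u) * w (- u) * (fejer b u)\<^sup>2))) =
        (\<integral>\<^sup>+u. ennreal (exp (\<Phi> * u) * w (- u) * (fejer b u)\<^sup>2) * \<phi> u \<partial>lborel)"
      by (rule nn_integral_density) measurable
    also have "\<dots> = (\<integral>\<^sup>+u\<in>X. ennreal (p * w (- u)) \<partial>lborel)"
    proof (rule nn_integral_cong)
      fix u
      have "exp (\<Phi> * u) * w (- u) * p * exp (- \<Phi> * u) = (exp (\<Phi> * u) * exp (- \<Phi> * u)) * (p * w (- u))"
        by (simp only: ac_simps)
      then have eq: "exp (\<Phi> * u) * w (- u) * p * exp (- \<Phi> * u) = p * w (- u)" unfolding e by simp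
      then show "ennreal (exp (\<Phi> * u) * w (- u) * (fejer b u)\<^sup>2) * \<phi> u = ennreal (p * w (- u)) * indicator X u"
        using *[of "exp (\<Phi> * u) * w (- u)" u, unfolded eq] w_nonneg by simp
    qed
    finally show ?thesis .
  qed
  moreover have "(\<integral>\<^sup>+u. \<phi> u \<partial>density lborel (\<lambda>u. ennreal (c * (fejer b u)\<^sup>2))) =
      (\<integral>\<^sup>+u\<in>X. ennreal (p * (c * exp (- \<Phi> * u))) \<partial>lborel)"
  proof -
    have "(\<integral>\<^sup>+u. \<phi> u \<partial>density lborel (\<lambda>u. ennreal (c * (fejer b u)\<^sup>2))) =
        (\<integral>\<^sup>+u. ennreal (c * (fejer b u)\<^sup>2) * \<phi> u \<partial>lborel)"
      by (rule nn_integral_density) measurable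
    also have "\<dots> = (\<integral>\<^sup>+u\<in>X. ennreal (p * (c * exp (- \<Phi> * u))) \<partial>lborel)"
      using *[of c] c_pos by (intro nn_integral_cong) (simp add: ac_simps)
    finally show ?thesis .
  qed
  ultimately show ?thesis by simp
qed

lemma nn_integral_exp_bounded:
  assumes X [measurable]: "X \<in> sets borel" and sub: "X \<subseteq> {- real (Suc n) <..< real (Suc n)}"
  shows "(\<integral>\<^sup>+u\<in>X. ennreal (p * (c * exp (- \<Phi> * u))) \<partial>lborel) < \<infinity>"
proof -
  have "(\<integral>\<^sup>+u\<in>X. ennreal (p * (c * exp (- \<Phi> * u))) \<partial>lborel) \<le>
      (\<integral>\<^sup>+u. ennreal (p * (c * exp (\<Phi> * real (Suc n)))) * indicator {- real (Suc n) <..< real (Suc n)} u \<partial>lborel)"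
  proof (rule nn_integral_mono)
    fix u
    show "ennreal (p * (c * exp (- \<Phi> * u))) * indicator X u \<le>
        ennreal (p * (c * exp (\<Phi> * real (Suc n)))) * indicator {- real (Suc n) <..< real (Suc n)} u"
    proof (cases "u \<in> X")
      case True
      then have "u \<in> {- real (Suc n) <..< real (Suc n)}" using sub by auto
      moreover from this have "\<Phi> * - u \<le> \<Phi> * real (Suc n)" using \<Phi> by (intro mult_left_mono) auto
      then have "p * (c * exp (- \<Phi> * u)) \<le> p * (c * exp (\<Phi> * real (Suc n)))"
        using p c_pos by (intro mult_left_mono) auto
      ultimately show ?thesis using True by (simp add: ennreal_leI del: of_nat_Suc)
    qed simp
  qed
  also have "\<dots> < \<infinity>" by (simp add: nn_integral_cmult_indicator ennreal_mult_less_top)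
  finally show ?thesis .
qed

text \<open>This is the positivity of the resolvent density. On the bounded set \<open>X\<close>
  where \<open>w (- u)\<close> is larger than \<open>c * exp (- \<Phi> * u)\<close>, the identity
  above bounds the integral of the larger function by that of the smaller, since
  \<open>emeasure R X \<ge> 0\<close>. The latter is finite, so \<open>X\<close> is a null
  set.\<close>

lemma w_le: "AE u in lborel. w (- u) \<le> c * exp (- \<Phi> * u)"
proof -
  have "AE u in lborel. u \<in> {- real (Suc n) <..< real (Suc n)} \<longrightarrow> w (- u) \<le> c * exp (- \<Phi> * u)" for n
  proof -
    define X where "X = {u \<in> {- real (Suc n) <..< real (Suc n)}. c * exp (- \<Phi> * u) < w (- u)}"
    have [measurable]: "X \<in> sets borel" unfolding X_def by measurable
    have sub: "X \<subseteq> {- real (Suc n) <..< real (Suc n)}" by (auto simp: X_def)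
    define h where "h = (\<lambda>u. ennreal (p * (c * exp (- \<Phi> * u))))"
    have [measurable]: "h \<in> borel_measurable borel" unfolding h_def by measurable
    define d where "d = (\<lambda>u. ennreal (p * (w (- u) - c * exp (- \<Phi> * u))))"
    have [measurable]: "d \<in> borel_measurable borel" unfolding d_def by measurable
    have "(\<integral>\<^sup>+u\<in>X. h u \<partial>lborel) + (\<integral>\<^sup>+u\<in>X. d u \<partial>lborel) = (\<integral>\<^sup>+u\<in>X. h u + d u \<partial>lborel)"
      by (simp add: distrib_right nn_integral_add)
    also have "\<dots> = (\<integral>\<^sup>+u\<in>X. ennreal (p * w (- u)) \<partial>lborel)"
      using p c_pos by (intro nn_integral_cong)
        (auto simp: indicator_def X_def h_def d_def algebra_simps simp flip: ennreal_plus)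
    also have "\<dots> \<le> emeasure R X + (\<integral>\<^sup>+u\<in>X. ennreal (p * w (- u)) \<partial>lborel)" by simp
    also have "\<dots> = (\<integral>\<^sup>+u\<in>X. h u \<partial>lborel)"
      unfolding h_def by (rule emeasure_R_bounded[OF _ sub]) measurable
    finally have "(\<integral>\<^sup>+u\<in>X. h u \<partial>lborel) + (\<integral>\<^sup>+u\<in>X. d u \<partial>lborel) \<le> (\<integral>\<^sup>+u\<in>X. h u \<partial>lborel) + 0" by simp
    moreover have "(\<integral>\<^sup>+u\<in>X. h u \<partial>lborel) \<noteq> \<top>"
      using nn_integral_exp_bounded[OF _ sub] by (simp add: h_def)
    ultimately have "(\<integral>\<^sup>+u\<in>X. d u \<partial>lborel) \<le> 0" by (simp only: ennreal_add_left_cancel_le) auto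
    then have "AE u in lborel. d u * indicator X u = 0"
      by (simp add: nn_integral_0_iff_AE)
    then show ?thesis
    proof eventually_elim
      case (elim u)
      then have "u \<notin> X" using p by (auto simp: d_def X_def mult_le_0_iff)
      then show ?case by (auto simp: X_def)
    qed
  qed
  then have "AE u in lborel. \<forall>n. u \<in> {- real (Suc n) <..< real (Suc n)} \<longrightarrow> w (- u) \<le> c * exp (- \<Phi> * u)"
    unfolding AE_all_countable by blast
  then show ?thesis
  proof eventually_elim
    case (elim u)
    obtain n where "\<bar>u\<bar> < real n" using reals_Archimedean2 by blast
    then have "u \<in> {- real (Suc n) <..< real (Suc n)}" by auto
    then show ?case using elim by blast
  qed
qed

text \<open>With positivity at hand, the term with \<open>w\<close> is finite on bounded sets and
  can be cancelled in the identity for \<open>R\<close>; bounded windows then exhaust the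
  line.\<close>

lemma R_eq: "R = density lborel (\<lambda>u. ennreal (p * (c * exp (- \<Phi> * u) - w (- u))))"
proof (rule measure_eqI)
  let ?g = "\<lambda>u. ennreal (p * (c * exp (- \<Phi> * u) - w (- u)))"
  let ?D = "density lborel ?g"
  show "sets R = sets ?D" by simp
  fix X assume "X \<in> sets R"
  then have [measurable]: "X \<in> sets borel" by simp
  define S where "S n = X \<inter> {- real (Suc n) <..< real (Suc n)}" for n
  have S [measurable]: "S n \<in> sets borel" for n unfolding S_def by measurable
  have eq: "emeasure R (S n) = emeasure ?D (S n)" for n
  proof -
    have sub: "S n \<subseteq> {- real (Suc n) <..< real (Suc n)}" by (simp add: S_def)
    have "(\<integral>\<^sup>+u\<in>S n. ?g u \<partial>lborel) + (\<integral>\<^sup>+u\<in>S n. ennreal (p * w (- u)) \<partial>lborel) =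
        (\<integral>\<^sup>+u\<in>S n. ?g u + ennreal (p * w (- u)) \<partial>lborel)"
      by (simp add: distrib_right nn_integral_add)
    also have "\<dots> = (\<integral>\<^sup>+u\<in>S n. ennreal (p * (c * exp (- \<Phi> * u))) \<partial>lborel)"
    proof (rule nn_integral_cong_AE)
      show "AE u in lborel. (?g u + ennreal (p * w (- u))) * indicator (S n) u =
          ennreal (p * (c * exp (- \<Phi> * u))) * indicator (S n) u"
        using w_le
      proof eventually_elim
        case (elim u)
        then have "?g u + ennreal (p * w (- u)) = ennreal (p * (c * exp (- \<Phi> * u) - w (- u)) + p * w (- u))"
          using p w_nonneg by (intro ennreal_plus[symmetric]) auto
        also have "p * (c * exp (- \<Phi> * u) - w (- u)) + p * w (- u) = p * (c * exp (- \<Phi> * u))"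
          by (simp add: algebra_simps)
        finally show ?case by simp
      qed
    qed
    also have "\<dots> = emeasure R (S n) + (\<integral>\<^sup>+u\<in>S n. ennreal (p * w (- u)) \<partial>lborel)"
      by (rule emeasure_R_bounded[OF S sub, symmetric])
    finally have eq: "(\<integral>\<^sup>+u\<in>S n. ?g u \<partial>lborel) + (\<integral>\<^sup>+u\<in>S n. ennreal (p * w (- u)) \<partial>lborel) =
        emeasure R (S n) + (\<integral>\<^sup>+u\<in>S n. ennreal (p * w (- u)) \<partial>lborel)" .
    have "(\<integral>\<^sup>+u\<in>S n. ennreal (p * w (- u)) \<partial>lborel) \<le> (\<integral>\<^sup>+u\<in>S n. ennreal (p * (c * exp (- \<Phi> * u))) \<partial>lborel)"
      unfolding emeasure_R_bounded[OF S sub, symmetric] by simp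
    then have fin: "(\<integral>\<^sup>+u\<in>S n. ennreal (p * w (- u)) \<partial>lborel) \<noteq> \<top>"
      using nn_integral_exp_bounded[OF S sub] by (auto simp: top_unique)
    have cancel: "x = y" if "x + z = y + z" "z \<noteq> \<top>" for x y z :: ennreal
      using that by (simp add: add.commute[of _ z])
    have "(\<integral>\<^sup>+u\<in>S n. ?g u \<partial>lborel) = emeasure R (S n)"
      by (rule cancel[OF eq fin])
    then show ?thesis by (simp add: emeasure_density)
  qed
  have lim: "(\<lambda>n. emeasure N (S n)) \<longlonglongrightarrow> emeasure N X" if "sets N = sets borel" for N :: "real measure"
  proof -
    have "(\<lambda>n. emeasure N (S n)) \<longlonglongrightarrow> emeasure N (\<Union>n. S n)"
    proof (rule Lim_emeasure_incseq)
      show "range S \<subseteq> sets N" unfolding that using S by blast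
      show "incseq S"
      proof (rule incseq_SucI)
        show "S n \<subseteq> S (Suc n)" for n
          unfolding S_def
          by (intro Int_mono subset_refl greaterThanLessThan_subseteq_greaterThanLessThan[THEN iffD2] impI conjI) simp_all
      qed
    qed
    moreover have "(\<Union>n. S n) = X"
    proof -
      have "\<exists>n. u \<in> {- real (Suc n) <..< real (Suc n)}" for u
      proof -
        obtain n where "\<bar>u\<bar> < real n" using reals_Archimedean2 by blast
        then have "u \<in> {- real (Suc n) <..< real (Suc n)}" by auto
        then show ?thesis by blast
      qed
      then have "(\<Union>n. {- real (Suc n) <..< real (Suc n)}) = UNIV" by blast
      then show ?thesis unfolding S_def by blast
    qed
    ultimately show ?thesis by simp
  qed
  have "(\<lambda>n. emeasure R (S n)) \<longlonglongrightarrow> emeasure R X" by (rule lim) simp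
  moreover have "(\<lambda>n. emeasure R (S n)) \<longlonglongrightarrow> emeasure ?D X"
    unfolding eq by (rule lim) simp
  ultimately show "emeasure R X = emeasure ?D X" by (rule LIMSEQ_unique)
qed

end

section \<open>Resolvent laws of a Levy process\<close>

text \<open>Rational times converging to \<open>t \<ge> 0\<close> from strictly above, since right
  continuity concerns the punctured right neighbourhood. For fixed \<open>n\<close> only countably
  many values occur, which yields joint measurability; \<open>max 0\<close> sends negative
  \<open>t\<close> to times at which \<open>X\<close> is measurable.\<close>

definition grid :: "nat \<Rightarrow> real \<Rightarrow> real" where
  "grid n t = max 0 ((of_int \<lfloor>real (Suc n) * t\<rfloor> + 1) / real (Suc n))"

lemma grid_gt:
  assumes "0 \<le> t"
  shows "t < grid n t" and "grid n t \<le> t + 1 / real (Suc n)"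
proof -
  let ?m = "real (Suc n)"
  have f: "?m * t < of_int \<lfloor>?m * t\<rfloor> + 1" "of_int \<lfloor>?m * t\<rfloor> \<le> ?m * t" by linarith+
  have m: "0 < ?m" by simp
  have "t < (of_int \<lfloor>?m * t\<rfloor> + 1) / ?m"
    using f(1) by (simp add: less_divide_eq mult.commute del: of_nat_Suc)
  then show "t < grid n t" by (simp add: grid_def del: of_nat_Suc)
  have "(of_int \<lfloor>?m * t\<rfloor> + 1) / ?m \<le> (?m * t + 1) / ?m"
    using f(2) m by (intro divide_right_mono) auto
  also have "\<dots> = t + 1 / ?m" using m by (simp add: add_divide_distrib del: of_nat_Suc)
  finally show "grid n t \<le> t + 1 / ?m"
    using assms m unfolding grid_def by (simp add: add_nonneg_nonneg del: of_nat_Suc)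
qed

lemma grid_filterlim:
  assumes "0 \<le> t"
  shows "filterlim (\<lambda>n. grid n t) (at_right t) sequentially"
proof -
  have "(\<lambda>n. grid n t) \<longlonglongrightarrow> t"
  proof (rule tendsto_sandwich)
    show "eventually (\<lambda>n. t \<le> grid n t) sequentially"
      using grid_gt(1)[OF assms] by (simp add: less_imp_le)
    show "eventually (\<lambda>n. grid n t \<le> t + inverse (real (Suc n))) sequentially"
      using grid_gt(2)[OF assms] by (simp add: inverse_eq_divide)
    show "(\<lambda>n. t + inverse (real (Suc n))) \<longlonglongrightarrow> t"
      by (rule LIMSEQ_inverse_real_of_nat_add)
  qed simp
  moreover have "grid n t \<noteq> t" for n using grid_gt(1)[OF assms, of n] by simp
  ultimately show ?thesis
    unfolding filterlim_at using grid_gt(1)[OF assms] by (auto intro!: always_eventually)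
qed

section \<open>Exponential moments and exponential times\<close>

context levy_process
begin

text \<open>Extended real valued, so that multiplicativity in \<open>t\<close> holds before any
  moment is known to be finite.\<close>

definition mgf :: "real \<Rightarrow> real \<Rightarrow> ennreal" where
  "mgf \<theta> t = (\<integral>\<^sup>+\<omega>. ennreal (exp (\<theta> * X t \<omega>)) \<partial>M)"

lemma mgf_add:
  assumes st: "0 \<le> s" "0 \<le> t"
  shows "mgf \<theta> (s + t) = mgf \<theta> s * mgf \<theta> t"
proof -
  note [measurable] = X_measurable[OF st(1)] X_measurable[OF st(2)] X_measurable[OF add_nonneg_nonneg[OF st]]
    X_measurable[OF order_refl]
  \<comment> \<open>The times \<open>0\<close>, \<open>s\<close>, \<open>s + t\<close>, continued
    constantly, because increments are indexed by a monotone sequence.\<close>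
  define T :: "nat \<Rightarrow> real" where "T i = (if i = 0 then 0 else if i = 1 then s else s + t)" for i
  have T: "0 \<le> T 0" "mono T" using st by (auto simp: T_def mono_def)
  let ?Y = "\<lambda>i \<omega>. ennreal (exp (\<theta> * (X (T (Suc i)) \<omega> - X (T i) \<omega>)))"
  have "indep_vars (\<lambda>_. borel) ?Y {..<2}"
    by (rule indep_vars_compose2[OF indep_increments[OF T]]) measurable
  then have "(\<integral>\<^sup>+\<omega>. (\<Prod>i<2. ?Y i \<omega>) \<partial>M) = (\<Prod>i<2. \<integral>\<^sup>+\<omega>. ?Y i \<omega> \<partial>M)"
    by (rule indep_vars_nn_integral[OF finite_lessThan]) simp
  then have "(\<integral>\<^sup>+\<omega>. ?Y 0 \<omega> * ?Y 1 \<omega> \<partial>M) = (\<integral>\<^sup>+\<omega>. ?Y 0 \<omega> \<partial>M) * (\<integral>\<^sup>+\<omega>. ?Y 1 \<omega> \<partial>M)"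
    by (simp add: numeral_2_eq_2 lessThan_Suc mult.commute)
  moreover have "(\<integral>\<^sup>+\<omega>. ?Y 0 \<omega> * ?Y 1 \<omega> \<partial>M) = mgf \<theta> (s + t)"
    unfolding mgf_def
  proof (rule nn_integral_cong_AE)
    show "AE \<omega> in M. ?Y 0 \<omega> * ?Y 1 \<omega> = ennreal (exp (\<theta> * X (s + t) \<omega>))"
      using X_zero by eventually_elim (simp add: T_def algebra_simps flip: ennreal_mult exp_add)
  qed
  moreover have "(\<integral>\<^sup>+\<omega>. ?Y 0 \<omega> \<partial>M) = mgf \<theta> s"
    unfolding mgf_def
  proof (rule nn_integral_cong_AE)
    show "AE \<omega> in M. ?Y 0 \<omega> = ennreal (exp (\<theta> * X s \<omega>))"
      using X_zero by eventually_elim (simp add: T_def)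
  qed
  moreover have "(\<integral>\<^sup>+\<omega>. ?Y 1 \<omega> \<partial>M) = mgf \<theta> t"
  proof -
    have "(\<integral>\<^sup>+\<omega>. ?Y 1 \<omega> \<partial>M) = (\<integral>\<^sup>+x. ennreal (exp (\<theta> * x)) \<partial>distr M borel (\<lambda>\<omega>. X (s + t) \<omega> - X s \<omega>))"
      by (subst nn_integral_distr) (auto simp: T_def)
    also have "\<dots> = (\<integral>\<^sup>+x. ennreal (exp (\<theta> * x)) \<partial>distr M borel (X t))"
      using stationary_increments[of s "s + t"] st by simp
    also have "\<dots> = mgf \<theta> t" unfolding mgf_def by (subst nn_integral_distr) auto
    finally show ?thesis .
  qed
  ultimately show ?thesis by simp
qed

lemma mgf_zero: "mgf \<theta> 0 = 1"
proof -
  have "mgf \<theta> 0 = (\<integral>\<^sup>+\<omega>. 1 \<partial>M)"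
    unfolding mgf_def
  proof (rule nn_integral_cong_AE)
    show "AE \<omega> in M. ennreal (exp (\<theta> * X 0 \<omega>)) = 1"
      using X_zero by eventually_elim simp
  qed
  then show ?thesis by (simp add: emeasure_space_1)
qed

lemma mgf_neq_0: "0 \<le> t \<Longrightarrow> mgf \<theta> t \<noteq> 0"
  unfolding mgf_def using X_measurable[of t] by (subst nn_integral_0_iff_AE) auto

lemma mgf_mult_nat:
  assumes "0 \<le> t"
  shows "mgf \<theta> (real k * t) = mgf \<theta> t ^ k"
proof (induction k)
  case (Suc k)
  have "mgf \<theta> (real (Suc k) * t) = mgf \<theta> (t + real k * t)" by (simp add: algebra_simps)
  also have "\<dots> = mgf \<theta> t * mgf \<theta> (real k * t)" using assms by (intro mgf_add) auto
  finally show ?case using Suc by simp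
qed (simp add: mgf_zero)

text \<open>The value at \<open>1 / (n + 1)\<close> is a root of order \<open>n + 1\<close> of
  \<open>exp a\<close>. Being finite and nonnegative it is determined by this, and its powers give
  the other rationals.\<close>

lemma mgf_rational:
  assumes one: "mgf \<theta> 1 = ennreal (exp a)"
  shows "mgf \<theta> (real k / real (Suc n)) = ennreal (exp (real k / real (Suc n) * a))"
proof -
  let ?m = "mgf \<theta> (1 / real (Suc n))"
  have "?m ^ Suc n = ennreal (exp a)"
    using mgf_mult_nat[of "1 / real (Suc n)" \<theta> "Suc n"] one by (simp del: of_nat_Suc power_Suc)
  moreover have "?m \<noteq> \<top>"
  proof
    assume "?m = \<top>"
    then have "?m ^ Suc n = \<top>" by (simp add: ennreal_top_mult power_eq_top_ennreal)
    then show False using \<open>?m ^ Suc n = ennreal (exp a)\<close> by simp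
  qed
  then obtain x where x: "?m = ennreal x" "0 \<le> x" by (cases ?m) auto
  ultimately have "ennreal (x ^ Suc n) = ennreal (exp a)"
    by (simp only: ennreal_power)
  then have "x ^ Suc n = exp a" using x(2) by (simp del: power_Suc)
  also have "exp a = exp (a / real (Suc n)) ^ Suc n"
    by (simp add: exp_of_nat_mult[symmetric] del: of_nat_Suc power_Suc)
  finally have "x = exp (a / real (Suc n))"
    using x(2) by (intro power_eq_imp_eq_base[of x "Suc n"]) auto
  then have "mgf \<theta> (real k * (1 / real (Suc n))) = ennreal (exp (a / real (Suc n)) ^ k)"
    using mgf_mult_nat[of "1 / real (Suc n)" \<theta> k] x by (simp add: ennreal_power)
  also have "exp (a / real (Suc n)) ^ k = exp (real k * (a / real (Suc n)))"
    by (rule exp_of_nat_mult[symmetric])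
  finally show ?thesis by (simp del: of_nat_Suc)
qed

lemma AE_grid_limit: "AE \<omega> in M. \<forall>t\<ge>0. (\<lambda>n. X (grid n t) \<omega>) \<longlonglongrightarrow> X t \<omega>"
  using cadlag
proof eventually_elim
  case (elim \<omega>)
  show ?case
  proof (intro allI impI)
    fix t :: real assume "0 \<le> t"
    then have "((\<lambda>s. X s \<omega>) \<longlongrightarrow> X t \<omega>) (at_right t)"
      using elim by (auto simp: continuous_within)
    then show "(\<lambda>n. X (grid n t) \<omega>) \<longlonglongrightarrow> X t \<omega>"
      by (rule filterlim_compose[OF _ grid_filterlim[OF \<open>0 \<le> t\<close>]])
  qed
qed

lemma grid_eq_rational:
  assumes "0 \<le> t"
  obtains k where "grid n t = real k / real (Suc n)"
proof -
  have "0 \<le> \<lfloor>real (Suc n) * t\<rfloor>" using assms by (simp del: of_nat_Suc)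
  then have "grid n t = real (nat (\<lfloor>real (Suc n) * t\<rfloor> + 1)) / real (Suc n)"
    by (simp add: grid_def del: of_nat_Suc)
  then show ?thesis using that by blast
qed

text \<open>Right continuity transfers the rational values to every time; with no majorant at hand,
  Fatou's lemma gives one inequality.\<close>

lemma mgf_le:
  assumes one: "mgf \<theta> 1 = ennreal (exp a)" and t: "0 \<le> t"
  shows "mgf \<theta> t \<le> ennreal (exp (t * a))"
proof -
  have g: "mgf \<theta> (grid n t) = ennreal (exp (grid n t * a))" for n
    using grid_eq_rational[OF t, of n] mgf_rational[OF one] by metis
  have "mgf \<theta> t = (\<integral>\<^sup>+\<omega>. liminf (\<lambda>n. ennreal (exp (\<theta> * X (grid n t) \<omega>))) \<partial>M)"
    unfolding mgf_def
  proof (rule nn_integral_cong_AE)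
    show "AE \<omega> in M. ennreal (exp (\<theta> * X t \<omega>)) = liminf (\<lambda>n. ennreal (exp (\<theta> * X (grid n t) \<omega>)))"
      using AE_grid_limit
    proof eventually_elim
      case (elim \<omega>)
      then have "(\<lambda>n. X (grid n t) \<omega>) \<longlonglongrightarrow> X t \<omega>" using t by blast
      then have "(\<lambda>n. ennreal (exp (\<theta> * X (grid n t) \<omega>))) \<longlonglongrightarrow> ennreal (exp (\<theta> * X t \<omega>))"
        by (intro tendsto_ennrealI tendsto_exp tendsto_mult_left)
      then show ?case using lim_imp_Liminf[OF sequentially_bot] by metis
    qed
  qed
  also have "\<dots> \<le> liminf (\<lambda>n. mgf \<theta> (grid n t))"
    unfolding mgf_def
  proof (rule nn_integral_liminf)
    fix n
    have "0 \<le> grid n t" by (simp add: grid_def)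
    from X_measurable[OF this] show "(\<lambda>\<omega>. ennreal (exp (\<theta> * X (grid n t) \<omega>))) \<in> borel_measurable M"
      by measurable
  qed
  also have "\<dots> = ennreal (exp (t * a))"
  proof (rule lim_imp_Liminf[OF sequentially_bot])
    have "(\<lambda>n. grid n t) \<longlonglongrightarrow> t"
      using grid_filterlim[OF t] by (simp add: filterlim_at)
    then show "(\<lambda>n. mgf \<theta> (grid n t)) \<longlonglongrightarrow> ennreal (exp (t * a))"
      unfolding g by (intro tendsto_ennrealI tendsto_exp tendsto_mult_right)
  qed
  finally show ?thesis .
qed

text \<open>Fatou only gives \<open>\<le>\<close>; applied at \<open>t\<close> and at \<open>N - t\<close> it gives equality, since the
  product over the two is known.\<close>

lemma mgf_eq:
  assumes one: "mgf \<theta> 1 = ennreal (exp a)" and t: "0 \<le> t"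
  shows "mgf \<theta> t = ennreal (exp (t * a))"
proof -
  obtain N :: nat where N: "t \<le> real N" using real_arch_simple by blast
  obtain x where x: "mgf \<theta> t = ennreal x" "0 \<le> x" "x \<le> exp (t * a)"
    using mgf_le[OF one t] by (cases "mgf \<theta> t") (auto simp: top_unique)
  obtain y where y: "mgf \<theta> (real N - t) = ennreal y" "0 \<le> y" "y \<le> exp ((real N - t) * a)"
    using mgf_le[OF one, of "real N - t"] N by (cases "mgf \<theta> (real N - t)") (auto simp: top_unique)
  have "mgf \<theta> (real N) = ennreal (exp (real N * a))"
    using mgf_rational[OF one, of N 0] by simp
  then have "ennreal (x * y) = ennreal (exp (real N * a))"
    using mgf_add[of t "real N - t" \<theta>] t N x y by (simp add: ennreal_mult)
  then have xy: "x * y = exp (t * a) * exp ((real N - t) * a)"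
    using x y by (simp add: algebra_simps flip: exp_add)
  have "exp (t * a) * exp ((real N - t) * a) \<le> x * exp ((real N - t) * a)"
    using x y unfolding xy[symmetric] by (intro mult_left_mono) auto
  then have "exp (t * a) \<le> x" by simp
  then show ?thesis using x by simp
qed

text \<open>The law of \<open>X\<close> at an independent exponential time. \<open>X\<close> is
  measurable at each fixed time only, so the limit along the grid serves as a jointly measurable
  version; almost surely it agrees with \<open>X s\<close> for all \<open>s \<ge> 0\<close>.\<close>

definition resolvent_law :: "real \<Rightarrow> real measure" where
  "resolvent_law p = distr (density lborel (\<lambda>s. ennreal (exponential_density p s)) \<Otimes>\<^sub>M M) borel
     (\<lambda>(s, \<omega>). lim (\<lambda>n. X (grid n s) \<omega>))"

text \<open>For fixed \<open>n\<close> the time enters through an integer-valued floor, which leaves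
  countably many fixed-time cases.\<close>

lemma measurable_lim_grid [measurable]:
  "(\<lambda>(s, \<omega>). lim (\<lambda>n. X (grid n s) \<omega>)) \<in> borel_measurable (borel \<Otimes>\<^sub>M M)"
proof -
  have "(\<lambda>x. X (grid n (fst x)) (snd x)) \<in> borel_measurable (borel \<Otimes>\<^sub>M M)" for n
  proof -
    have "(\<lambda>x. (\<lambda>(k::int) x. X (max 0 ((of_int k + 1) / real (Suc n))) (snd x)) \<lfloor>real (Suc n) * fst x\<rfloor> x)
        \<in> borel_measurable (borel \<Otimes>\<^sub>M M)"
    proof (rule measurable_compose_countable[where g = "\<lambda>x. \<lfloor>real (Suc n) * fst x\<rfloor>"
          and f = "\<lambda>(k::int) x. X (max 0 ((of_int k + 1) / real (Suc n))) (snd x)"])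
      show "(\<lambda>x. X (max 0 ((of_int k + 1) / real (Suc n))) (snd x)) \<in> borel_measurable (borel \<Otimes>\<^sub>M M)" for k :: int
        by (rule measurable_compose[OF measurable_snd X_measurable]) simp
      show "(\<lambda>x. \<lfloor>real (Suc n) * fst x\<rfloor>) \<in> measurable (borel \<Otimes>\<^sub>M M) (count_space UNIV)"
        by measurable
    qed
    then show ?thesis by (simp add: grid_def)
  qed
  then show ?thesis
    unfolding case_prod_beta' by (intro borel_measurable_lim_metric)
qed

lemma real_distribution_resolvent_law:
  assumes "0 < p"
  shows "real_distribution (resolvent_law p)"
proof -
  interpret E: prob_space "density lborel (\<lambda>s. ennreal (exponential_density p s))"
    using assms by (rule prob_space_exponential_density)
  interpret P: pair_prob_space "density lborel (\<lambda>s. ennreal (exponential_density p s))" M ..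
  show ?thesis unfolding resolvent_law_def
    by (rule P.real_distribution_distr) measurable
qed

lemma nn_integral_resolvent_law:
  assumes p: "0 < p" and f [measurable]: "f \<in> borel_measurable borel"
  shows "(\<integral>\<^sup>+u. f u \<partial>resolvent_law p) =
    (\<integral>\<^sup>+s. ennreal (exponential_density p s) * (\<integral>\<^sup>+\<omega>. f (X s \<omega>) \<partial>M) \<partial>lborel)"
proof -
  let ?E = "density lborel (\<lambda>s. ennreal (exponential_density p s))"
  let ?Y = "\<lambda>(s, \<omega>). lim (\<lambda>n. X (grid n s) \<omega>)"
  have "(\<integral>\<^sup>+u. f u \<partial>resolvent_law p) = (\<integral>\<^sup>+x. f (?Y x) \<partial>(?E \<Otimes>\<^sub>M M))"
    unfolding resolvent_law_def by (rule nn_integral_distr) measurable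
  also have "\<dots> = (\<integral>\<^sup>+s. \<integral>\<^sup>+\<omega>. f (?Y (s, \<omega>)) \<partial>M \<partial>?E)"
    by (rule nn_integral_fst[symmetric]) measurable
  also have "\<dots> = (\<integral>\<^sup>+s. ennreal (exponential_density p s) * (\<integral>\<^sup>+\<omega>. f (?Y (s, \<omega>)) \<partial>M) \<partial>lborel)"
    by (rule nn_integral_density) measurable
  also have "\<dots> = (\<integral>\<^sup>+s. ennreal (exponential_density p s) * (\<integral>\<^sup>+\<omega>. f (X s \<omega>) \<partial>M) \<partial>lborel)"
  proof (rule nn_integral_cong)
    fix s :: real
    show "ennreal (exponential_density p s) * (\<integral>\<^sup>+\<omega>. f (?Y (s, \<omega>)) \<partial>M) =
       ennreal (exponential_density p s) * (\<integral>\<^sup>+\<omega>. f (X s \<omega>) \<partial>M)"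
    proof (cases "0 \<le> s")
      case True
      have "(\<integral>\<^sup>+\<omega>. f (?Y (s, \<omega>)) \<partial>M) = (\<integral>\<^sup>+\<omega>. f (X s \<omega>) \<partial>M)"
      proof (rule nn_integral_cong_AE)
        show "AE \<omega> in M. f (?Y (s, \<omega>)) = f (X s \<omega>)"
          using AE_grid_limit
        proof eventually_elim
          case (elim \<omega>)
          then have "lim (\<lambda>n. X (grid n s) \<omega>) = X s \<omega>" using True by (intro limI) blast
          then show ?case by simp
        qed
      qed
      then show ?thesis by simp
    qed (simp add: exponential_density_def)
  qed
  finally show ?thesis .
qed

text \<open>The factor \<open>exp (s * a)\<close> turns the exponential density of rate
  \<open>p\<close> into \<open>p / (p - a)\<close> times the one of rate
  \<open>p - a\<close>.\<close>

lemma resolvent_law_transform: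
  assumes p: "0 < p" and one: "mgf \<theta> 1 = ennreal (exp a)" and a: "a < p"
  shows "has_bochner_integral (resolvent_law p) (\<lambda>u. exp (\<theta> * u)) (p / (p - a))"
proof (rule has_bochner_integral_nn_integral)
  show "(\<lambda>u. exp (\<theta> * u)) \<in> borel_measurable (resolvent_law p)"
    unfolding resolvent_law_def by measurable
  show "0 \<le> p / (p - a)" using p a by simp
  interpret E: prob_space "density lborel (\<lambda>s. ennreal (exponential_density (p - a) s))"
    using a by (intro prob_space_exponential_density) simp
  have "(\<integral>\<^sup>+u. ennreal (exp (\<theta> * u)) \<partial>resolvent_law p) =
      (\<integral>\<^sup>+s. ennreal (exponential_density p s) * mgf \<theta> s \<partial>lborel)"
    unfolding mgf_def by (rule nn_integral_resolvent_law[OF p]) measurable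
  also have "\<dots> = (\<integral>\<^sup>+s. ennreal (p / (p - a)) * ennreal (exponential_density (p - a) s) \<partial>lborel)"
  proof (rule nn_integral_cong)
    fix s :: real
    show "ennreal (exponential_density p s) * mgf \<theta> s = ennreal (p / (p - a)) * ennreal (exponential_density (p - a) s)"
    proof (cases "0 \<le> s")
      case True
      have "p * exp (- s * p) * exp (s * a) = p * exp (- s * (p - a))"
        by (simp add: algebra_simps flip: exp_add)
      also have "\<dots> = p / (p - a) * ((p - a) * exp (- s * (p - a)))"
        using a by simp
      finally have "p * exp (- s * p) * exp (s * a) = p / (p - a) * ((p - a) * exp (- s * (p - a)))" .
      then have "exponential_density p s * exp (s * a) = p / (p - a) * exponential_density (p - a) s"
        using True by (simp add: exponential_density_def)
      then show ?thesis
        using True p a by (simp add: mgf_eq[OF one] exponential_density_nonneg flip: ennreal_mult)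
    qed (simp add: exponential_density_def)
  qed
  also have "\<dots> = ennreal (p / (p - a)) * emeasure (density lborel (\<lambda>s. ennreal (exponential_density (p - a) s))) UNIV"
    by (subst nn_integral_cmult) (auto simp: emeasure_density)
  also have "\<dots> = ennreal (p / (p - a))" using E.emeasure_space_1 by simp
  finally show "(\<integral>\<^sup>+u. ennreal (exp (\<theta> * u)) \<partial>resolvent_law p) = ennreal (p / (p - a))" .
qed simp

end

section \<open>Scale functions\<close>

lemma scale_function_pos: "is_scale_function \<psi> p w \<Longrightarrow> 0 < x \<Longrightarrow> 0 < w x"
proof -
  assume w: "is_scale_function \<psi> p w" and x: "0 < x"
  have m: "strict_mono_on {0..} w" and "0 \<le> w 0"
    using w unfolding is_scale_function_def by blast+
  have "w 0 < w x" by (rule strict_mono_onD[OF m]) (use x in auto)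
  then show ?thesis using \<open>0 \<le> w 0\<close> by simp
qed

lemma scale_function_neg: "is_scale_function \<psi> p w \<Longrightarrow> x < 0 \<Longrightarrow> w x = 0"
  by (simp add: is_scale_function_def)

lemma scale_function_nonneg: "is_scale_function \<psi> p w \<Longrightarrow> 0 \<le> w x"
  unfolding is_scale_function_def by (metis linorder_not_less order_refl)

lemma scale_function_measurable:
  assumes w: "is_scale_function \<psi> p w"
  shows "w \<in> borel_measurable borel"
proof -
  have c: "continuous_on {0..} w" using w unfolding is_scale_function_def by blast
  have "(\<lambda>x. indicator {0..} x *\<^sub>R w x) = w"
  proof
    show "indicator {0..} x *\<^sub>R w x = w x" for x
      by (cases "x < 0") (simp_all add: scale_function_neg[OF w])
  qed
  moreover have "(\<lambda>x. indicator {0..} x *\<^sub>R w x) \<in> borel_measurable borel"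
    by (rule borel_measurable_continuous_on_indicator[OF _ c]) simp
  ultimately show ?thesis by (simp only:)
qed

lemma scale_function_laplace:
  assumes w: "is_scale_function \<psi> p w" and \<theta>: "right_inverse \<psi> p < \<theta>"
  shows "has_bochner_integral lborel (\<lambda>x. exp (- \<theta> * x) * w x) (1 / (\<psi> \<theta> - p))"
proof -
  have e: "indicator {0..} x *\<^sub>R (exp (- \<theta> * x) * w x) = exp (- \<theta> * x) * w x" for x
    by (cases "x < 0") (simp_all add: scale_function_neg[OF w])
  have "set_integrable lborel {0..} (\<lambda>x. exp (- \<theta> * x) * w x)"
    "(LBINT x:{0..}. exp (- \<theta> * x) * w x) = 1 / (\<psi> \<theta> - p)"
    using w \<theta> unfolding is_scale_function_def by blast+
  then show ?thesis
    unfolding has_bochner_integral_iff set_integrable_def set_lebesgue_integral_def e by blast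
qed

lemma scale_function_transform:
  assumes w: "is_scale_function \<psi> p w" and \<theta>: "right_inverse \<psi> p < \<theta>"
  shows "has_bochner_integral lborel (\<lambda>u. exp (\<theta> * u) * w (- u)) (1 / (\<psi> \<theta> - p))"
  using lborel_has_bochner_integral_real_affine_iff[of "-1" "\<lambda>x. exp (- \<theta> * x) * w x" "1 / (\<psi> \<theta> - p)" 0]
    scale_function_laplace[OF assms] by simp

text \<open>\<open>1 / (\<psi> \<theta> - p)\<close> is the integral of a nonnegative function that
  is positive on the open half-line, hence it is positive.\<close>

lemma scale_function_greater:
  assumes w: "is_scale_function \<psi> p w" and \<theta>: "right_inverse \<psi> p < \<theta>"
  shows "p < \<psi> \<theta>"
proof -
  note h = scale_function_laplace[OF assms]
  have nn: "0 \<le> exp (- \<theta> * x) * w x" for x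
    using scale_function_nonneg[OF w] by simp
  have "0 \<le> 1 / (\<psi> \<theta> - p)"
    unfolding has_bochner_integral_integral_eq[OF h, symmetric]
    by (rule Bochner_Integration.integral_nonneg) (rule nn)
  \<comment> \<open>As \<open>1 / 0 = 0\<close>, this also rules out
    \<open>\<psi> \<theta> = p\<close>.\<close>
  moreover have "1 / (\<psi> \<theta> - p) \<noteq> 0"
  proof
    assume "1 / (\<psi> \<theta> - p) = 0"
    then have z: "(\<integral>x. exp (- \<theta> * x) * w x \<partial>lborel) = 0"
      by (simp only: has_bochner_integral_integral_eq[OF h])
    have i: "integrable lborel (\<lambda>x. exp (- \<theta> * x) * w x)"
      using h by (rule integrable.intros)
    have "AE x in lborel. exp (- \<theta> * x) * w x = 0"
      by (rule integral_nonneg_eq_0_iff_AE[OF i AE_I2[OF nn], THEN iffD1, OF z])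
    then have "AE x in lborel. x \<notin> {0<..<1::real}"
    proof eventually_elim
      case (elim x)
      then show ?case using scale_function_pos[OF w, of x] by auto
    qed
    then have "emeasure lborel {0<..<1::real} = 0"
      by (subst (asm) AE_iff_measurable[where N = "{0<..<1}"]) auto
    then show False by simp
  qed
  ultimately show "p < \<psi> \<theta>" by (simp add: zero_le_divide_iff)
qed

lemma exp_le_one_plus_exp: "s \<le> t \<Longrightarrow> 0 \<le> s \<Longrightarrow> exp (s * x) \<le> 1 + exp (t * x)" for s t x :: real
proof (cases "0 \<le> x")
  case True
  assume "s \<le> t"
  then have "exp (s * x) \<le> exp (t * x)" using True by (simp add: mult_right_mono)
  then show ?thesis by (simp add: add_increasing)
next
  case False
  assume "0 \<le> s"
  then have "s * x \<le> 0" using False by (simp add: mult_nonneg_nonpos)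
  then have "exp (s * x) \<le> 1" by simp
  then show ?thesis by (simp add: add_increasing2)
qed

section \<open>The Laplace exponent and its right inverse\<close>

locale levy_process_scale = levy_process M X
  for M :: "'a measure" and X :: "real \<Rightarrow> 'a \<Rightarrow> real" +
  fixes W :: "real \<Rightarrow> real \<Rightarrow> real"
  assumes scale: "\<And>p. 0 \<le> p \<Longrightarrow> is_scale_function (laplace_exponent M X) p (W p)"
begin

abbreviation "\<psi> \<equiv> laplace_exponent M X"
abbreviation "\<Phi> \<equiv> right_inverse \<psi>"

lemma X1_measurable [measurable]: "X 1 \<in> borel_measurable M"
  by (rule X_measurable) simp

lemma \<psi>_greater: "0 \<le> p \<Longrightarrow> \<Phi> p < \<theta> \<Longrightarrow> p < \<psi> \<theta>"
  by (rule scale_function_greater[OF scale])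

text \<open>Finiteness is read off the logarithm: a function that is not integrable has Bochner
  integral \<open>0\<close>, and \<open>ln 0 = 0\<close>, contrary to \<open>\<psi> t > 0\<close>
  for \<open>t\<close> beyond \<open>\<Phi> 0\<close>. Smaller orders follow by domination.\<close>

lemma integrable_exp_X1:
  assumes "0 \<le> \<theta>"
  shows "integrable M (\<lambda>\<omega>. exp (\<theta> * X 1 \<omega>))"
proof -
  define t where "t = max \<theta> (\<Phi> 0) + 1"
  have "\<Phi> 0 < t" by (simp add: t_def)
  then have "0 < \<psi> t" by (intro \<psi>_greater) auto
  then have i: "integrable M (\<lambda>\<omega>. exp (t * X 1 \<omega>))"
    unfolding laplace_exponent_def using not_integrable_integral_eq by fastforce
  show ?thesis
  proof (rule Bochner_Integration.integrable_bound)
    show "integrable M (\<lambda>\<omega>. 1 + exp (t * X 1 \<omega>))" using i by simp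
    show "AE \<omega> in M. norm (exp (\<theta> * X 1 \<omega>)) \<le> norm (1 + exp (t * X 1 \<omega>))"
    proof (rule AE_I2)
      fix \<omega>
      have "exp (\<theta> * X 1 \<omega>) \<le> 1 + exp (t * X 1 \<omega>)"
        using assms by (intro exp_le_one_plus_exp) (auto simp: t_def)
      then show "norm (exp (\<theta> * X 1 \<omega>)) \<le> norm (1 + exp (t * X 1 \<omega>))" by simp
    qed
  qed measurable
qed

lemma exp_\<psi>:
  assumes "0 \<le> \<theta>"
  shows "(\<integral>\<omega>. exp (\<theta> * X 1 \<omega>) \<partial>M) = exp (\<psi> \<theta>)" and "mgf \<theta> 1 = ennreal (exp (\<psi> \<theta>))"
proof -
  have m: "mgf \<theta> 1 = ennreal (\<integral>\<omega>. exp (\<theta> * X 1 \<omega>) \<partial>M)"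
    unfolding mgf_def using integrable_exp_X1[OF assms] by (intro nn_integral_eq_integral) auto
  then have "0 < (\<integral>\<omega>. exp (\<theta> * X 1 \<omega>) \<partial>M)"
    using mgf_neq_0[of 1 \<theta>] by (simp add: ennreal_eq_0_iff not_le)
  then show 1: "(\<integral>\<omega>. exp (\<theta> * X 1 \<omega>) \<partial>M) = exp (\<psi> \<theta>)"
    by (simp add: laplace_exponent_def)
  show "mgf \<theta> 1 = ennreal (exp (\<psi> \<theta>))" using m 1 by simp
qed

lemma \<psi>_zero: "\<psi> 0 = 0"
  by (simp add: laplace_exponent_def prob_space)

text \<open>Integrate the convexity inequality \<open>exp (s y) \<le> 1 - s + s exp y\<close> at
  \<open>y = \<theta> X 1 - \<psi> \<theta>\<close>.\<close>

lemma \<psi>_scale_le: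
  assumes s: "0 \<le> s" "s \<le> 1" and \<theta>: "0 \<le> \<theta>"
  shows "\<psi> (s * \<theta>) \<le> s * \<psi> \<theta>"
proof -
  have le: "exp (s * y) \<le> 1 - s + s * exp y" for y :: real
    using convex_onD[OF exp_convex, of s 0 y] s by (simp add: algebra_simps)
  have "exp (s * \<theta> * x) \<le> exp (s * \<psi> \<theta>) * (1 - s + s * (exp (\<theta> * x) / exp (\<psi> \<theta>)))" for x
  proof -
    have "exp (s * \<theta> * x) = exp (s * \<psi> \<theta>) * exp (s * (\<theta> * x - \<psi> \<theta>))"
      by (simp add: algebra_simps flip: exp_add)
    also have "\<dots> \<le> exp (s * \<psi> \<theta>) * (1 - s + s * exp (\<theta> * x - \<psi> \<theta>))"
      using le by (intro mult_left_mono) auto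
    finally show ?thesis by (simp add: exp_diff)
  qed
  then have "(\<integral>\<omega>. exp (s * \<theta> * X 1 \<omega>) \<partial>M) \<le>
      (\<integral>\<omega>. exp (s * \<psi> \<theta>) * (1 - s + s * (exp (\<theta> * X 1 \<omega>) / exp (\<psi> \<theta>))) \<partial>M)"
    using s \<theta> integrable_exp_X1[of "s * \<theta>"] integrable_exp_X1[of \<theta>] by (intro integral_mono) auto
  also have "\<dots> = exp (s * \<psi> \<theta>) * (1 - s + s * ((\<integral>\<omega>. exp (\<theta> * X 1 \<omega>) \<partial>M) / exp (\<psi> \<theta>)))"
    using integrable_exp_X1[OF \<theta>] by (simp add: prob_space)
  also have "\<dots> = exp (s * \<psi> \<theta>)" using exp_\<psi>(1)[OF \<theta>] by simp
  finally show ?thesis using exp_\<psi>(1)[of "s * \<theta>"] s \<theta> by simp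
qed

text \<open>A convergent sequence of orders is bounded by some \<open>K\<close>, and
  \<open>1 + exp (K * X 1 \<omega>)\<close> is an integrable majorant.\<close>

lemma \<psi>_continuous: "continuous_on {0..} \<psi>"
proof -
  have "continuous_on {0..} (\<lambda>\<theta>. \<integral>\<omega>. exp (\<theta> * X 1 \<omega>) \<partial>M)"
    unfolding continuous_on_sequentially
  proof (intro allI ballI impI)
    fix x and a :: real assume a: "a \<in> {0..}" and x: "(\<forall>n. x n \<in> {0..}) \<and> x \<longlonglongrightarrow> a"
    then have "Bseq x" by (auto intro: convergent_imp_Bseq convergentI)
    then obtain K where K: "\<And>n. norm (x n) \<le> K" by (auto simp: Bseq_def)
    have K0: "0 \<le> K" using K[of 0] norm_ge_zero order_trans by blast
    show "((\<lambda>\<theta>. \<integral>\<omega>. exp (\<theta> * X 1 \<omega>) \<partial>M) \<circ> x) \<longlonglongrightarrow> (\<integral>\<omega>. exp (a * X 1 \<omega>) \<partial>M)"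
      unfolding comp_def
    proof (rule integral_dominated_convergence[where w = "\<lambda>\<omega>. 1 + exp (K * X 1 \<omega>)"])
      show "integrable M (\<lambda>\<omega>. 1 + exp (K * X 1 \<omega>))" using integrable_exp_X1[OF K0] by simp
      show "AE \<omega> in M. (\<lambda>n. exp (x n * X 1 \<omega>)) \<longlonglongrightarrow> exp (a * X 1 \<omega>)"
        using x by (intro AE_I2 tendsto_exp tendsto_mult_right) auto
      show "AE \<omega> in M. norm (exp (x n * X 1 \<omega>)) \<le> 1 + exp (K * X 1 \<omega>)" for n
      proof (rule AE_I2)
        fix \<omega>
        have "x n \<le> K" "0 \<le> x n" using K[of n] x by auto
        then show "norm (exp (x n * X 1 \<omega>)) \<le> 1 + exp (K * X 1 \<omega>)"
          using exp_le_one_plus_exp by simp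
      qed
    qed measurable
  qed
  then have "continuous_on {0..} (\<lambda>\<theta>. ln (\<integral>\<omega>. exp (\<theta> * X 1 \<omega>) \<partial>M))"
    by (intro continuous_on_ln) (auto simp: exp_\<psi>)
  then show ?thesis unfolding laplace_exponent_def[abs_def] .
qed

text \<open>The supremum is attained: the level set is closed by continuity, nonempty by the
  intermediate value theorem starting from \<open>\<psi> 0 = 0\<close>, and bounded because
  \<open>\<psi>\<close> exceeds \<open>p\<close> beyond \<open>\<Phi> p\<close>.\<close>

lemma \<Phi>_nonneg_and_\<psi>_\<Phi>:
  assumes p: "0 \<le> p"
  shows "0 \<le> \<Phi> p" and "\<psi> (\<Phi> p) = p"
proof -
  let ?S = "{s. 0 \<le> s \<and> \<psi> s = p}"
  \<comment> \<open>So far \<open>\<Phi> p\<close> is the \<open>Sup\<close> of a set that might be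
    empty or unbounded; the maximum with \<open>0\<close> copes with any value.\<close>
  define t where "t = max 0 (\<Phi> p) + 1"
  have t: "0 \<le> t" "p < \<psi> t" using \<psi>_greater[OF p, of t] by (auto simp: t_def)
  have "\<exists>s\<ge>0. s \<le> t \<and> \<psi> s = p"
    using t p \<psi>_zero by (intro IVT') (auto intro: continuous_on_subset[OF \<psi>_continuous])
  then have ne: "?S \<noteq> {}" by auto
  have bd: "bdd_above ?S"
  proof (rule bdd_aboveI)
    show "s \<le> \<Phi> p" if "s \<in> ?S" for s
      using that \<psi>_greater[OF p, of s] by (auto simp: not_less[symmetric])
  qed
  have "closed ?S"
  proof -
    have "closed {x \<in> {0..}. \<psi> x = p}"
      by (intro continuous_closed_preimage_constant \<psi>_continuous closed_atLeast)
    then show ?thesis by simp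
  qed
  from closed_contains_Sup[OF ne bd this] show "0 \<le> \<Phi> p" "\<psi> (\<Phi> p) = p"
    by (auto simp: right_inverse_def)
qed

lemma \<Phi>_pos: "0 < p \<Longrightarrow> 0 < \<Phi> p"
  using \<Phi>_nonneg_and_\<psi>_\<Phi>[of p] \<psi>_zero by (cases "\<Phi> p = 0") auto

text \<open>Convexity along the segment from \<open>0\<close>: as \<open>\<psi> 0 = 0\<close> and
  \<open>\<psi> (\<Phi> p) = p\<close>, the value at \<open>\<theta>\<close> lies below the chord,
  which has height \<open>p * \<theta> / \<Phi> p < p\<close> there.\<close>

lemma \<psi>_less:
  assumes p: "0 < p" and \<theta>: "0 \<le> \<theta>" "\<theta> < \<Phi> p"
  shows "\<psi> \<theta> < p"
proof -
  have \<Phi>: "0 < \<Phi> p" "\<psi> (\<Phi> p) = p" using \<Phi>_pos \<Phi>_nonneg_and_\<psi>_\<Phi> p by auto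
  then have "\<psi> (\<theta> / \<Phi> p * \<Phi> p) \<le> \<theta> / \<Phi> p * \<psi> (\<Phi> p)"
    using \<theta> by (intro \<psi>_scale_le) auto
  also have "\<dots> < 1 * p"
    unfolding \<Phi>(2) using p \<theta> \<Phi> by (intro mult_strict_right_mono) auto
  finally show ?thesis using \<Phi> by simp
qed

lemma \<Phi>_strict_mono:
  assumes "0 < p" "p < r"
  shows "\<Phi> p < \<Phi> r"
proof (rule ccontr)
  assume "\<not> \<Phi> p < \<Phi> r"
  moreover have "\<psi> (\<Phi> r) = r" "0 \<le> \<Phi> r" "\<psi> (\<Phi> p) = p"
    using \<Phi>_nonneg_and_\<psi>_\<Phi> assms by auto
  ultimately show False
    using \<psi>_less[OF assms(1), of "\<Phi> r"] assms by (cases "\<Phi> r = \<Phi> p") auto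
qed

text \<open>\<open>\<psi>\<close> is bounded on \<open>{0..B}\<close>, so a level above that bound
  is attained only beyond \<open>B\<close>.\<close>

lemma \<Phi>_at_top: "filterlim \<Phi> at_top at_top"
  unfolding filterlim_at_top
proof
  fix B :: real
  have "compact (\<psi> ` {0..B})"
    by (intro compact_continuous_image continuous_on_subset[OF \<psi>_continuous]) auto
  then have "bdd_above (\<psi> ` {0..B})"
    by (intro bounded_imp_bdd_above compact_imp_bounded)
  then obtain K where "\<forall>y \<in> \<psi> ` {0..B}. y \<le> K" unfolding bdd_above_def ..
  then have K: "\<psi> x \<le> K" if "x \<in> {0..B}" for x using that by simp
  show "eventually (\<lambda>p. B \<le> \<Phi> p) at_top"
    using eventually_gt_at_top[of "max 0 K"]
  proof eventually_elim
    case (elim p)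
    then have "\<psi> (\<Phi> p) = p" "0 \<le> \<Phi> p" using \<Phi>_nonneg_and_\<psi>_\<Phi>[of p] by auto
    then show ?case using K[of "\<Phi> p"] elim by (cases "\<Phi> p \<le> B") auto
  qed
qed

lemma resolvent_law_has_transform:
  assumes "0 < p" "0 \<le> \<theta>" "\<theta> < \<Phi> p"
  shows "has_bochner_integral (resolvent_law p) (\<lambda>u. exp (\<theta> * u)) (p / (p - \<psi> \<theta>))"
  using assms by (intro resolvent_law_transform exp_\<psi>(2) \<psi>_less)

text \<open>An instance of the analytic core; any rate above \<open>p\<close> serves for the
  continuation, here \<open>p + 1\<close>. The constant \<open>c\<close> is identified through the
  derivative of \<open>\<psi>\<close> at \<open>\<Phi> p\<close>, and the bound on \<open>w\<close>
  becomes positivity of the density.\<close>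

lemma resolvent_law_eq:
  assumes p: "0 < p"
  shows "resolvent_law p = density lborel (\<lambda>u. ennreal (p * resolvent_density \<psi> W p u))"
    and "AE u in lborel. 0 \<le> resolvent_density \<psi> W p u"
proof -
  interpret R: real_distribution "resolvent_law p" by (rule real_distribution_resolvent_law[OF p])
  interpret R': real_distribution "resolvent_law (p + 1)"
    using p by (intro real_distribution_resolvent_law) simp
  interpret T: resolvent_transform "resolvent_law p" "resolvent_law (p + 1)" \<psi> "W p" p "p + 1" "\<Phi> p" "\<Phi> (p + 1)"
  proof
    have s: "is_scale_function \<psi> p (W p)" using p by (intro scale) simp
    show "0 < p" by fact
    show "p < p + 1" by simp
    show "0 < \<Phi> p" by (rule \<Phi>_pos[OF p])
    show "\<Phi> p < \<Phi> (p + 1)" using p by (intro \<Phi>_strict_mono) auto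
    show "has_bochner_integral (resolvent_law p) (\<lambda>u. exp (\<theta> * u)) (p / (p - \<psi> \<theta>))"
      if "0 \<le> \<theta>" "\<theta> < \<Phi> p" for \<theta> by (rule resolvent_law_has_transform[OF p that])
    show "has_bochner_integral (resolvent_law (p + 1)) (\<lambda>u. exp (\<theta> * u)) ((p + 1) / (p + 1 - \<psi> \<theta>))"
      if "0 \<le> \<theta>" "\<theta> < \<Phi> (p + 1)" for \<theta> using p by (intro resolvent_law_has_transform that) simp
    show "has_bochner_integral lborel (\<lambda>u. exp (\<theta> * u) * W p (- u)) (1 / (\<psi> \<theta> - p))"
      if "\<Phi> p < \<theta>" for \<theta> by (rule scale_function_transform[OF s that])
    show "W p \<in> borel_measurable borel" by (rule scale_function_measurable[OF s])
    show "W p x = 0" if "x < 0" for x using s that by (simp add: is_scale_function_def)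
    show "0 \<le> W p x" for x by (rule scale_function_nonneg[OF s])
    show "0 < W p x" if "0 < x" for x by (rule scale_function_pos[OF s that])
    show "\<psi> (\<Phi> p) = p" using p by (intro \<Phi>_nonneg_and_\<psi>_\<Phi>) simp
    show "\<psi> \<theta> < p" if "0 \<le> \<theta>" "\<theta> < \<Phi> p" for \<theta> by (rule \<psi>_less[OF p that])
    show "p < \<psi> \<theta> \<and> \<psi> \<theta> < p + 1" if "\<Phi> p < \<theta>" "\<theta> < \<Phi> (p + 1)" for \<theta>
      using that p \<Phi>_pos[OF p] by (intro conjI \<psi>_greater \<psi>_less) auto
  qed
  have c: "T.c = 1 / deriv \<psi> (\<Phi> p)"
    using DERIV_imp_deriv[OF T.\<psi>_deriv] by (simp add: T.c_def)
  have d: "T.c * exp (- \<Phi> p * u) - W p (- u) = resolvent_density \<psi> W p u" for u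
    by (simp add: resolvent_density_def c)
  show "resolvent_law p = density lborel (\<lambda>u. ennreal (p * resolvent_density \<psi> W p u))"
    using T.R_eq unfolding d .
  show "AE u in lborel. 0 \<le> resolvent_density \<psi> W p u"
    using T.w_le by eventually_elim (simp add: d[symmetric])
qed

end

section \<open>Weak limits\<close>

text \<open>Levy's continuity theorem concerns sequences, so the filter is tested along sequences
  that tend to infinity.\<close>

lemma weak_conv_along_at_topI:
  fixes N :: "real \<Rightarrow> real measure"
  assumes N: "\<And>r. 0 < r \<Longrightarrow> real_distribution (N r)" and \<mu>: "real_distribution \<mu>"
    and char: "\<And>t. ((\<lambda>r. char (N r) t) \<longlongrightarrow> char \<mu> t) at_top"
  shows "weak_conv_along N \<mu> at_top"
  unfolding weak_conv_along_def
proof (intro allI impI)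
  fix f :: "real \<Rightarrow> real" assume f: "continuous_on UNIV f \<and> bounded (range f)"
  show "((\<lambda>r. \<integral>x. f x \<partial>N r) \<longlongrightarrow> (\<integral>x. f x \<partial>\<mu>)) at_top"
  proof (rule tendsto_at_topI_sequentially)
    fix Y :: "nat \<Rightarrow> real" assume Y: "filterlim Y at_top sequentially"
    \<comment> \<open>\<open>N r\<close> is a distribution for \<open>r > 0\<close> only; the cut at
      \<open>1\<close> alters finitely many terms.\<close>
    define Y' where "Y' n = max 1 (Y n)" for n
    have rd: "real_distribution (N (Y' n))" for n by (rule N) (simp add: Y'_def)
    have Y': "filterlim Y' at_top sequentially"
      by (rule filterlim_at_top_mono[OF Y]) (simp add: Y'_def)
    have "weak_conv_m (\<lambda>n. N (Y' n)) \<mu>"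
      by (rule levy_continuity[OF rd \<mu>]) (rule filterlim_compose[OF char Y'])
    then have "weak_conv_along (\<lambda>n. N (Y' n)) \<mu> sequentially"
      using weak_conv_along_sequentially_iff[OF rd \<mu>] by simp
    then have l: "(\<lambda>n. \<integral>x. f x \<partial>N (Y' n)) \<longlonglongrightarrow> (\<integral>x. f x \<partial>\<mu>)"
      using f unfolding weak_conv_along_def by simp
    have "eventually (\<lambda>n. 1 \<le> Y n) sequentially"
      using Y unfolding filterlim_at_top by simp
    then have "eventually (\<lambda>n. (\<integral>x. f x \<partial>N (Y' n)) = (\<integral>x. f x \<partial>N (Y n))) sequentially"
      by eventually_elim (simp add: Y'_def max_def)
    then show "(\<lambda>n. \<integral>x. f x \<partial>N (Y n)) \<longlonglongrightarrow> (\<integral>x. f x \<partial>\<mu>)"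
      by (rule Lim_transform_eventually[OF l])
  qed
qed

section \<open>Convolutions and the exponential law\<close>

lemma real_distribution_convolution:
  assumes "real_distribution N1" "real_distribution N2"
  shows "real_distribution (convolution N1 N2)"
proof -
  interpret N1: real_distribution N1 by fact
  interpret N2: real_distribution N2 by fact
  interpret pair_prob_space N1 N2 ..
  show ?thesis unfolding convolution_def by (rule real_distribution_distr) measurable
qed

lemma char_convolution:
  assumes "real_distribution N1" "real_distribution N2"
  shows "char (convolution N1 N2) t = char N1 t * char N2 t"
proof -
  interpret N1: real_distribution N1 by fact
  interpret N2: real_distribution N2 by fact
  interpret pair_prob_space N1 N2 ..
  let ?f = "\<lambda>x. iexp (t * fst x) * iexp (t * snd x)"
  have i: "integrable (N1 \<Otimes>\<^sub>M N2) ?f"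
    by (rule P.integrable_const_bound[where B = 1]) (auto simp: norm_mult)
  have "char (convolution N1 N2) t = (\<integral>x. iexp (t * (fst x + snd x)) \<partial>(N1 \<Otimes>\<^sub>M N2))"
    unfolding char_def convolution_def by (subst integral_distr) (auto simp: case_prod_beta')
  also have "\<dots> = (\<integral>x. ?f x \<partial>(N1 \<Otimes>\<^sub>M N2))"
    by (simp add: distrib_left exp_add)
  also have "\<dots> = (\<integral>x. (\<integral>y. iexp (t * x) * iexp (t * y) \<partial>N2) \<partial>N1)"
    using integral_fst'[OF i] by simp
  also have "\<dots> = (\<integral>x. iexp (t * x) * (\<integral>y. iexp (t * y) \<partial>N2) \<partial>N1)"
    by simp
  also have "\<dots> = char N1 t * char N2 t"
    unfolding char_def by (rule integral_mult_left_zero)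
  finally show ?thesis .
qed

definition exponential_law :: "real \<Rightarrow> real measure" where
  "exponential_law a = density lborel (\<lambda>x. ennreal (exponential_density a x))"

lemma real_distribution_exponential_law: "0 < a \<Longrightarrow> real_distribution (exponential_law a)"
  unfolding exponential_law_def
  by (intro real_distribution.intro prob_space_exponential_density real_distribution_axioms.intro) simp_all

lemma AE_exponential_law: "AE x in exponential_law a. 0 \<le> x"
  unfolding exponential_law_def
  by (subst AE_density) (auto simp: exponential_density_def)

lemma exponential_law_laplace:
  assumes a: "0 < a" and \<theta>: "0 \<le> \<theta>"
  shows "(\<integral>y. exp (- \<theta> * y) \<partial>exponential_law a) = a / (a + \<theta>)"
proof -
  interpret P: prob_space "density lborel (\<lambda>x. ennreal (exponential_density (a + \<theta>) x))"
    using assms by (intro prob_space_exponential_density) simp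
  have e: "exponential_density a x *\<^sub>R exp (- \<theta> * x) = exponential_density (a + \<theta>) x *\<^sub>R (a / (a + \<theta>))" for x
  proof (cases "x < 0")
    case False
    have "exp (- x * a) * exp (- \<theta> * x) = exp (- x * (a + \<theta>))"
      by (simp add: algebra_simps flip: exp_add)
    then show ?thesis using False assms by (simp add: exponential_density_def)
  qed (simp add: exponential_density_def)
  have "(\<integral>y. exp (- \<theta> * y) \<partial>exponential_law a) = (\<integral>x. exponential_density a x *\<^sub>R exp (- \<theta> * x) \<partial>lborel)"
    unfolding exponential_law_def using a
    by (intro integral_density AE_I2 exponential_density_nonneg) measurable
  also have "\<dots> = (\<integral>x. a / (a + \<theta>) \<partial>density lborel (\<lambda>x. ennreal (exponential_density (a + \<theta>) x)))"
    unfolding e using assms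
    by (intro integral_density[symmetric] AE_I2 exponential_density_nonneg) auto
  also have "\<dots> = a / (a + \<theta>)" using P.prob_space by simp
  finally show ?thesis .
qed

text \<open>Lebesgue null sets are invariant under the reflection taking \<open>x\<close> to
  \<open>u - x\<close>. This makes the integrand of the convolution nonnegative for each fixed
  \<open>u\<close>.\<close>

lemma AE_reflect:
  fixes g :: "real \<Rightarrow> real"
  assumes g: "AE u in lborel. 0 \<le> g u" and [measurable]: "g \<in> borel_measurable borel"
  shows "AE x in lborel. 0 \<le> g (u - x)"
proof -
  have "(\<integral>\<^sup>+x. indicator {x. g x < 0} x \<partial>lborel) = 0"
    using g by (subst nn_integral_0_iff_AE) (auto elim!: eventually_mono simp: not_less indicator_def)
  then have "(\<integral>\<^sup>+x. indicator {x. g x < 0} (u + - 1 * x) \<partial>lborel) = 0"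
    using nn_integral_real_affine[of "indicator {x. g x < 0}" "- 1" u] by simp
  then have "AE x in lborel. indicator {x. g x < 0} (u + - 1 * x) = (0 :: ennreal)"
    by (subst (asm) nn_integral_0_iff_AE) auto
  then show ?thesis by eventually_elim (auto simp: indicator_def not_less split: if_splits)
qed

context levy_process_scale
begin

text \<open>The prescribed transform is that of the exponential law of rate \<open>\<Phi> q\<close>,
  and Laplace transforms determine laws on the half-line. Existence and uniqueness of the limit
  follow at once.\<close>

lemma limit_law_iff:
  assumes q: "0 < q"
  shows "limit_law \<psi> q \<mu> \<longleftrightarrow> \<mu> = exponential_law (\<Phi> q)"
proof -
  note rd = real_distribution_exponential_law[OF \<Phi>_pos[OF q]]
  have s: "(LINT y:{0..}|N. exp (- \<theta> * y)) = (\<integral>y. exp (- \<theta> * y) \<partial>N)"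
    if "real_distribution N" "AE y in N. 0 \<le> y" for N and \<theta> :: real
  proof -
    interpret N: real_distribution N by fact
    show ?thesis
      unfolding set_lebesgue_integral_def using that(2)
      by (intro integral_cong_AE) (auto elim!: eventually_mono)
  qed
  show ?thesis
  proof
    assume \<mu>: "limit_law \<psi> q \<mu>"
    then have \<mu>': "real_distribution \<mu>" "AE y in \<mu>. 0 \<le> y" by (auto simp: limit_law_def)
    show "\<mu> = exponential_law (\<Phi> q)"
    proof (rule laplace_transform_uniqueness[OF \<mu>' rd AE_exponential_law])
      fix \<theta> :: real assume "0 < \<theta>"
      then show "(\<integral>y. exp (- \<theta> * y) \<partial>\<mu>) = (\<integral>y. exp (- \<theta> * y) \<partial>exponential_law (\<Phi> q))"
        using \<mu> s[OF \<mu>', of \<theta>] exponential_law_laplace[OF \<Phi>_pos[OF q], of \<theta>]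
        unfolding limit_law_def by simp
    qed
  next
    assume eq: "\<mu> = exponential_law (\<Phi> q)"
    show "limit_law \<psi> q \<mu>"
      unfolding limit_law_def eq
      using rd AE_exponential_law[of "\<Phi> q"] s[OF rd AE_exponential_law] exponential_law_laplace[OF \<Phi>_pos[OF q]]
      by simp
  qed
qed

section \<open>The measures \<open>mu1\<close> as mixtures\<close>

definition "weight q r = \<Phi> q / \<Phi> (q + r)"

text \<open>The last identity rewrites the absolutely continuous part of \<open>mu1\<close> as
  \<open>1 - weight q r\<close> times an exponential density, so that it complements the atom of
  mass \<open>weight q r\<close>.\<close>

lemma weight:
  assumes "0 < q" "0 < r"
  shows "0 < weight q r" "weight q r < 1"
    and "weight q r * (\<Phi> (q + r) - \<Phi> q) = (1 - weight q r) * \<Phi> q"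
proof -
  have "0 < \<Phi> q" "\<Phi> q < \<Phi> (q + r)" using assms \<Phi>_pos \<Phi>_strict_mono by auto
  then show "0 < weight q r" "weight q r < 1"
    "weight q r * (\<Phi> (q + r) - \<Phi> q) = (1 - weight q r) * \<Phi> q"
    by (simp_all add: weight_def field_simps)
qed

definition atom_part :: "real \<Rightarrow> real \<Rightarrow> real measure" where
  "atom_part q r = density (return borel 0) (\<lambda>_. ennreal (weight q r))"
definition exponential_part :: "real \<Rightarrow> real \<Rightarrow> real measure" where
  "exponential_part q r = density lborel (\<lambda>y. ennreal ((1 - weight q r) * exponential_density (\<Phi> q) y))"

lemma sets_parts: "sets (atom_part q r) = sets borel" "sets (exponential_part q r) = sets borel"
  by (simp_all add: atom_part_def exponential_part_def)

lemma mu1_eq: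
  assumes qr: "0 < q" "0 < r"
  shows "mu1 \<psi> q r = add_measure (atom_part q r) (exponential_part q r)"
proof -
  note w = weight[OF qr]
  have \<Phi>q: "0 < \<Phi> q" by (rule \<Phi>_pos[OF qr(1)])
  have sp: "space (atom_part q r) = UNIV" by (simp add: atom_part_def)
  have eq: "ennreal (\<Phi> q / \<Phi> (q + r)) * (emeasure (return borel 0) A +
       (\<integral>\<^sup>+y\<in>A. indicator {0<..} y * ennreal ((\<Phi> (q + r) - \<Phi> q) * exp (- \<Phi> q * y)) \<partial>lborel)) =
      emeasure (atom_part q r) A + emeasure (exponential_part q r) A"
    if A [measurable]: "A \<in> sets borel" for A
  proof -
    have a: "emeasure (atom_part q r) A = ennreal (weight q r) * emeasure (return borel 0) A"
      unfolding atom_part_def by (subst emeasure_density) (auto simp: nn_integral_return)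
    have "emeasure (exponential_part q r) A =
        (\<integral>\<^sup>+y. ennreal ((1 - weight q r) * exponential_density (\<Phi> q) y) * indicator A y \<partial>lborel)"
      unfolding exponential_part_def by (rule emeasure_density) auto
    also have "\<dots> = (\<integral>\<^sup>+y. ennreal (weight q r) * (indicator {0<..} y * ennreal ((\<Phi> (q + r) - \<Phi> q) * exp (- \<Phi> q * y)) * indicator A y) \<partial>lborel)"
    proof (rule nn_integral_cong_AE)
      show "AE y in lborel. ennreal ((1 - weight q r) * exponential_density (\<Phi> q) y) * indicator A y =
         ennreal (weight q r) * (indicator {0<..} y * ennreal ((\<Phi> (q + r) - \<Phi> q) * exp (- \<Phi> q * y)) * indicator A y)"
        \<comment> \<open>At \<open>0\<close> the exponential density is positive, while the
          indicator of \<open>{0<..}\<close> vanishes.\<close>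
        using AE_lborel_singleton[of 0]
      proof eventually_elim
        case (elim y)
        show ?case
        proof (cases "0 < y")
          case True
          have "(1 - weight q r) * (\<Phi> q * exp (- y * \<Phi> q)) = (1 - weight q r) * \<Phi> q * exp (- \<Phi> q * y)"
            by (simp add: mult.commute)
          also have "\<dots> = weight q r * ((\<Phi> (q + r) - \<Phi> q) * exp (- \<Phi> q * y))"
            unfolding w(3)[symmetric] by simp
          finally have "(1 - weight q r) * exponential_density (\<Phi> q) y = weight q r * ((\<Phi> (q + r) - \<Phi> q) * exp (- \<Phi> q * y))"
            using True by (simp add: exponential_density_def)
          moreover have "0 \<le> (\<Phi> (q + r) - \<Phi> q) * exp (- \<Phi> q * y)"
            using \<Phi>_strict_mono[of q "q + r"] qr by simp
          ultimately show ?thesis using True w(1) by (simp add: ennreal_mult mult.assoc)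
        next
          case False
          then show ?thesis using elim by (simp add: exponential_density_def)
        qed
      qed
    qed
    also have "\<dots> = ennreal (weight q r) * (\<integral>\<^sup>+y\<in>A. indicator {0<..} y * ennreal ((\<Phi> (q + r) - \<Phi> q) * exp (- \<Phi> q * y)) \<partial>lborel)"
      by (rule nn_integral_cmult) measurable
    finally show ?thesis unfolding a weight_def[symmetric] by (simp add: distrib_left)
  qed
  show ?thesis
    unfolding mu1_def Let_def add_measure_def sp sets_parts
    by (rule measure_of_eq) (use eq sets.sigma_sets_eq[of "borel :: real measure"] in auto)
qed

lemma emeasure_parts:
  assumes qr: "0 < q" "0 < r"
  shows "emeasure (atom_part q r) UNIV = ennreal (weight q r)"
    and "emeasure (exponential_part q r) UNIV = ennreal (1 - weight q r)"
proof -
  note w = weight[OF qr]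
  interpret P: prob_space "density lborel (\<lambda>x. ennreal (exponential_density (\<Phi> q) x))"
    by (rule prob_space_exponential_density[OF \<Phi>_pos[OF qr(1)]])
  show "emeasure (atom_part q r) UNIV = ennreal (weight q r)"
    unfolding atom_part_def by (subst emeasure_density) (auto simp: nn_integral_return)
  have "emeasure (exponential_part q r) UNIV =
      (\<integral>\<^sup>+y. ennreal (1 - weight q r) * ennreal (exponential_density (\<Phi> q) y) \<partial>lborel)"
    unfolding exponential_part_def using w
    by (subst emeasure_density) (auto simp: ennreal_mult' intro!: nn_integral_cong)
  also have "\<dots> = ennreal (1 - weight q r) * emeasure (density lborel (\<lambda>x. ennreal (exponential_density (\<Phi> q) x))) UNIV"
    by (subst nn_integral_cmult) (auto simp: emeasure_density)
  finally show "emeasure (exponential_part q r) UNIV = ennreal (1 - weight q r)"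
    using P.emeasure_space_1 by simp
qed

lemma finite_parts:
  assumes qr: "0 < q" "0 < r"
  shows "finite_measure (atom_part q r)" "finite_measure (exponential_part q r)"
proof -
  have sp: "space (atom_part q r) = UNIV" "space (exponential_part q r) = UNIV"
    by (simp_all add: atom_part_def exponential_part_def)
  show "finite_measure (atom_part q r)" "finite_measure (exponential_part q r)"
    by (rule finite_measureI; simp add: sp emeasure_parts[OF qr])+
qed

lemma real_distribution_mu1:
  assumes qr: "0 < q" "0 < r"
  shows "real_distribution (mu1 \<psi> q r)"
proof (rule real_distribution.intro)
  note w = weight[OF qr]
  have sp: "space (mu1 \<psi> q r) = UNIV" using sets_eq_imp_space_eq[OF sets_parts(1)] by (simp add: mu1_eq[OF qr])
  have "emeasure (mu1 \<psi> q r) UNIV = emeasure (atom_part q r) UNIV + emeasure (exponential_part q r) UNIV"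
    unfolding mu1_eq[OF qr] by (rule emeasure_add_measure) (simp_all add: sets_parts)
  also have "\<dots> = ennreal (weight q r) + ennreal (1 - weight q r)"
    by (simp only: emeasure_parts[OF qr])
  also have "\<dots> = 1" using w by (simp flip: ennreal_plus)
  finally show "prob_space (mu1 \<psi> q r)" by (intro prob_spaceI) (simp add: sp)
  show "real_distribution_axioms (mu1 \<psi> q r)"
    by unfold_locales (simp add: mu1_eq[OF qr] sets_parts)
qed

lemma AE_mu1:
  assumes qr: "0 < q" "0 < r"
  shows "AE y in mu1 \<psi> q r. 0 \<le> y"
proof (rule AE_I)
  interpret mu1: real_distribution "mu1 \<psi> q r" by (rule real_distribution_mu1[OF qr])
  show "{y \<in> space (mu1 \<psi> q r). \<not> 0 \<le> y} \<subseteq> {..<0}" by auto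
  show "{..<0} \<in> sets (mu1 \<psi> q r)" by simp
  have "emeasure (mu1 \<psi> q r) {..<0} = emeasure (atom_part q r) {..<0} + emeasure (exponential_part q r) {..<0}"
    unfolding mu1_eq[OF qr] by (rule emeasure_add_measure) (simp_all add: sets_parts)
  also have "emeasure (atom_part q r) {..<0} = 0"
    unfolding atom_part_def by (subst emeasure_density) (auto simp: nn_integral_return)
  also have "emeasure (exponential_part q r) {..<0} =
      (\<integral>\<^sup>+y. ennreal ((1 - weight q r) * exponential_density (\<Phi> q) y) * indicator {..<0} y \<partial>lborel)"
    unfolding exponential_part_def by (rule emeasure_density) auto
  also have "\<dots> = (\<integral>\<^sup>+y. 0 \<partial>(lborel :: real measure))"
  proof (rule nn_integral_cong)
    show "ennreal ((1 - weight q r) * exponential_density (\<Phi> q) y) * indicator {..<0} y = 0" for y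
      by (cases "y < 0") (simp_all add: exponential_density_def)
  qed
  finally show "emeasure (mu1 \<psi> q r) {..<0} = 0" by simp
qed

lemma char_mu1:
  assumes qr: "0 < q" "0 < r"
  shows "char (mu1 \<psi> q r) t = of_real (weight q r) + of_real (1 - weight q r) * char (exponential_law (\<Phi> q)) t"
proof -
  note w = weight[OF qr]
  interpret E: real_distribution "exponential_law (\<Phi> q)"
    by (rule real_distribution_exponential_law[OF \<Phi>_pos[OF qr(1)]])
  interpret A: finite_measure "atom_part q r" by (rule finite_parts[OF qr])
  interpret B: finite_measure "exponential_part q r" by (rule finite_parts[OF qr])
  note [measurable_cong] = sets_parts
  have nn: "0 \<le> exponential_density (\<Phi> q) x" for x
    using \<Phi>_pos[OF qr(1)] by (rule exponential_density_nonneg)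
  have "char (mu1 \<psi> q r) t = (\<integral>x. iexp (t * x) \<partial>atom_part q r) + (\<integral>x. iexp (t * x) \<partial>exponential_part q r)"
    unfolding char_def mu1_eq[OF qr]
  proof (rule integral_add_measure_complex)
    show "integrable (atom_part q r) (\<lambda>x. iexp (t * x))"
      by (rule A.integrable_const_bound[where B = 1]) auto
    show "integrable (exponential_part q r) (\<lambda>x. iexp (t * x))"
      by (rule B.integrable_const_bound[where B = 1]) auto
  qed (simp add: sets_parts)
  also have "(\<integral>x. iexp (t * x) \<partial>atom_part q r) = (\<integral>x. weight q r *\<^sub>R iexp (t * x) \<partial>return borel 0)"
    unfolding atom_part_def using w by (intro integral_density) auto
  also have "\<dots> = of_real (weight q r)"
    by (subst integral_return) (auto simp: scaleR_conv_of_real)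
  also have "(\<integral>x. iexp (t * x) \<partial>exponential_part q r) =
      (\<integral>x. ((1 - weight q r) * exponential_density (\<Phi> q) x) *\<^sub>R iexp (t * x) \<partial>lborel)"
    unfolding exponential_part_def using w nn by (intro integral_density) auto
  also have "\<dots> = (\<integral>x. (1 - weight q r) *\<^sub>R (exponential_density (\<Phi> q) x *\<^sub>R iexp (t * x)) \<partial>lborel)"
    by simp
  also have "\<dots> = (1 - weight q r) *\<^sub>R (\<integral>x. exponential_density (\<Phi> q) x *\<^sub>R iexp (t * x) \<partial>lborel)"
    by (rule integral_scaleR_right)
  also have "(\<integral>x. exponential_density (\<Phi> q) x *\<^sub>R iexp (t * x) \<partial>lborel) = char (exponential_law (\<Phi> q)) t"
    unfolding char_def exponential_law_def using nn by (intro integral_density[symmetric]) auto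
  finally show ?thesis by (simp add: scaleR_conv_of_real)
qed

lemma weight_tendsto: "((\<lambda>r. weight q r) \<longlongrightarrow> 0) at_top"
  unfolding weight_def
proof (rule tendsto_divide_0[OF tendsto_const])
  have "filterlim (\<lambda>r. q + r) at_top (at_top :: real filter)"
    by (rule filterlim_tendsto_add_at_top[OF tendsto_const filterlim_ident])
  from filterlim_compose[OF \<Phi>_at_top this]
  show "filterlim (\<lambda>r. \<Phi> (q + r)) at_infinity at_top"
    by (rule filterlim_at_top_imp_at_infinity)
qed

lemma char_mu1_tendsto:
  assumes q: "0 < q"
  shows "((\<lambda>r. char (mu1 \<psi> q r) t) \<longlongrightarrow> char (exponential_law (\<Phi> q)) t) at_top"
proof -
  have "((\<lambda>r. of_real (weight q r) + of_real (1 - weight q r) * char (exponential_law (\<Phi> q)) t) \<longlongrightarrow>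
      of_real 0 + of_real (1 - 0) * char (exponential_law (\<Phi> q)) t) at_top"
    by (intro tendsto_intros weight_tendsto)
  then have l: "((\<lambda>r. of_real (weight q r) + of_real (1 - weight q r) * char (exponential_law (\<Phi> q)) t) \<longlongrightarrow>
      char (exponential_law (\<Phi> q)) t) at_top" by simp
  have "eventually (\<lambda>r. of_real (weight q r) + of_real (1 - weight q r) * char (exponential_law (\<Phi> q)) t
     = char (mu1 \<psi> q r) t) at_top"
    using eventually_gt_at_top[of 0] by eventually_elim (simp only: char_mu1[OF q])
  then show ?thesis by (rule Lim_transform_eventually[OF l])
qed

section \<open>The measures \<open>mu2\<close> as convolutions, and their limit\<close>

lemma resolvent_density_measurable:
  assumes "0 \<le> p"
  shows "resolvent_density \<psi> W p \<in> borel_measurable borel"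
proof -
  have [measurable]: "W p \<in> borel_measurable borel" by (rule scale_function_measurable[OF scale[OF assms]])
  show ?thesis unfolding resolvent_density_def[abs_def] by measurable
qed

text \<open>Computed with nonnegative integrals, where Tonelli's theorem applies without
  integrability: the atom contributes \<open>g\<close>, the exponential part the integral over
  \<open>y\<close>. Passing to the Bochner integral in \<open>mu2\<close> requires the latter to be
  finite, which is shown for almost every \<open>u\<close>; for densities that suffices.\<close>

lemma mu2_eq:
  assumes qr: "0 < q" "0 < r"
  shows "mu2 \<psi> W q r = convolution (mu1 \<psi> q r) (resolvent_law (q + r))"
proof -
  define p where "p = q + r"
  have p: "0 < p" using qr by (simp add: p_def)
  define g where "g = resolvent_density \<psi> W p"
  have gm [measurable]: "g \<in> borel_measurable borel"
    unfolding g_def using p by (intro resolvent_density_measurable) simp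
  have g0: "AE u in lborel. 0 \<le> g u" unfolding g_def by (rule resolvent_law_eq(2)[OF p])
  have R: "resolvent_law p = density lborel (\<lambda>u. ennreal (p * g u))"
    unfolding g_def by (rule resolvent_law_eq(1)[OF p])
  define \<rho> where "\<rho> = weight q r"
  note w = weight[OF qr, folded \<rho>_def]
  have \<Phi>q: "0 < \<Phi> q" by (rule \<Phi>_pos[OF qr(1)])
  have \<Phi>qp: "\<Phi> q < \<Phi> p" unfolding p_def using qr by (intro \<Phi>_strict_mono) auto
  define e where "e = (\<lambda>y. (1 - \<rho>) * exponential_density (\<Phi> q) y)"
  have em [measurable]: "e \<in> borel_measurable borel" unfolding e_def by measurable
  \<comment> \<open>The contribution of the exponential part, possibly infinite at this
    stage.\<close>
  define k where "k u = (\<integral>\<^sup>+x. ennreal (e x) * ennreal (p * g (u - x)) \<partial>lborel)" for u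
  have km [measurable]: "k \<in> borel_measurable borel" unfolding k_def by measurable
  interpret R: real_distribution "resolvent_law p" by (rule real_distribution_resolvent_law[OF p])
  interpret mu1: real_distribution "mu1 \<psi> q r" by (rule real_distribution_mu1[OF qr])
  have conv: "(\<integral>\<^sup>+u. f u \<partial>convolution (mu1 \<psi> q r) (resolvent_law p)) =
      (\<integral>\<^sup>+u. (ennreal (\<rho> * p * g u) + k u) * f u \<partial>lborel)"
    if f [measurable]: "f \<in> borel_measurable borel" for f :: "real \<Rightarrow> ennreal"
  proof -
    define F where "F x = (\<integral>\<^sup>+u. ennreal (p * g (u - x)) * f u \<partial>lborel)" for x
    have Fm [measurable]: "F \<in> borel_measurable borel" unfolding F_def by measurable
    have F: "(\<integral>\<^sup>+y. f (x + y) \<partial>resolvent_law p) = F x" for x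
    proof -
      have "(\<integral>\<^sup>+y. f (x + y) \<partial>resolvent_law p) = (\<integral>\<^sup>+y. ennreal (p * g y) * f (x + y) \<partial>lborel)"
        unfolding R by (rule nn_integral_density) measurable
      also have "\<dots> = F x"
        unfolding F_def
        using nn_integral_real_affine[of "\<lambda>y. ennreal (p * g y) * f (x + y)" 1 "- x"] by simp
      finally show ?thesis .
    qed
    have "(\<integral>\<^sup>+u. f u \<partial>convolution (mu1 \<psi> q r) (resolvent_law p)) = (\<integral>\<^sup>+x. F x \<partial>mu1 \<psi> q r)"
      by (subst nn_integral_convolution) (simp_all add: F mu1.finite_measure_axioms R.finite_measure_axioms)
    also have "\<dots> = (\<integral>\<^sup>+x. F x \<partial>atom_part q r) + (\<integral>\<^sup>+x. F x \<partial>exponential_part q r)"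
      unfolding mu1_eq[OF qr] by (rule nn_integral_add_measure) (simp_all add: atom_part_def exponential_part_def)
    also have "(\<integral>\<^sup>+x. F x \<partial>atom_part q r) = ennreal \<rho> * F 0"
      unfolding atom_part_def \<rho>_def by (subst nn_integral_density) (auto simp: nn_integral_return)
    also have "\<dots> = (\<integral>\<^sup>+u. ennreal (\<rho> * p * g u) * f u \<partial>lborel)"
      unfolding F_def using w p
      by (subst nn_integral_cmult[symmetric]) (auto intro!: nn_integral_cong simp: ennreal_mult' mult.assoc)
    also have "(\<integral>\<^sup>+x. F x \<partial>exponential_part q r) = (\<integral>\<^sup>+x. ennreal (e x) * F x \<partial>lborel)"
      unfolding exponential_part_def e_def \<rho>_def by (rule nn_integral_density) measurable
    also have "\<dots> = (\<integral>\<^sup>+x. (\<integral>\<^sup>+u. ennreal (e x) * (ennreal (p * g (u - x)) * f u) \<partial>lborel) \<partial>lborel)"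
      unfolding F_def by (intro nn_integral_cong nn_integral_cmult[symmetric]) measurable
    also have "\<dots> = (\<integral>\<^sup>+u. (\<integral>\<^sup>+x. ennreal (e x) * (ennreal (p * g (u - x)) * f u) \<partial>lborel) \<partial>lborel)"
      by (rule lborel_pair.Fubini') measurable
    also have "\<dots> = (\<integral>\<^sup>+u. k u * f u \<partial>lborel)"
      unfolding k_def mult.assoc[symmetric] by (intro nn_integral_cong nn_integral_multc) measurable
    also have "(\<integral>\<^sup>+u. ennreal (\<rho> * p * g u) * f u \<partial>lborel) + (\<integral>\<^sup>+u. k u * f u \<partial>lborel) =
       (\<integral>\<^sup>+u. (ennreal (\<rho> * p * g u) + k u) * f u \<partial>lborel)"
      unfolding distrib_right by (rule nn_integral_add[symmetric]) measurable
    finally show ?thesis .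
  qed
  interpret C: real_distribution "convolution (mu1 \<psi> q r) (resolvent_law p)"
    by (rule real_distribution_convolution) unfold_locales
  \<comment> \<open>The convolution has total mass \<open>1\<close>, which makes \<open>k\<close>
    finite almost everywhere.\<close>
  have "(\<integral>\<^sup>+u. (ennreal (\<rho> * p * g u) + k u) * 1 \<partial>lborel) = 1"
    using conv[of "\<lambda>_. 1"] C.emeasure_space_1 by simp
  moreover have "(\<integral>\<^sup>+u. k u \<partial>lborel) \<le> (\<integral>\<^sup>+u. (ennreal (\<rho> * p * g u) + k u) * 1 \<partial>lborel)"
    by (intro nn_integral_mono) simp
  ultimately have "(\<integral>\<^sup>+u. k u \<partial>lborel) \<noteq> \<infinity>" by (auto simp: top_unique)
  then have kfin: "AE u in lborel. k u \<noteq> \<infinity>" by (intro nn_integral_PInf_AE) auto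
  have "AE u in lborel. ennreal (p * \<Phi> q / \<Phi> p * (g u + (\<Phi> p - \<Phi> q) * (LBINT y:{0..}. exp (- \<Phi> q * y) * g (u - y)))) =
      ennreal (\<rho> * p * g u) + k u"
    using kfin g0
  proof eventually_elim
    case (elim u)
    define h where "h y = indicator {0..} y *\<^sub>R (exp (- \<Phi> q * y) * g (u - y))" for y
    have hm [measurable]: "h \<in> borel_measurable borel" unfolding h_def by measurable
    have h0: "AE y in lborel. 0 \<le> h y"
      using AE_reflect[OF g0 gm, of u] by eventually_elim (simp add: h_def)
    define C where "C = (1 - \<rho>) * \<Phi> q * p"
    have C: "0 < C" using w p \<Phi>q by (simp add: C_def)
    have eg: "e y * (p * g (u - y)) = C * h y" for y
      by (cases "y < 0") (simp_all add: e_def h_def C_def exponential_density_def mult_ac)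
    have e0: "0 \<le> e y" for y using w \<Phi>q by (simp add: e_def exponential_density_nonneg)
    have "k u = (\<integral>\<^sup>+y. ennreal C * ennreal (h y) \<partial>lborel)"
      unfolding k_def
    proof (rule nn_integral_cong)
      fix y
      have "ennreal (e y) * ennreal (p * g (u - y)) = ennreal (e y * (p * g (u - y)))"
        using e0[of y] by (simp add: ennreal_mult')
      then show "ennreal (e y) * ennreal (p * g (u - y)) = ennreal C * ennreal (h y)"
        unfolding eg using C by (simp add: ennreal_mult')
    qed
    also have "\<dots> = ennreal C * (\<integral>\<^sup>+y. ennreal (h y) \<partial>lborel)" by (rule nn_integral_cmult) measurable
    finally have ku: "k u = ennreal C * (\<integral>\<^sup>+y. ennreal (h y) \<partial>lborel)" .
    then have hfin: "(\<integral>\<^sup>+y. ennreal (h y) \<partial>lborel) \<noteq> \<top>"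
      using elim(1) C by (auto simp: ennreal_mult_top)
    \<comment> \<open>Both sides would be the default \<open>0\<close> if the nonnegative integral
      were infinite; \<open>hfin\<close> excludes that case when \<open>k u\<close> is expressed
      through this value.\<close>
    have I: "(LBINT y:{0..}. exp (- \<Phi> q * y) * g (u - y)) = enn2real (\<integral>\<^sup>+y. ennreal (h y) \<partial>lborel)"
      unfolding set_lebesgue_integral_def h_def[symmetric] using h0 by (intro integral_eq_nn_integral) auto
    define I where "I = (LBINT y:{0..}. exp (- \<Phi> q * y) * g (u - y))"
    have I0: "0 \<le> I" unfolding I_def I by simp
    have "k u = ennreal C * ennreal I" using ku hfin unfolding I_def I by (simp add: less_top)
    also have "\<dots> = ennreal (C * I)" using C I0 by (simp add: ennreal_mult)
    finally have k: "k u = ennreal (C * I)" .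
    have "p * \<Phi> q / \<Phi> p = \<rho> * p" by (simp add: \<rho>_def weight_def p_def mult.commute)
    then have "p * \<Phi> q / \<Phi> p * (g u + (\<Phi> p - \<Phi> q) * I) = \<rho> * p * g u + \<rho> * (\<Phi> p - \<Phi> q) * p * I"
      by (simp only: distrib_left mult_ac)
    also have "\<rho> * (\<Phi> p - \<Phi> q) * p * I = C * I"
      using w(3) by (simp add: C_def p_def)
    finally show ?case
      unfolding I_def[symmetric] k using elim(2) C I0 w p by (simp add: ennreal_plus)
  qed
  then have "mu2 \<psi> W q r = density lborel (\<lambda>u. ennreal (\<rho> * p * g u) + k u)"
    unfolding mu2_def Let_def p_def[symmetric] g_def[symmetric]
    by (intro density_cong) (simp_all add: set_lebesgue_integral_def)
  also have "\<dots> = convolution (mu1 \<psi> q r) (resolvent_law p)"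
  proof (rule measure_eqI)
    fix A assume "A \<in> sets (density lborel (\<lambda>u. ennreal (\<rho> * p * g u) + k u))"
    then have [measurable]: "A \<in> sets borel" by simp
    show "emeasure (density lborel (\<lambda>u. ennreal (\<rho> * p * g u) + k u)) A = emeasure (convolution (mu1 \<psi> q r) (resolvent_law p)) A"
      using conv[of "indicator A"] by (simp add: emeasure_density)
  qed simp
  finally show ?thesis unfolding p_def .
qed

text \<open>Chebyshev's argument with \<open>(exp u - 1)^2\<close> in place of \<open>u^2\<close>:
  it stays away from \<open>0\<close> off each neighbourhood of \<open>0\<close>, and its mean
  involves the exponential moments of orders \<open>1\<close> and \<open>2\<close> only.\<close>

lemma resolvent_law_tendsto: "((\<lambda>p. char (resolvent_law p) t) \<longlongrightarrow> 1) at_top"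
proof (rule tendstoI)
  fix \<epsilon> :: real assume \<epsilon>: "0 < \<epsilon>"
  \<comment> \<open>\<open>\<bar>t\<bar> + 1\<close> keeps the denominator positive at
    \<open>t = 0\<close>.\<close>
  define \<eta> where "\<eta> = \<epsilon> / (2 * (\<bar>t\<bar> + 1))"
  have \<eta>: "0 < \<eta>" using \<epsilon> by (simp add: \<eta>_def)
  have t\<eta>: "\<bar>t\<bar> * \<eta> \<le> \<epsilon> / 2" using \<epsilon> by (simp add: \<eta>_def field_simps)
  \<comment> \<open>A lower bound for \<open>(exp u - 1)^2\<close> when
    \<open>\<bar>u\<bar> \<ge> \<eta>\<close>, with equality at \<open>u = - \<eta>\<close>.\<close>
  define m where "m = (1 - exp (- \<eta>))\<^sup>2"
  have m: "0 < m" using \<eta> by (simp add: m_def)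
  have bound: "norm (iexp (t * u) - 1) \<le> \<epsilon> / 2 + 2 / m * (exp u - 1)\<^sup>2" for u
  proof (cases "\<bar>u\<bar> < \<eta>")
    case True
    have "norm (iexp (t * u) - 1) \<le> \<bar>t * u\<bar>"
      using iexp_approx1[of "t * u" 0] by simp
    also have "\<dots> \<le> \<bar>t\<bar> * \<eta>" using True by (simp add: abs_mult mult_left_mono)
    also have "\<dots> \<le> \<epsilon> / 2" by (rule t\<eta>)
    also have "\<dots> \<le> \<epsilon> / 2 + 2 / m * (exp u - 1)\<^sup>2" using m by simp
    finally show ?thesis .
  next
    case False
    have "1 - exp (- \<eta>) \<le> \<bar>exp u - 1\<bar>"
    proof (cases "0 \<le> u")
      case True
      then have "exp \<eta> \<le> exp u" using False by simp
      \<comment> \<open>Hence \<open>exp \<eta> - 1 \<ge> 1 - exp (- \<eta>)\<close>: positive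
        \<open>u\<close> are the better case.\<close>
      moreover have "2 \<le> exp \<eta> + exp (- \<eta>)"
        using exp_ge_add_one_self[of \<eta>] exp_ge_add_one_self[of "- \<eta>"] by linarith
      ultimately show ?thesis by linarith
    next
      case neg: False
      then have "exp u \<le> exp (- \<eta>)" using False by simp
      then show ?thesis by linarith
    qed
    moreover have "0 \<le> 1 - exp (- \<eta>)" using \<eta> by simp
    ultimately have "m \<le> (exp u - 1)\<^sup>2"
      unfolding m_def by (metis power2_abs power_mono)
    then have "2 \<le> 2 / m * (exp u - 1)\<^sup>2" using m by (simp add: field_simps)
    moreover have "norm (iexp (t * u) - 1) \<le> 2"
      using norm_triangle_ineq4[of "iexp (t * u)" 1] by simp
    ultimately show ?thesis using \<epsilon> by linarith
  qed
  \<comment> \<open>Once \<open>\<Phi> p > 2\<close>, this is the mean of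
    \<open>(exp u - 1)^2\<close> under \<open>resolvent_law p\<close>; the limits of its terms sum
    to \<open>1 - 2 + 1 = 0\<close>.\<close>
  define s where "s p = p / (p - \<psi> 2) - 2 * (p / (p - \<psi> 1)) + 1" for p
  have l: "((\<lambda>p. p / (p - a)) \<longlongrightarrow> 1) at_top" for a :: real by real_asymp
  have "(s \<longlongrightarrow> 1 - 2 * 1 + 1) at_top" unfolding s_def by (intro tendsto_intros l)
  then have "(s \<longlongrightarrow> 0) at_top" by simp
  \<comment> \<open>Below this threshold the term \<open>2 / m * s p\<close> is less than
    \<open>\<epsilon> / 2\<close>.\<close>
  moreover have "0 < \<epsilon> * m / 4" using \<epsilon> m by simp
  ultimately have s: "eventually (\<lambda>p. s p < \<epsilon> * m / 4) at_top" by (rule order_tendstoD)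
  \<comment> \<open>From here on the orders \<open>1\<close> and \<open>2\<close> lie in the range
    where the transform formula is available.\<close>
  have \<Phi>: "eventually (\<lambda>p. 2 < \<Phi> p) at_top"
    using \<Phi>_at_top by (simp add: filterlim_at_top_dense)
  show "eventually (\<lambda>p. dist (char (resolvent_law p) t) 1 < \<epsilon>) at_top"
    using s \<Phi> eventually_gt_at_top[of 0]
  proof eventually_elim
    case (elim p)
    interpret R: real_distribution "resolvent_law p" by (rule real_distribution_resolvent_law[OF elim(3)])
    have h: "has_bochner_integral (resolvent_law p) (\<lambda>u. exp (2 * u)) (p / (p - \<psi> 2))"
      "has_bochner_integral (resolvent_law p) (\<lambda>u. exp (1 * u)) (p / (p - \<psi> 1))"
      using elim by (intro resolvent_law_has_transform; simp)+
    have "(exp u - 1)\<^sup>2 = exp (2 * u) - 2 * exp (1 * u) + 1" for u :: real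
      by (simp add: power2_eq_square algebra_simps flip: exp_add)
    moreover have "has_bochner_integral (resolvent_law p) (\<lambda>u. exp (2 * u) - 2 * exp (1 * u) + 1) (s p)"
      unfolding s_def using h R.prob_space
      by (intro has_bochner_integral_add has_bochner_integral_diff has_bochner_integral_mult_right)
        (auto simp: has_bochner_integral_iff)
    ultimately have sq: "has_bochner_integral (resolvent_law p) (\<lambda>u. (exp u - 1)\<^sup>2) (s p)" by simp
    have i: "integrable (resolvent_law p) (\<lambda>u. iexp (t * u) - 1)"
      by (rule R.integrable_const_bound[where B = 2])
        (auto intro!: AE_I2 order_trans[OF norm_triangle_ineq4])
    have "char (resolvent_law p) t - 1 = (\<integral>u. iexp (t * u) - 1 \<partial>resolvent_law p)"
      unfolding char_def using R.integrable_iexp[of "\<lambda>u. t * u"] R.prob_space by simp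
    also have "norm \<dots> \<le> (\<integral>u. \<epsilon> / 2 + 2 / m * (exp u - 1)\<^sup>2 \<partial>resolvent_law p)"
    proof (rule order_trans[OF integral_norm_bound integral_mono])
      show "integrable (resolvent_law p) (\<lambda>u. norm (iexp (t * u) - 1))" using i by (rule integrable_norm)
      show "integrable (resolvent_law p) (\<lambda>u. \<epsilon> / 2 + 2 / m * (exp u - 1)\<^sup>2)"
        using sq by (intro Bochner_Integration.integrable_add integrable_mult_right) (auto simp: has_bochner_integral_iff)
    qed (rule bound)
    also have "\<dots> = \<epsilon> / 2 + 2 / m * s p"
      using sq R.prob_space by (subst Bochner_Integration.integral_add) (auto simp: has_bochner_integral_iff)
    also have "\<dots> < \<epsilon> / 2 + 2 / m * (\<epsilon> * m / 4)"
      using elim(1) m by (intro add_strict_left_mono mult_strict_left_mono) auto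
    also have "\<dots> = \<epsilon>" using m by simp
    finally show ?case by (simp add: dist_norm)
  qed
qed

lemma real_distribution_mu2:
  assumes "0 < q" "0 < r"
  shows "real_distribution (mu2 \<psi> W q r)"
  unfolding mu2_eq[OF assms]
  using assms by (intro real_distribution_convolution real_distribution_mu1 real_distribution_resolvent_law) auto

text \<open>Characteristic functions multiply under convolution and the factor of the resolvent law
  tends to \<open>1\<close>, so \<open>mu2\<close> inherits the limit of \<open>mu1\<close>.\<close>

lemma char_mu2_tendsto:
  assumes q: "0 < q"
  shows "((\<lambda>r. char (mu2 \<psi> W q r) t) \<longlongrightarrow> char (exponential_law (\<Phi> q)) t) at_top"
proof -
  have "filterlim (\<lambda>r. q + r) at_top (at_top :: real filter)"
    by (rule filterlim_tendsto_add_at_top[OF tendsto_const filterlim_ident])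
  from tendsto_mult[OF char_mu1_tendsto[OF q] filterlim_compose[OF resolvent_law_tendsto this]]
  have l: "((\<lambda>r. char (mu1 \<psi> q r) t * char (resolvent_law (q + r)) t) \<longlongrightarrow> char (exponential_law (\<Phi> q)) t) at_top"
    by simp
  have "eventually (\<lambda>r. char (mu1 \<psi> q r) t * char (resolvent_law (q + r)) t = char (mu2 \<psi> W q r) t) at_top"
    using eventually_gt_at_top[of 0]
  proof eventually_elim
    case (elim r)
    then show ?case
      unfolding mu2_eq[OF q elim] using q
      by (intro char_convolution[symmetric] real_distribution_mu1 real_distribution_resolvent_law) auto
  qed
  then show ?thesis by (rule Lim_transform_eventually[OF l])
qed

lemma limit_theorem:
  assumes q: "0 < q"
  shows "(\<forall>r>0. real_distribution (mu1 \<psi> q r) \<and> (AE y in mu1 \<psi> q r. 0 \<le> y) \<and>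
                 real_distribution (mu2 \<psi> W q r)) \<and>
         (\<exists>!\<mu>. limit_law \<psi> q \<mu>) \<and>
         (\<forall>\<mu>. limit_law \<psi> q \<mu> \<longrightarrow>
            weak_conv_along (mu1 \<psi> q) \<mu> at_top \<and>
            weak_conv_along (mu2 \<psi> W q) \<mu> at_top)"
  unfolding limit_law_iff[OF q]
proof (intro conjI allI impI)
  have E: "real_distribution (exponential_law (\<Phi> q))"
    by (rule real_distribution_exponential_law[OF \<Phi>_pos[OF q]])
  show "\<exists>!\<mu>. \<mu> = exponential_law (\<Phi> q)" by simp
  show "weak_conv_along (mu1 \<psi> q) \<mu> at_top" if "\<mu> = exponential_law (\<Phi> q)" for \<mu>
    unfolding that by (rule weak_conv_along_at_topI[OF real_distribution_mu1[OF q] E char_mu1_tendsto[OF q]])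
  show "weak_conv_along (mu2 \<psi> W q) \<mu> at_top" if "\<mu> = exponential_law (\<Phi> q)" for \<mu>
    unfolding that by (rule weak_conv_along_at_topI[OF real_distribution_mu2[OF q] E char_mu2_tendsto[OF q]])
qed (use q in \<open>auto intro: real_distribution_mu1 AE_mu1 real_distribution_mu2\<close>)

end

theorem proposition5p1:
  fixes M :: "'a measure" and X :: "real \<Rightarrow> 'a \<Rightarrow> real"
    and \<psi> :: "real \<Rightarrow> real" and W :: "real \<Rightarrow> real \<Rightarrow> real" and q :: real
  assumes "spectrally_negative_levy_process M X"
    and "\<psi> = laplace_exponent M X"
    and "\<And>p. 0 \<le> p \<Longrightarrow> is_scale_function \<psi> p (W p)"
    and "0 < q"
  shows "(\<forall>r>0. real_distribution (mu1 \<psi> q r) \<and> (AE y in mu1 \<psi> q r. 0 \<le> y) \<and>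
                 real_distribution (mu2 \<psi> W q r)) \<and>
         (\<exists>!\<mu>. limit_law \<psi> q \<mu>) \<and>
         (\<forall>\<mu>. limit_law \<psi> q \<mu> \<longrightarrow>
            weak_conv_along (mu1 \<psi> q) \<mu> at_top \<and>
            weak_conv_along (mu2 \<psi> W q) \<mu> at_top)"
proof -
  interpret spectrally_negative_levy_process M X by fact
  interpret levy_process_scale M X W
    by unfold_locales (use assms(2,3) in simp)
  show ?thesis unfolding assms(2) by (rule limit_theorem[OF assms(4)])
qed

end
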